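(* Let $K$ be an algebraically closed field complete with respect to a nontrivial nonarchimedean absolute value, let $\varphi:\mathbb{P}^N_K\to\mathbb{P}^N_K$ be a morphism of degree $d\ge2$, let $\Phi$ be a lift of $\varphi$, and let $\hat g_\Phi:\mathbb{P}^N(K)\to\mathbb{R}$ be the modified Green function. Let $u=\max\{2d,\ |\operatorname{Res}(\varphi)|^{-2}\}$. Then for all $P,Q\in\mathbb{P}^N(K)$, $$|\hat g_\Phi(P)-\hat g_\Phi(Q)|\le\frac{2u\log u}{d}\,\Delta(P,Q)^{\frac{\log d}{\log u}}.$$ In particular $\hat g_\Phi$ is Hölder continuous.
   Context: For $x\in K^{N+1}$, $\|x\|=\max_i|x_i|$, and $\pi:K^{N+1}\setminus\{0\}\to\mathbb{P}^N(K)$ is the projection. The chordal distance of $P=\pi(x)$, $Q=\pi(y)$ is $\Delta(P,Q)=\max_{i,j}|x_iy_j-x_jy_i|/(\|x\|\,\|y\|)$. A lift of $\varphi$ is a tuple $\Phi=(\Phi_0,\dots,\Phi_N)$ of degree-$d$ homogeneous polynomials over $K$ with no common nontrivial zero and $\varphi\circ\pi=\pi\circ\Phi$; $\|\Phi\|$ is the maximum absolute value of its coefficients, and $\Phi$ is minimal if $\|\Phi\|=1$. $\operatorname{Res}(\varphi)$ is the Macaulay resultant of a minimal lift ($|\operatorname{Res}(\varphi)|$ is well defined, $0<|\operatorname{Res}(\varphi)|\le1$). The Green function is $G_\Phi(x)=\lim_{n\to\infty}d^{-n}\log\|\Phi^n(x)\|$ (the limit exists) and $\hat g_\Phi(P)=G_\Phi(x)-\log\|x\|$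 for $x\in\pi^{-1}(P)$. *)

theory Defs
  imports Complex_Main "HOL-Library.Poly_Mapping" "HOL-Computational_Algebra.Polynomial"
    "HOL-Computational_Algebra.Factorial_Ring"
begin

definition nonarch_abs :: "('k::field \<Rightarrow> real) \<Rightarrow> bool" where
  "nonarch_abs absv \<longleftrightarrow>
     (\<forall>x. 0 \<le> absv x) \<and> (\<forall>x. absv x = 0 \<longleftrightarrow> x = 0) \<and>
     (\<forall>x y. absv (x * y) = absv x * absv y) \<and>
     (\<forall>x y. absv (x + y) \<le> max (absv x) (absv y))"

definition nontrivial_abs :: "('k::field \<Rightarrow> real) \<Rightarrow> bool" where
  "nontrivial_abs absv \<longleftrightarrow> (\<exists>x. x \<noteq> 0 \<and> absv x \<noteq> 1)"

definition complete_abs :: "('k::field \<Rightarrow> real) \<Rightarrow> bool" where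
  "complete_abs absv \<longleftrightarrow>
     (\<forall>X :: nat \<Rightarrow> 'k.
        (\<forall>e>0. \<exists>M. \<forall>m\<ge>M. \<forall>n\<ge>M. absv (X m - X n) < e) \<longrightarrow>
        (\<exists>L. (\<lambda>n. absv (X n - L)) \<longlonglongrightarrow> 0))"

definition alg_closed :: "'k::field itself \<Rightarrow> bool" where
  "alg_closed _ \<longleftrightarrow> (\<forall>p :: 'k poly. 0 < degree p \<longrightarrow> (\<exists>x. poly p x = 0))"

text \<open>A vector of K^(N+1) is a function nat => K; only the entries 0..N matter.\<close>

definition vnorm :: "('k \<Rightarrow> real) \<Rightarrow> nat \<Rightarrow> (nat \<Rightarrow> 'k) \<Rightarrow> real" where
  "vnorm absv N x = Max ((\<lambda>i. absv (x i)) ` {..N})"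

definition nonzero_vec :: "nat \<Rightarrow> (nat \<Rightarrow> 'k::zero) \<Rightarrow> bool" where
  "nonzero_vec N x \<longleftrightarrow> (\<exists>i\<le>N. x i \<noteq> 0)"

definition mons_deg :: "nat \<Rightarrow> nat \<Rightarrow> (nat \<Rightarrow> nat) set" where
  "mons_deg N d = {\<alpha>. (\<forall>i>N. \<alpha> i = 0) \<and> (\<Sum>i\<le>N. \<alpha> i) = d}"

definition heval :: "nat \<Rightarrow> nat \<Rightarrow> ((nat \<Rightarrow> nat) \<Rightarrow> 'k::comm_ring_1) \<Rightarrow> (nat \<Rightarrow> 'k) \<Rightarrow> 'k" where
  "heval N d c x = (\<Sum>\<alpha>\<in>mons_deg N d. c \<alpha> * (\<Prod>i\<le>N. x i ^ \<alpha> i))"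

text \<open>A tuple Phi = (Phi_0..Phi_N) of forms: Phi i is the coefficient function of Phi_i.\<close>

type_synonym 'k hmap = "nat \<Rightarrow> (nat \<Rightarrow> nat) \<Rightarrow> 'k"

definition hmap_apply :: "nat \<Rightarrow> nat \<Rightarrow> 'k::comm_ring_1 hmap \<Rightarrow> (nat \<Rightarrow> 'k) \<Rightarrow> (nat \<Rightarrow> 'k)" where
  "hmap_apply N d Phi x = (\<lambda>i. if i \<le> N then heval N d (Phi i) x else 0)"

definition hmap_norm :: "('k \<Rightarrow> real) \<Rightarrow> nat \<Rightarrow> nat \<Rightarrow> 'k hmap \<Rightarrow> real" where
  "hmap_norm absv N d Phi = Max ((\<lambda>(i, \<alpha>). absv (Phi i \<alpha>)) ` ({..N} \<times> mons_deg N d))"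

text \<open>Phi has no common nontrivial zero (so it is a lift of a morphism of degree d).\<close>

definition no_common_zero :: "nat \<Rightarrow> nat \<Rightarrow> 'k::comm_ring_1 hmap \<Rightarrow> bool" where
  "no_common_zero N d Phi \<longleftrightarrow>
     (\<forall>x. (\<forall>i\<le>N. heval N d (Phi i) x = 0) \<longrightarrow> (\<forall>i\<le>N. x i = 0))"

definition same_proj_map :: "nat \<Rightarrow> nat \<Rightarrow> 'k::field hmap \<Rightarrow> 'k hmap \<Rightarrow> bool" where
  "same_proj_map N d Phi Psi \<longleftrightarrow>
     (\<forall>x. nonzero_vec N x \<longrightarrow>
        (\<exists>l. l \<noteq> 0 \<and> (\<forall>i\<le>N. heval N d (Psi i) x = l * heval N d (Phi i) x)))"

text \<open>Polynomials with integer coefficients in the indeterminates u_(i,alpha)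
  (the coefficient of the monomial alpha in the i-th form).\<close>

type_synonym zpoly = "((nat \<times> (nat \<Rightarrow> nat)) \<Rightarrow>\<^sub>0 nat) \<Rightarrow>\<^sub>0 int"

definition zpoly_eval :: "zpoly \<Rightarrow> (nat \<times> (nat \<Rightarrow> nat) \<Rightarrow> 'r::comm_ring_1) \<Rightarrow> 'r" where
  "zpoly_eval R a =
     (\<Sum>m\<in>Poly_Mapping.keys R. of_int (Poly_Mapping.lookup R m) *
        (\<Prod>v\<in>Poly_Mapping.keys m. a v ^ Poly_Mapping.lookup m v))"

definition zpoly_vars :: "zpoly \<Rightarrow> (nat \<times> (nat \<Rightarrow> nat)) set" where
  "zpoly_vars R = (\<Union>m\<in>Poly_Mapping.keys R. Poly_Mapping.keys m)"

text \<open>Macaulay's characterisation (e.g. Cox--Little--O'Shea, Using Algebraic Geometry,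
  Ch. 3, Thm 2.3): Res is the unique irreducible polynomial over Z in the coefficients
  which vanishes (over C) exactly when the forms have a common nontrivial zero and
  with Res(X_0^d,...,X_N^d) = 1.\<close>

definition is_macaulay_res :: "nat \<Rightarrow> nat \<Rightarrow> zpoly \<Rightarrow> bool" where
  "is_macaulay_res N d R \<longleftrightarrow>
     zpoly_vars R \<subseteq> {..N} \<times> mons_deg N d \<and>
     irreducible R \<and>
     (\<forall>c :: complex hmap.
        zpoly_eval R (\<lambda>(i, \<alpha>). c i \<alpha>) = 0 \<longleftrightarrow>
        (\<exists>z. nonzero_vec N z \<and> (\<forall>i\<le>N. heval N d (c i) z = 0))) \<and>
     zpoly_eval R (\<lambda>(i, \<alpha>). if \<alpha> = (\<lambda>j. if j = i then d else 0) then 1 else 0) = (1::int)"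

definition macaulay_res :: "nat \<Rightarrow> nat \<Rightarrow> zpoly" where
  "macaulay_res N d = (THE R. is_macaulay_res N d R)"

definition Res_of_lift :: "nat \<Rightarrow> nat \<Rightarrow> 'k::comm_ring_1 hmap \<Rightarrow> 'k" where
  "Res_of_lift N d Phi = zpoly_eval (macaulay_res N d) (\<lambda>(i, \<alpha>). Phi i \<alpha>)"

definition minimal_lift_of :: "('k::field \<Rightarrow> real) \<Rightarrow> nat \<Rightarrow> nat \<Rightarrow> 'k hmap \<Rightarrow> 'k hmap \<Rightarrow> bool" where
  "minimal_lift_of absv N d Phi Psi \<longleftrightarrow>
     no_common_zero N d Psi \<and> same_proj_map N d Phi Psi \<and> hmap_norm absv N d Psi = 1"

definition abs_Res :: "('k::field \<Rightarrow> real) \<Rightarrow> nat \<Rightarrow> nat \<Rightarrow> 'k hmap \<Rightarrow> real" where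
  "abs_Res absv N d Phi = absv (Res_of_lift N d (SOME Psi. minimal_lift_of absv N d Phi Psi))"

definition green :: "('k::field \<Rightarrow> real) \<Rightarrow> nat \<Rightarrow> nat \<Rightarrow> 'k hmap \<Rightarrow> (nat \<Rightarrow> 'k) \<Rightarrow> real" where
  "green absv N d Phi x =
     lim (\<lambda>n. ln (vnorm absv N ((hmap_apply N d Phi ^^ n) x)) / real d ^ n)"

text \<open>Modified Green function, evaluated at a representative x of P.\<close>

definition green_hat :: "('k::field \<Rightarrow> real) \<Rightarrow> nat \<Rightarrow> nat \<Rightarrow> 'k hmap \<Rightarrow> (nat \<Rightarrow> 'k) \<Rightarrow> real" where
  "green_hat absv N d Phi x = green absv N d Phi x - ln (vnorm absv N x)"

definition chordal :: "('k::field \<Rightarrow> real) \<Rightarrow> nat \<Rightarrow> (nat \<Rightarrow> 'k) \<Rightarrow> (nat \<Rightarrow> 'k) \<Rightarrow> real" where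
  "chordal absv N x y =
     Max ((\<lambda>(i, j). absv (x i * y j - x j * y i)) ` ({..N} \<times> {..N}))
       / (vnorm absv N x * vnorm absv N y)"

end

theory Submission
  imports Defs "Jordan_Normal_Form.Char_Poly" "HOL-Library.Function_Algebras"
    "HOL-Computational_Algebra.Fundamental_Theorem_Algebra"
begin

hide_const (open) module.smult

text \<open>
  Write \<open>\<rho> = |Res \<phi>|\<close>, take a minimal lift, and put \<open>h(P) = ln (\<parallel>\<Phi> x\<parallel> / \<parallel>x\<parallel> ^ d)\<close>. The modified Green
  function is the sum of \<open>h(\<phi> ^ n P) / d ^ (n + 1)\<close> over \<open>n\<close>. From \<open>\<rho> \<parallel>x\<parallel> ^ d \<le> \<parallel>\<Phi> x\<parallel> \<le> \<parallel>x\<parallel> ^ d\<close> and the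
  ultrametric inequality one obtains that \<open>ln \<rho> \<le> h \<le> 0\<close>, that \<open>h(P) = h(Q)\<close> whenever \<open>\<Delta>(P, Q) < \<rho>\<close>,
  and that \<open>\<phi>\<close> expands \<open>\<Delta>\<close> by at most \<open>\<rho> ^ -2 \<le> u\<close>. Hence only the terms with
  \<open>u ^ n \<Delta>(P, Q) \<ge> \<rho>\<close> contribute to the difference of Green functions, and summing the geometric
  tail gives the Hoelder bound.

  The lower bound for \<open>\<parallel>\<Phi> x\<parallel>\<close> needs the resultant itself. Let \<open>T\<close> be the prime ideal of
  integer polynomials in the coefficients of \<open>N + 1\<close> forms that vanish on all systems with a
  common zero. Over the subring omitting the coefficient of \<open>X_0 ^ d\<close> in the zeroth form, \<open>T\<close> has no
  nonzero element, so by Gauss's lemma \<open>T\<close> is principal, and its normalised generator is the unique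
  polynomial with Macaulay's properties. A maximal minor of a Macaulay matrix lies in \<open>T\<close>, and by
  the Nullstellensatz some such minor is nonzero at any given system without a common zero, over any
  algebraically closed field; so the resultant is nonzero there. Finally, if \<open>\<parallel>x\<parallel> = 1\<close>, changing one
  coefficient of each form by at most \<open>\<parallel>\<Phi> x\<parallel>\<close> makes \<open>x\<close> a common zero, whence \<open>\<rho> \<le> \<parallel>\<Phi> x\<parallel>\<close>
  because integer polynomials are 1-Lipschitz on the unit polydisc.
\<close>

subsection \<open>Unique factorization in subrings\<close>

text \<open>\<open>macaulay_res\<close> is pinned down by its complex zeros, but its nonvanishing is
  needed over a field of arbitrary characteristic. The bridge is divisibility between integer
  polynomials: a relation \<open>R dvd mac_minor N D \<sigma>\<close> can be evaluated in any
  commutative ring, so a minor that is nonzero at a system over \<open>K\<close> makes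
  \<open>R\<close> nonzero there. One minor takes the value 1 at the power forms; hence the
  generator takes the value 1 or -1 there, and the normalisation in \<open>is_macaulay_res\<close>
  fixes the sign and leaves no room for an integer factor. Rings are subsets of a type because the
  number of variables changes during the inductions: coefficients are adjoined one by one in the
  factorisation theory, and coordinates are removed one by one in the Nullstellensatz. A further
  obstacle is that \<open>same_proj_map\<close> supplies a scalar at each point separately. Iterates
  of \<open>Phi\<close> can be compared with those of a minimal lift only after this scalar is known
  to be constant, which rests on algebraic closedness.\<close>

definition ring_on :: "'a::comm_ring_1 set \<Rightarrow> bool" where
  "ring_on R \<longleftrightarrow> 1 \<in> R \<and> (\<forall>x\<in>R. \<forall>y\<in>R. x + y \<in> R \<and> x * y \<in> R \<and> - x \<in> R)"

lemma ring_onD: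
  assumes "ring_on R"
  shows "1 \<in> R" "0 \<in> R" "x \<in> R \<Longrightarrow> y \<in> R \<Longrightarrow> x + y \<in> R" "x \<in> R \<Longrightarrow> y \<in> R \<Longrightarrow> x * y \<in> R"
    "x \<in> R \<Longrightarrow> - x \<in> R" "x \<in> R \<Longrightarrow> y \<in> R \<Longrightarrow> x - y \<in> R"
proof -
  show a: "1 \<in> R" "x \<in> R \<Longrightarrow> y \<in> R \<Longrightarrow> x + y \<in> R" "x \<in> R \<Longrightarrow> y \<in> R \<Longrightarrow> x * y \<in> R" "x \<in> R \<Longrightarrow> - x \<in> R" for x y
    using assms by (auto simp: ring_on_def)
  show "0 \<in> R" using a(2)[OF a(1) a(4)[OF a(1)]] by simp
  show "x \<in> R \<Longrightarrow> y \<in> R \<Longrightarrow> x - y \<in> R" using a(2)[of x "- y"] a(4)[of y] by simp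
qed

lemma ring_on_sum: "ring_on R \<Longrightarrow> (\<And>i. i \<in> A \<Longrightarrow> f i \<in> R) \<Longrightarrow> sum f A \<in> R"
  by (induction A rule: infinite_finite_induct) (auto simp: ring_onD)

lemma ring_on_prod: "ring_on R \<Longrightarrow> (\<And>i. i \<in> A \<Longrightarrow> f i \<in> R) \<Longrightarrow> prod f A \<in> R"
  by (induction A rule: infinite_finite_induct) (auto simp: ring_onD)

lemma ring_on_power: "ring_on R \<Longrightarrow> x \<in> R \<Longrightarrow> x ^ n \<in> R"
  by (induction n) (auto simp: ring_onD)

definition domain_on :: "'a::comm_ring_1 set \<Rightarrow> bool" where
  "domain_on S \<longleftrightarrow> ring_on S \<and> (\<forall>x\<in>S. \<forall>y\<in>S. x * y = 0 \<longrightarrow> x = 0 \<or> y = 0)"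

definition dvd_on :: "'a::comm_ring_1 set \<Rightarrow> 'a \<Rightarrow> 'a \<Rightarrow> bool" where
  "dvd_on S a b \<longleftrightarrow> (\<exists>k\<in>S. b = a * k)"

definition irred_on :: "'a::comm_ring_1 set \<Rightarrow> 'a \<Rightarrow> bool" where
  "irred_on S a \<longleftrightarrow> a \<in> S \<and> a \<noteq> 0 \<and> \<not> dvd_on S a 1 \<and>
     (\<forall>b\<in>S. \<forall>c\<in>S. a = b * c \<longrightarrow> dvd_on S b 1 \<or> dvd_on S c 1)"

definition prime_on :: "'a::comm_ring_1 set \<Rightarrow> 'a \<Rightarrow> bool" where
  "prime_on S p \<longleftrightarrow> p \<in> S \<and> (\<forall>a\<in>S. \<forall>b\<in>S. dvd_on S p (a * b) \<longrightarrow> dvd_on S p a \<or> dvd_on S p b)"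

text \<open>Instead of chain conditions, a multiplicative size function guarantees factorisation.\<close>
definition size_on :: "'a::comm_ring_1 set \<Rightarrow> ('a \<Rightarrow> nat) \<Rightarrow> bool" where
  "size_on S sz \<longleftrightarrow> (\<forall>a\<in>S - {0}. \<forall>b\<in>S - {0}. sz (a * b) = sz a * sz b) \<and>
     (\<forall>a\<in>S - {0}. 0 < sz a \<and> (sz a = 1 \<longleftrightarrow> dvd_on S a 1))"

definition ufd_on :: "'a::comm_ring_1 set \<Rightarrow> bool" where
  "ufd_on S \<longleftrightarrow> domain_on S \<and> (\<exists>sz. size_on S sz) \<and> (\<forall>p. irred_on S p \<longrightarrow> prime_on S p)"

definition ideal_on :: "'a::comm_ring_1 set \<Rightarrow> 'a set \<Rightarrow> bool" where
  "ideal_on S J \<longleftrightarrow> J \<subseteq> S \<and> 0 \<in> J \<and> (\<forall>x\<in>J. \<forall>y\<in>J. x + y \<in> J) \<and> (\<forall>s\<in>S. \<forall>x\<in>J. s * x \<in> J)"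

definition poly_on :: "'a::comm_ring_1 set \<Rightarrow> 'a poly set" where
  "poly_on S = {p. \<forall>i. coeff p i \<in> S}"

lemma ring_on_poly_on:
  assumes "ring_on R"
  shows "ring_on (poly_on R)"
proof -
  have "(\<Sum>i\<le>n. coeff x i * coeff y (n - i)) \<in> R" if "x \<in> poly_on R" "y \<in> poly_on R" for x y n
    using that by (intro ring_on_sum[OF assms] ring_onD(4)[OF assms]) (auto simp: poly_on_def)
  then show ?thesis
    unfolding ring_on_def by (auto simp: poly_on_def ring_onD[OF assms] coeff_mult)
qed

lemma domain_onD:
  assumes "domain_on S"
  shows "1 \<in> S" "0 \<in> S" "x \<in> S \<Longrightarrow> y \<in> S \<Longrightarrow> x + y \<in> S" "x \<in> S \<Longrightarrow> y \<in> S \<Longrightarrow> x * y \<in> S"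
    "x \<in> S \<Longrightarrow> - x \<in> S" "x \<in> S \<Longrightarrow> y \<in> S \<Longrightarrow> x - y \<in> S"
    "x \<in> S \<Longrightarrow> y \<in> S \<Longrightarrow> x * y = 0 \<Longrightarrow> x = 0 \<or> y = 0"
proof -
  have r: "ring_on S" using assms by (simp add: domain_on_def)
  show "1 \<in> S" "0 \<in> S" by (rule ring_onD[OF r])+
  show "x \<in> S \<Longrightarrow> y \<in> S \<Longrightarrow> x + y \<in> S" by (rule ring_onD(3)[OF r])
  show "x \<in> S \<Longrightarrow> y \<in> S \<Longrightarrow> x * y \<in> S" by (rule ring_onD(4)[OF r])
  show "x \<in> S \<Longrightarrow> - x \<in> S" by (rule ring_onD(5)[OF r])
  show "x \<in> S \<Longrightarrow> y \<in> S \<Longrightarrow> x - y \<in> S" by (rule ring_onD(6)[OF r])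
  show "x \<in> S \<Longrightarrow> y \<in> S \<Longrightarrow> x * y = 0 \<Longrightarrow> x = 0 \<or> y = 0" using assms by (simp add: domain_on_def)
qed

lemma domain_on_cancel:
  assumes "domain_on S" "x \<in> S" "y \<in> S" "z \<in> S" "x \<noteq> 0" "x * y = x * z"
  shows "y = z"
proof -
  have "x * (y - z) = 0" using assms by (simp add: algebra_simps)
  with domain_onD(7)[OF assms(1,2), of "y - z"] domain_onD(6)[OF assms(1)] assms show ?thesis by auto
qed

lemma dvd_on_add: "domain_on S \<Longrightarrow> dvd_on S p x \<Longrightarrow> dvd_on S p y \<Longrightarrow> dvd_on S p (x + y)"
  unfolding dvd_on_def by (metis distrib_left domain_onD(3))

lemma dvd_on_diff: "domain_on S \<Longrightarrow> dvd_on S p x \<Longrightarrow> dvd_on S p y \<Longrightarrow> dvd_on S p (x - y)"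
  unfolding dvd_on_def by (metis right_diff_distrib domain_onD(6))

lemma dvd_on_mult: "domain_on S \<Longrightarrow> dvd_on S p x \<Longrightarrow> y \<in> S \<Longrightarrow> dvd_on S p (x * y)"
  unfolding dvd_on_def by (metis mult.assoc domain_onD(4))

lemma dvd_on_0: "domain_on S \<Longrightarrow> dvd_on S p 0"
  unfolding dvd_on_def using domain_onD(2) by force

lemma dvd_on_sum:
  assumes "domain_on S" "\<And>i. i \<in> A \<Longrightarrow> dvd_on S p (f i)"
  shows "dvd_on S p (sum f A)"
  using assms(2)
  by (induction A rule: infinite_finite_induct) (auto simp: dvd_on_0[OF assms(1)] dvd_on_add[OF assms(1)])

section \<open>Polynomials over a domain: degrees, Gauss's lemma, pseudo-division\<close>

context
  fixes S :: "'a::comm_ring_1 set"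
  assumes S: "domain_on S"
begin

lemma poly_on_coeff: "p \<in> poly_on S \<Longrightarrow> coeff p i \<in> S"
  by (simp add: poly_on_def)

lemma poly_on_smult: "c \<in> S \<Longrightarrow> p \<in> poly_on S \<Longrightarrow> smult c p \<in> poly_on S"
  by (simp add: poly_on_def domain_onD[OF S])

lemma poly_on_const: "c \<in> S \<Longrightarrow> [:c:] \<in> poly_on S"
  by (auto simp: poly_on_def domain_onD[OF S] coeff_pCons split: nat.split)

lemma poly_on_monom: "c \<in> S \<Longrightarrow> monom c n \<in> poly_on S"
  by (auto simp: poly_on_def domain_onD[OF S])

lemma poly_on_degree_mult:
  assumes "p \<in> poly_on S" "q \<in> poly_on S" "p \<noteq> 0" "q \<noteq> 0"
  shows "degree (p * q) = degree p + degree q" "lead_coeff (p * q) = lead_coeff p * lead_coeff q" "p * q \<noteq> 0"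
proof -
  have "lead_coeff p * lead_coeff q \<noteq> 0"
    using domain_onD(7)[OF S poly_on_coeff[OF assms(1)] poly_on_coeff[OF assms(2)]] assms by force
  then have c: "coeff (p * q) (degree p + degree q) \<noteq> 0" by (simp add: coeff_mult_degree_sum)
  then show "degree (p * q) = degree p + degree q"
    by (intro antisym degree_mult_le le_degree)
  then show "lead_coeff (p * q) = lead_coeff p * lead_coeff q"
    by (simp add: coeff_mult_degree_sum)
  from c show "p * q \<noteq> 0" by auto
qed

lemma domain_on_poly: "domain_on (poly_on S)"
  unfolding domain_on_def
proof (intro conjI ballI impI)
  show "ring_on (poly_on S)" using S by (intro ring_on_poly_on) (simp add: domain_on_def)
  show "x = 0 \<or> y = 0" if "x \<in> poly_on S" "y \<in> poly_on S" "x * y = 0" for x y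
    using poly_on_degree_mult(3)[OF that(1,2)] that(3) by auto
qed

lemma dvd_on_const_poly:
  assumes "p \<in> S" "f \<in> poly_on S"
  shows "dvd_on (poly_on S) [:p:] f \<longleftrightarrow> (\<forall>i. dvd_on S p (coeff f i))"
proof
  assume "dvd_on (poly_on S) [:p:] f"
  then show "\<forall>i. dvd_on S p (coeff f i)" by (auto simp: dvd_on_def poly_on_def)
next
  assume "\<forall>i. dvd_on S p (coeff f i)"
  then obtain q where q: "\<And>i. q i \<in> S" "\<And>i. coeff f i = p * q i" unfolding dvd_on_def by metis
  let ?g = "\<Sum>i\<le>degree f. monom (q i) i"
  have cg: "coeff ?g j = (if j \<le> degree f then q j else 0)" for j
    by (simp add: coeff_sum)
  have "?g \<in> poly_on S" by (simp only: poly_on_def mem_Collect_eq cg) (simp add: q domain_onD[OF S])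
  moreover have "f = [:p:] * ?g"
    by (rule poly_eqI) (auto simp: cg q(2)[symmetric] coeff_eq_0)
  ultimately show "dvd_on (poly_on S) [:p:] f" by (auto simp: dvd_on_def)
qed

text \<open>Gauss's lemma. If \<open>p\<close> divides neither factor, let \<open>i\<close> and
  \<open>j\<close> be the lowest positions of coefficients not divisible by \<open>p\<close>. In the
  coefficient of degree \<open>i + j\<close> of the product, every term except
  \<open>coeff a i * coeff b j\<close> is divisible by \<open>p\<close>.\<close>

lemma prime_on_const_poly:
  assumes p: "prime_on S p"
  shows "prime_on (poly_on S) [:p:]"
  unfolding prime_on_def
proof (intro conjI ballI impI)
  have pS: "p \<in> S" using p by (simp add: prime_on_def)
  then show "[:p:] \<in> poly_on S" by (rule poly_on_const)
  fix a b assume ab: "a \<in> poly_on S" "b \<in> poly_on S" "dvd_on (poly_on S) [:p:] (a * b)"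
  have abS: "a * b \<in> poly_on S" using domain_onD(4)[OF domain_on_poly] ab by blast
  show "dvd_on (poly_on S) [:p:] a \<or> dvd_on (poly_on S) [:p:] b"
  proof (rule ccontr)
    assume "\<not> ?thesis"
    then have ex: "\<exists>i. \<not> dvd_on S p (coeff a i)" "\<exists>i. \<not> dvd_on S p (coeff b i)"
      using dvd_on_const_poly[OF pS] ab by auto
    define i where "i = (LEAST i. \<not> dvd_on S p (coeff a i))"
    define j where "j = (LEAST i. \<not> dvd_on S p (coeff b i))"
    have i: "\<not> dvd_on S p (coeff a i)" "\<And>k. k < i \<Longrightarrow> dvd_on S p (coeff a k)"
      unfolding i_def using LeastI_ex[OF ex(1)] not_less_Least by auto
    have j: "\<not> dvd_on S p (coeff b j)" "\<And>k. k < j \<Longrightarrow> dvd_on S p (coeff b k)"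
      unfolding j_def using LeastI_ex[OF ex(2)] not_less_Least by auto
    have e: "coeff (a * b) (i + j) = coeff a i * coeff b j + (\<Sum>k\<in>{..i+j} - {i}. coeff a k * coeff b (i + j - k))"
      unfolding coeff_mult by (subst sum.remove[of _ i]) auto
    have d: "dvd_on S p (\<Sum>k\<in>{..i+j} - {i}. coeff a k * coeff b (i + j - k))"
    proof (rule dvd_on_sum[OF S])
      fix k assume k: "k \<in> {..i + j} - {i}"
      show "dvd_on S p (coeff a k * coeff b (i + j - k))"
      proof (cases "k < i")
        case True
        then show ?thesis using dvd_on_mult[OF S i(2)] poly_on_coeff[OF ab(2)] by blast
      next
        case False
        with k have "i + j - k < j" by auto
        then show ?thesis using dvd_on_mult[OF S j(2)] poly_on_coeff[OF ab(1)] by (metis mult.commute)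
      qed
    qed
    have "dvd_on S p (coeff (a * b) (i + j))" using dvd_on_const_poly[OF pS abS] ab(3) by blast
    from dvd_on_diff[OF S this d] have "dvd_on S p (coeff a i * coeff b j)"
      unfolding e by simp
    then show False using p i(1) j(1) poly_on_coeff[OF ab(1)] poly_on_coeff[OF ab(2)]
      unfolding prime_on_def by blast
  qed
qed

text \<open>Replaces the statement that over the fraction field an ideal is generated by any element
  of least degree. Cross-multiplying by leading coefficients avoids fractions, at the price of the
  scalar \<open>c\<close>; the difference stays in \<open>J\<close>, so minimality of
  \<open>r\<close> lets the reduction continue down to zero.\<close>

lemma pseudo_division_minimal:
  assumes J: "ideal_on (poly_on S) J" and r: "r \<in> J" "r \<noteq> 0" "\<And>g. g \<in> J \<Longrightarrow> g \<noteq> 0 \<Longrightarrow> degree r \<le> degree g"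
    and g: "g \<in> J"
  shows "\<exists>c\<in>S. \<exists>q\<in>poly_on S. c \<noteq> 0 \<and> smult c g = q * r"
  using g
proof (induction "degree g" arbitrary: g rule: less_induct)
  case less
  have rS: "r \<in> poly_on S" and gS: "g \<in> poly_on S" using J r less(2) by (auto simp: ideal_on_def)
  show ?case
  proof (cases "g = 0")
    case True
    then show ?thesis using domain_onD[OF S] domain_onD[OF domain_on_poly]
      by (intro bexI[of _ 1] bexI[of _ 0]) auto
  next
    case False
    let ?m = "monom (lead_coeff g) (degree g - degree r)"
    let ?g = "smult (lead_coeff r) g - ?m * r"
    have m: "?m \<in> poly_on S" by (intro poly_on_monom poly_on_coeff gS)
    have le: "degree r \<le> degree g" using r(3)[OF less(2) False] .
    have lr: "lead_coeff r \<in> S" "lead_coeff r \<noteq> 0" using poly_on_coeff[OF rS] r(2) by auto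
    have "?g = [:lead_coeff r:] * g + (- ?m) * r" by simp
    also have "\<dots> \<in> J" using J less(2) r(1) poly_on_const[OF lr(1)] domain_onD(5)[OF domain_on_poly m]
      unfolding ideal_on_def by blast
    finally have gJ: "?g \<in> J" .
    have "coeff ?g (degree g) = 0" using le by (simp add: coeff_monom_mult)
    moreover have "degree ?g \<le> degree g"
      by (intro degree_diff_le degree_smult_le order.trans[OF degree_mult_le]) (use le degree_monom_le[of "lead_coeff g" "degree g - degree r"] in auto)
    \<comment> \<open>The second alternative is needed when \<open>g\<close> is constant, since then
      the degree cannot drop.\<close>
    ultimately have cases: "degree ?g < degree g \<or> ?g = 0"
      by (metis coeff_0_degree_minus_1 eq_zero_or_degree_less le_neq_implies_less leading_coeff_0_iff)
    have "\<exists>c\<in>S. \<exists>q\<in>poly_on S. c \<noteq> 0 \<and> smult c ?g = q * r"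
    proof (cases "?g = 0")
      case True
      then show ?thesis using domain_onD[OF S] domain_onD[OF domain_on_poly]
        by (intro bexI[of _ 1] bexI[of _ 0]) auto
    next
      case False
      then show ?thesis using less(1)[OF _ gJ] cases by blast
    qed
    then obtain c q where cq: "c \<in> S" "q \<in> poly_on S" "c \<noteq> 0" "smult c ?g = q * r" by blast
    have "smult (c * lead_coeff r) g = (q + smult c ?m) * r"
      using cq(4) by (simp add: smult_diff_right algebra_simps)
    moreover have "c * lead_coeff r \<noteq> 0" using domain_onD(7)[OF S cq(1) lr(1)] cq(3) lr(2) by blast
    ultimately show ?thesis
      using domain_onD(4)[OF S cq(1) lr(1)] domain_onD(3)[OF domain_on_poly cq(2) poly_on_smult[OF cq(1) m]] by blast
  qed
qed

end

lemma ideal_minimal_degree: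
  assumes "f \<in> J" "f \<noteq> 0"
  shows "\<exists>r. r \<in> J \<and> r \<noteq> 0 \<and> (\<forall>g. g \<in> J \<longrightarrow> g \<noteq> 0 \<longrightarrow> degree r \<le> degree g)"
  using ex_has_least_nat[of "\<lambda>g. g \<in> J \<and> g \<noteq> 0" f degree] assms by auto

section \<open>Factoriality of polynomial rings and principal prime ideals\<close>

context
  fixes S :: "'a::comm_ring_1 set" and sz :: "'a \<Rightarrow> nat"
  assumes S: "domain_on S" and sz: "size_on S sz" and ip: "\<And>p. irred_on S p \<Longrightarrow> prime_on S p"
begin

private lemma SPs: "domain_on (poly_on S)" by (rule domain_on_poly[OF S])

text \<open>Does the work of contents without gcds: a scalar dividing a product can be distributed
  over the two factors. Induction on the size of \<open>c\<close>: an irreducible \<open>c\<close>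
  is prime and by Gauss's lemma divides one factor outright, and a reducible one is removed in two
  rounds.\<close>

lemma split_scalar:
  assumes "c \<in> S" "c \<noteq> 0" "q \<in> poly_on S" "r \<in> poly_on S" "h \<in> poly_on S" "smult c h = q * r"
  shows "\<exists>c1\<in>S. \<exists>c2\<in>S. \<exists>q1\<in>poly_on S. \<exists>r1\<in>poly_on S. c = c1 * c2 \<and> q = smult c1 q1 \<and> r = smult c2 r1 \<and> h = q1 * r1"
  using assms
proof (induction "sz c" arbitrary: c q r h rule: less_induct)
  case less
  note pc = domain_onD[OF SPs] and sc = domain_onD[OF S]
  have cancel: "x = y" if "smult a x = smult a y" "a \<in> S" "a \<noteq> 0" "x \<in> poly_on S" "y \<in> poly_on S" for a x y
    using domain_on_cancel[OF SPs poly_on_const[OF S, of a], of x y] that by auto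
  consider (unit) "dvd_on S c 1" | (irr) "irred_on S c"
    | (red) a b where "a \<in> S" "b \<in> S" "c = a * b" "\<not> dvd_on S a 1" "\<not> dvd_on S b 1"
    using less(2,3) unfolding irred_on_def by blast
  then show ?case
  proof cases
    case unit
    then obtain k where k: "k \<in> S" "1 = c * k" by (auto simp: dvd_on_def)
    have "h = smult (c * k) h" using k(2)[symmetric] by simp
    also have "\<dots> = smult k (smult c h)" by (simp add: mult.commute)
    also have "\<dots> = smult k q * r" using less(7) by simp
    finally have "h = smult k q * r" .
    moreover have "q = smult c (smult k q)" using k by (simp flip: k(2))
    ultimately show ?thesis using less(2,5) sc(1) poly_on_smult[OF S k(1) less(4)]
      by (intro bexI[of _ c] bexI[of _ 1] bexI[of _ "smult k q"] bexI[of _ r]) simp_all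
  next
    case irr
    then have pr: "prime_on (poly_on S) [:c:]" by (intro prime_on_const_poly S ip)
    have "dvd_on (poly_on S) [:c:] (q * r)" unfolding dvd_on_def less(7)[symmetric] using less(6) by auto
    then consider "dvd_on (poly_on S) [:c:] q" | "dvd_on (poly_on S) [:c:] r"
      using pr less unfolding prime_on_def by blast
    then show ?thesis
    proof cases
      case 1
      then obtain k where k: "k \<in> poly_on S" "q = smult c k" by (auto simp: dvd_on_def)
      have "h = k * r" using cancel[OF _ less(2,3,6), of "k * r"] less pc(4)[OF k(1) less(5)] k(2) by simp
      then show ?thesis using less(2,5) k sc(1)
        by (intro bexI[of _ c] bexI[of _ 1] bexI[of _ k] bexI[of _ r]) simp_all
    next
      case 2
      then obtain k where k: "k \<in> poly_on S" "r = smult c k" by (auto simp: dvd_on_def)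
      have "h = q * k" using cancel[OF _ less(2,3,6), of "q * k"] less pc(4)[OF less(4) k(1)] k(2) by simp
      then show ?thesis using less(2,4) k sc(1)
        by (intro bexI[of _ 1] bexI[of _ c] bexI[of _ q] bexI[of _ k]) simp_all
    qed
  next
    case red
    have nz: "a \<noteq> 0" "b \<noteq> 0" using red less by auto
    have "sz c = sz a * sz b" "sz a > 0" "sz b > 0" "sz a \<noteq> 1" "sz b \<noteq> 1"
      using sz red nz unfolding size_on_def by auto
    then have lt: "sz a < sz c" "sz b < sz c" by (simp_all add: nat_neq_iff)
    have bh: "smult b h \<in> poly_on S" using poly_on_smult[OF S] red less by blast
    have "smult a (smult b h) = q * r" using less(7) red by simp
    from less(1)[OF lt(1) red(1) nz(1) less(4,5) bh this]
    obtain a1 a2 q1 r1 where 1: "a1 \<in> S" "a2 \<in> S" "q1 \<in> poly_on S" "r1 \<in> poly_on S" "a = a1 * a2"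
      "q = smult a1 q1" "r = smult a2 r1" "smult b h = q1 * r1" by blast
    \<comment> \<open>Second round: \<open>a\<close> has been cancelled, and \<open>b\<close> is now
      split over the remaining factors \<open>q1\<close> and \<open>r1\<close>.\<close>
    from less(1)[OF lt(2) red(2) nz(2) 1(3,4) less(6) 1(8)]
    obtain b1 b2 q2 r2 where 2: "b1 \<in> S" "b2 \<in> S" "q2 \<in> poly_on S" "r2 \<in> poly_on S" "b = b1 * b2"
      "q1 = smult b1 q2" "r1 = smult b2 r2" "h = q2 * r2" by blast
    have "c = (a1 * b1) * (a2 * b2)" "q = smult (a1 * b1) q2" "r = smult (a2 * b2) r2"
      using red 1 2 by (simp_all add: mult_ac)
    then show ?thesis using sc(4)[OF 1(1) 2(1)] sc(4)[OF 1(2) 2(2)] 2 by blast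
  qed
qed

lemma dvd_on_poly_unit:
  assumes "p \<in> poly_on S" "p \<noteq> 0"
  shows "dvd_on (poly_on S) p 1 \<longleftrightarrow> degree p = 0 \<and> dvd_on S (lead_coeff p) 1"
proof
  assume "dvd_on (poly_on S) p 1"
  then obtain k where k: "k \<in> poly_on S" "1 = p * k" by (auto simp: dvd_on_def)
  then have "k \<noteq> 0" by auto
  then have "degree (1::'a poly) = degree p + degree k" "lead_coeff (1::'a poly) = lead_coeff p * lead_coeff k"
    using poly_on_degree_mult[OF S assms(1) k(1) assms(2)] k(2) by metis+
  then show "degree p = 0 \<and> dvd_on S (lead_coeff p) 1"
    using poly_on_coeff[OF S k(1)] by (auto simp: dvd_on_def)
next
  assume a: "degree p = 0 \<and> dvd_on S (lead_coeff p) 1"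
  then obtain k where k: "k \<in> S" "1 = lead_coeff p * k" by (auto simp: dvd_on_def)
  have "p = [:lead_coeff p:]" using a by (metis degree_0_id)
  then have "1 = p * [:k:]" using k(2) by (metis mult_to_poly one_pCons)
  then show "dvd_on (poly_on S) p 1" using poly_on_const[OF S k(1)] unfolding dvd_on_def by blast
qed

text \<open>The factor \<open>2 ^ degree p\<close> turns the additivity of degrees into
  multiplicativity and exceeds 1 exactly when the degree is positive.\<close>

lemma size_on_poly: "size_on (poly_on S) (\<lambda>p. 2 ^ degree p * sz (lead_coeff p))"
  unfolding size_on_def
proof (intro conjI ballI)
  fix a b assume ab: "a \<in> poly_on S - {0}" "b \<in> poly_on S - {0}"
  then have "lead_coeff a \<in> S - {0}" "lead_coeff b \<in> S - {0}" using poly_on_coeff[OF S] by auto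
  then show "2 ^ degree (a * b) * sz (lead_coeff (a * b)) = 2 ^ degree a * sz (lead_coeff a) * (2 ^ degree b * sz (lead_coeff b))"
    using ab sz poly_on_degree_mult[OF S, of a b] by (auto simp: size_on_def power_add)
next
  fix a assume a: "a \<in> poly_on S - {0}"
  then have l: "lead_coeff a \<in> S - {0}" using poly_on_coeff[OF S] by auto
  with sz show "0 < 2 ^ degree a * sz (lead_coeff a)" by (auto simp: size_on_def)
  show "(2 ^ degree a * sz (lead_coeff a) = 1) = dvd_on (poly_on S) a 1"
    using dvd_on_poly_unit[of a] a l sz by (auto simp: size_on_def)
qed

text \<open>Bezout's argument over the fraction field, with denominators cleared. For
  \<open>f\<close> of positive degree dividing \<open>a * b\<close>, an element \<open>r\<close> of
  least degree in the ideal generated by \<open>f\<close> and \<open>a\<close> is, up to scalars, a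
  divisor of \<open>f\<close>. Either it is an associate of \<open>f\<close>, and then
  \<open>f\<close> divides \<open>a\<close>, or it is constant, and then \<open>f\<close> divides
  \<open>b\<close>. Constant \<open>f\<close> is covered by Gauss's lemma.\<close>

lemma irred_on_poly_prime:
  assumes f: "irred_on (poly_on S) f"
  shows "prime_on (poly_on S) f"
proof (cases "degree f = 0")
  case True
  then obtain c where c: "f = [:c:]" by (metis degree_0_id)
  have "c \<in> S" using f c by (auto simp: irred_on_def poly_on_def dest: spec[of _ 0])
  have cu: "dvd_on (poly_on S) [:x:] 1 \<longleftrightarrow> dvd_on S x 1" if "x \<in> S" "x \<noteq> 0" for x
    using dvd_on_poly_unit[of "[:x:]"] poly_on_const[OF S] that by auto
  have "irred_on S c" unfolding irred_on_def
  proof (intro conjI ballI impI)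
    show "c \<in> S" by fact
    show "c \<noteq> 0" using f c by (auto simp: irred_on_def)
    show "\<not> dvd_on S c 1" using f c cu[OF \<open>c \<in> S\<close> \<open>c \<noteq> 0\<close>] by (auto simp: irred_on_def)
    fix a b assume ab: "a \<in> S" "b \<in> S" "c = a * b"
    then have "f = [:a:] * [:b:]" using c by simp
    moreover have "a \<noteq> 0" "b \<noteq> 0" by (rule notI, use ab(3) \<open>c \<noteq> 0\<close> in simp)+
    moreover have "dvd_on (poly_on S) [:a:] 1 \<or> dvd_on (poly_on S) [:b:] 1"
      using f \<open>f = [:a:] * [:b:]\<close> poly_on_const[OF S ab(1)] poly_on_const[OF S ab(2)] by (simp only: irred_on_def)
    ultimately show "dvd_on S a 1 \<or> dvd_on S b 1" using cu[OF ab(1)] cu[OF ab(2)] by blast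
  qed
  then show ?thesis unfolding c by (intro prime_on_const_poly S ip)
next
  case False
  note pc = domain_onD[OF SPs] and sc = domain_onD[OF S]
  have fS: "f \<in> poly_on S" and f0: "f \<noteq> 0" using f by (auto simp: irred_on_def)
  \<comment> \<open>An irreducible polynomial of positive degree is primitive: any scalar factor is
    a unit.\<close>
  have prim: "\<exists>k\<in>S. 1 = c * k" if "c \<in> S" "g \<in> poly_on S" "f = smult c g" for c g
  proof -
    have c0: "c \<noteq> 0" using that f0 by auto
    have g0: "degree g \<noteq> 0" using that False degree_smult_le[of c g] by auto
    have "f = [:c:] * g" using that by simp
    with f have "dvd_on (poly_on S) [:c:] 1 \<or> dvd_on (poly_on S) g 1"
      using poly_on_const[OF S that(1)] that(2) unfolding irred_on_def by blast
    moreover have "\<not> dvd_on (poly_on S) g 1" using dvd_on_poly_unit[OF that(2)] g0 by (metis degree_0)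
    ultimately show ?thesis using dvd_on_poly_unit[OF poly_on_const[OF S that(1)]] c0 by (auto simp: dvd_on_def)
  qed
  \<comment> \<open>Divisibility by the primitive \<open>f\<close> over the fraction field descends
    to \<open>S\<close>: the part of \<open>c\<close> that falls on \<open>f\<close> is a
    unit.\<close>
  have dvd_of_scalar_multiple: "dvd_on (poly_on S) f h" if "c \<in> S" "c \<noteq> 0" "z \<in> poly_on S" "h \<in> poly_on S" "smult c h = f * z" for c z h
  proof -
    from split_scalar[OF that(1,2) fS that(3,4,5)]
    obtain c1 q1 r1 where 1: "c1 \<in> S" "q1 \<in> poly_on S" "r1 \<in> poly_on S" "f = smult c1 q1" "h = q1 * r1" by blast
    from prim[OF 1(1,2,4)] obtain k where k: "k \<in> S" "1 = c1 * k" by blast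
    have "q1 = smult k f" using 1(4) k(2)[symmetric] by (simp add: mult.commute)
    then have "h = f * smult k r1" using 1(5) by simp
    then show ?thesis using poly_on_smult[OF S k(1) 1(3)] unfolding dvd_on_def by blast
  qed
  show ?thesis unfolding prime_on_def
  proof (intro conjI ballI impI fS)
    fix a b assume ab: "a \<in> poly_on S" "b \<in> poly_on S" "dvd_on (poly_on S) f (a * b)"
    define J where "J = {x * f + y * a |x y. x \<in> poly_on S \<and> y \<in> poly_on S}"
    have J: "ideal_on (poly_on S) J" unfolding ideal_on_def
    proof (intro conjI ballI subsetI)
      show "x \<in> poly_on S" if "x \<in> J" for x using that unfolding J_def by (auto intro!: pc fS ab)
      show "0 \<in> J" unfolding J_def using pc(2) by force
      fix s t assume st: "s \<in> J" "t \<in> J"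
      then obtain x y x' y' where "s = x * f + y * a" "t = x' * f + y' * a" "x \<in> poly_on S" "y \<in> poly_on S" "x' \<in> poly_on S" "y' \<in> poly_on S"
        by (auto simp: J_def)
      then have "s + t = (x + x') * f + (y + y') * a" "x + x' \<in> poly_on S" "y + y' \<in> poly_on S" by (auto simp: algebra_simps intro: pc)
      then show "s + t \<in> J" unfolding J_def by blast
    next
      fix s t assume st: "s \<in> poly_on S" "t \<in> J"
      then obtain x y where "t = x * f + y * a" "x \<in> poly_on S" "y \<in> poly_on S" by (auto simp: J_def)
      then have "s * t = (s * x) * f + (s * y) * a" "s * x \<in> poly_on S" "s * y \<in> poly_on S" using st by (auto simp: algebra_simps intro: pc)
      then show "s * t \<in> J" unfolding J_def by blast
    qed
    have "f = 1 * f + 0 * a" "a = 0 * f + 1 * a" by simp_all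
    then have fJ: "f \<in> J" and aJ: "a \<in> J" unfolding J_def using pc(1,2) by blast+
    obtain r where r: "r \<in> J" "r \<noteq> 0" "\<And>g. g \<in> J \<Longrightarrow> g \<noteq> 0 \<Longrightarrow> degree r \<le> degree g"
      using ideal_minimal_degree[OF fJ f0] by blast
    have rS: "r \<in> poly_on S" using r J by (auto simp: ideal_on_def)
    from pseudo_division_minimal[OF S J r fJ] obtain c q where c: "c \<in> S" "q \<in> poly_on S" "c \<noteq> 0" "smult c f = q * r" by blast
    from split_scalar[OF c(1,3,2) rS fS c(4)] obtain c1 c2 q1 r1 where
      1: "c1 \<in> S" "c2 \<in> S" "q1 \<in> poly_on S" "r1 \<in> poly_on S" "c = c1 * c2" "q = smult c1 q1" "r = smult c2 r1" "f = q1 * r1" by blast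
    have "dvd_on (poly_on S) q1 1 \<or> dvd_on (poly_on S) r1 1" using f 1 unfolding irred_on_def by blast
    then show "dvd_on (poly_on S) f a \<or> dvd_on (poly_on S) f b"
    proof
      assume "dvd_on (poly_on S) q1 1"
      then obtain k where k: "k \<in> poly_on S" "1 = q1 * k" by (auto simp: dvd_on_def)
      have "r1 = (q1 * k) * r1" using k(2)[symmetric] by simp
      then have r1: "r1 = f * k" using 1(8) by (simp add: mult_ac)
      from pseudo_division_minimal[OF S J r aJ] obtain c' q' where c': "c' \<in> S" "q' \<in> poly_on S" "c' \<noteq> 0" "smult c' a = q' * r" by blast
      have "smult c' a = f * (smult c2 (k * q'))" using c'(4) 1(7) r1 by (simp add: mult_ac)
      moreover have "smult c2 (k * q') \<in> poly_on S" using poly_on_smult[OF S 1(2)] pc(4)[OF k(1) c'(2)] by blast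
      ultimately show ?thesis using dvd_of_scalar_multiple[OF c'(1,3) _ ab(1)] by blast
    next
      \<comment> \<open>Now a nonzero constant \<open>e\<close> is a combination of \<open>f\<close>
        and \<open>a\<close>, and multiplying that relation by \<open>b\<close> makes the right side
        a multiple of \<open>f\<close>.\<close>
      assume u: "dvd_on (poly_on S) r1 1"
      have "r1 \<noteq> 0" using r(2) 1(7) by auto
      then have "degree r1 = 0" using dvd_on_poly_unit[OF 1(4)] u by blast
      then have "degree r = 0" using 1(7) degree_smult_le[of c2 r1] by simp
      then obtain e where e: "r = [:e:]" by (metis degree_0_id)
      have e': "e \<in> S" "e \<noteq> 0" using e rS r(2) by (auto simp: poly_on_def dest: spec[of _ 0])
      obtain x y where xy: "r = x * f + y * a" "x \<in> poly_on S" "y \<in> poly_on S" using r(1) by (auto simp: J_def)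
      obtain w where w: "w \<in> poly_on S" "a * b = f * w" using ab(3) by (auto simp: dvd_on_def)
      have "smult e b = r * b" using e by simp
      also have "\<dots> = x * b * f + y * (a * b)" using xy(1) by (simp add: algebra_simps)
      also have "\<dots> = f * (x * b + y * w)" using w(2) by (simp add: algebra_simps)
      finally show ?thesis using dvd_of_scalar_multiple[OF e' _ ab(2)] pc(3)[OF pc(4)[OF xy(2) ab(2)] pc(4)[OF xy(3) w(1)]] by blast
    qed
  qed
qed

lemma ufd_on_poly: "ufd_on (poly_on S)"
  unfolding ufd_on_def using SPs size_on_poly irred_on_poly_prime by blast

text \<open>Two minimal elements are played against each other. \<open>R\<close>, of least size, is
  irreducible because \<open>T\<close> is prime, hence prime; \<open>r\<close>, of least degree,
  divides everything in \<open>T\<close> up to scalars. As no nonzero scalar lies in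
  \<open>T\<close>, \<open>R\<close> cannot divide the scalars that occur, so it divides
  \<open>r\<close> and then every element of \<open>T\<close>.\<close>

lemma prime_ideal_principal:
  assumes T: "ideal_on (poly_on S) T" "1 \<notin> T" and Tp: "\<And>a b. a \<in> poly_on S \<Longrightarrow> b \<in> poly_on S \<Longrightarrow> a * b \<in> T \<Longrightarrow> a \<in> T \<or> b \<in> T"
    and T0: "\<And>c. [:c:] \<in> T \<Longrightarrow> c = 0" and ne: "f0 \<in> T" "f0 \<noteq> 0"
  shows "\<exists>R\<in>T. irred_on (poly_on S) R \<and> (\<forall>g\<in>T. dvd_on (poly_on S) R g)"
proof -
  note pc = domain_onD[OF SPs]
  let ?N = "\<lambda>p. 2 ^ degree p * sz (lead_coeff p)"
  have TS: "x \<in> poly_on S" if "x \<in> T" for x using T(1) that by (auto simp: ideal_on_def)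
  have Tm: "s * x \<in> T" if "x \<in> T" "s \<in> poly_on S" for x s using T(1) that by (auto simp: ideal_on_def)
  obtain R where R: "R \<in> T" "R \<noteq> 0" "\<And>g. g \<in> T \<Longrightarrow> g \<noteq> 0 \<Longrightarrow> ?N R \<le> ?N g"
    using ex_has_least_nat[of "\<lambda>g. g \<in> T \<and> g \<noteq> 0" f0 ?N] ne by auto
  have RS: "R \<in> poly_on S" using TS R by blast
  have key: "dvd_on (poly_on S) b 1" if ab: "a \<in> T" "b \<in> poly_on S" "R = a * b" for a b
  proof -
    have nz: "a \<noteq> 0" "b \<noteq> 0" using ab R(2) by auto
    have "?N R = ?N a * ?N b" using size_on_poly TS[OF ab(1)] ab nz unfolding size_on_def by blast
    moreover have "?N R \<le> ?N a" using R(3)[OF ab(1) nz(1)] .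
    moreover have "?N a > 0" "?N b > 0" using size_on_poly TS[OF ab(1)] ab nz unfolding size_on_def by blast+
    ultimately have "?N b = 1" by (metis One_nat_def Suc_leI antisym mult_le_cancel1 nat_mult_1_right)
    then show ?thesis using size_on_poly ab nz unfolding size_on_def by blast
  qed
  have irr: "irred_on (poly_on S) R" unfolding irred_on_def
  proof (intro conjI ballI impI RS R(2))
    show "\<not> dvd_on (poly_on S) R 1"
    proof
      assume "dvd_on (poly_on S) R 1"
      then obtain k where "k \<in> poly_on S" "1 = R * k" by (auto simp: dvd_on_def)
      then show False using Tm[OF R(1)] T(2) by (metis mult.commute)
    qed
    fix b c assume bc: "b \<in> poly_on S" "c \<in> poly_on S" "R = b * c"
    then consider "b \<in> T" | "c \<in> T" using Tp R(1) by blast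
    then show "dvd_on (poly_on S) b 1 \<or> dvd_on (poly_on S) c 1"
    proof cases
      case 1
      then show ?thesis using key[of b c] bc by blast
    next
      case 2
      then show ?thesis using key[of c b] bc by (simp add: mult.commute)
    qed
  qed
  then have Rp: "prime_on (poly_on S) R" by (rule irred_on_poly_prime)
  obtain r where r: "r \<in> T" "r \<noteq> 0" "\<And>g. g \<in> T \<Longrightarrow> g \<noteq> 0 \<Longrightarrow> degree r \<le> degree g"
    using ideal_minimal_degree[OF ne] by blast
  have rS: "r \<in> poly_on S" using TS r by blast
  have dr: "degree r > 0"
  proof (rule ccontr)
    assume "\<not> degree r > 0"
    then obtain e where "r = [:e:]" by (metis degree_0_id gr0I)
    with r T0[of e] show False by auto
  qed
  \<comment> \<open>\<open>R\<close> divides \<open>q * r\<close>. If it divided \<open>q\<close>,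
    cancelling \<open>R\<close> would make the constant \<open>c\<close> a multiple of
    \<open>r\<close>, which has positive degree.\<close>
  from pseudo_division_minimal[OF S T(1) r R(1)] obtain c q where c: "c \<in> S" "q \<in> poly_on S" "c \<noteq> 0" "smult c R = q * r" by blast
  have "dvd_on (poly_on S) R (q * r)" unfolding c(4)[symmetric] dvd_on_def
    using poly_on_const[OF S c(1)] by (intro bexI[of _ "[:c:]"]) auto
  moreover have "\<not> dvd_on (poly_on S) R q"
  proof
    assume "dvd_on (poly_on S) R q"
    then obtain k where k: "k \<in> poly_on S" "q = R * k" by (auto simp: dvd_on_def)
    have "R * [:c:] = R * (k * r)" using c(4) k(2) by (simp add: mult_ac)
    then have "[:c:] = k * r" using domain_on_cancel[OF SPs RS poly_on_const[OF S c(1)] pc(4)[OF k(1) rS] R(2)] by blast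
    moreover from this have "k \<noteq> 0" using c(3) by auto
    ultimately have "degree [:c:] = degree k + degree r" using poly_on_degree_mult(1)[OF S k(1) rS _ r(2)] by metis
    then show False using dr by simp
  qed
  ultimately have Rr: "dvd_on (poly_on S) R r" using Rp c(2) rS unfolding prime_on_def by blast
  have "dvd_on (poly_on S) R g" if g: "g \<in> T" for g
  proof -
    from pseudo_division_minimal[OF S T(1) r g] obtain c' q' where c': "c' \<in> S" "q' \<in> poly_on S" "c' \<noteq> 0" "smult c' g = q' * r" by blast
    have "dvd_on (poly_on S) R ([:c':] * g)" using dvd_on_mult[OF SPs Rr c'(2)] c'(4) by (simp add: mult.commute)
    then consider "dvd_on (poly_on S) R [:c':]" | "dvd_on (poly_on S) R g"
      using Rp poly_on_const[OF S c'(1)] TS[OF g] unfolding prime_on_def by blast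
    then show ?thesis
    proof cases
      case 1
      then obtain k where "k \<in> poly_on S" "[:c':] = R * k" by (auto simp: dvd_on_def)
      then have "[:c':] \<in> T" using Tm[OF R(1)] by (metis mult.commute)
      then show ?thesis using T0 c'(3) by blast
    qed
  qed
  then show ?thesis using irr R(1) by blast
qed

end

text \<open>Needed because adjoining a variable to integer polynomials yields a subset of
  \<open>zpoly\<close>, whereas the factorisation theory lives in the type of univariate polynomials
  over it.\<close>

lemma ufd_on_image:
  fixes h :: "'a::comm_ring_1 \<Rightarrow> 'b::comm_ring_1"
  assumes S: "ufd_on S" and inj: "inj_on h S" and h1: "h 1 = 1"
    and add: "\<And>x y. x \<in> S \<Longrightarrow> y \<in> S \<Longrightarrow> h (x + y) = h x + h y"
    and mult: "\<And>x y. x \<in> S \<Longrightarrow> y \<in> S \<Longrightarrow> h (x * y) = h x * h y"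
  shows "ufd_on (h ` S)"
proof -
  have dom: "domain_on S" using S by (simp add: ufd_on_def)
  note sc = domain_onD[OF dom]
  have h0: "h 0 = 0" using add[OF sc(2) sc(2)] by simp
  have hm: "h (- x) = - h x" if "x \<in> S" for x
    using add[OF that sc(5)[OF that]] h0 by (simp add: add_eq_0_iff)
  have hi: "h x = h y \<longleftrightarrow> x = y" if "x \<in> S" "y \<in> S" for x y using inj that by (auto dest: inj_onD)
  have hz: "h x = 0 \<longleftrightarrow> x = 0" if "x \<in> S" for x using hi[OF that sc(2)] h0 by simp
  have hd: "dvd_on (h ` S) (h x) (h y) \<longleftrightarrow> dvd_on S x y" if "x \<in> S" "y \<in> S" for x y
    unfolding dvd_on_def using that hi sc(4) by (auto simp flip: mult)
  have hu: "dvd_on (h ` S) (h x) 1 \<longleftrightarrow> dvd_on S x 1" if "x \<in> S" for x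
    using hd[OF that sc(1)] h1 by simp
  obtain sz where sz: "size_on S sz" using S by (auto simp: ufd_on_def)
  have 1: "domain_on (h ` S)"
    unfolding domain_on_def ring_on_def ball_simps(9)
  proof (intro conjI ballI)
    show "1 \<in> h ` S" using sc(1) h1 by (metis imageI)
    fix x y assume "x \<in> S" "y \<in> S"
    then show "h x + h y \<in> h ` S" "h x * h y \<in> h ` S" "- h x \<in> h ` S" "h x * h y = 0 \<longrightarrow> h x = 0 \<or> h y = 0"
      using sc hz by (auto simp flip: mult add hm)
  qed
  have 2: "size_on (h ` S) (\<lambda>y. sz (the_inv_into S h y))"
    unfolding size_on_def
  proof (intro conjI ballI)
    fix x y assume "x \<in> h ` S - {0}" "y \<in> h ` S - {0}"
    then obtain a b where ab: "x = h a" "y = h b" "a \<in> S - {0}" "b \<in> S - {0}" using h0 by blast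
    then show "sz (the_inv_into S h (x * y)) = sz (the_inv_into S h x) * sz (the_inv_into S h y)"
      using sz sc(4) by (simp add: size_on_def the_inv_into_f_f[OF inj] flip: mult)
  next
    fix x assume "x \<in> h ` S - {0}"
    then obtain a where a: "x = h a" "a \<in> S - {0}" using h0 by blast
    then show "0 < sz (the_inv_into S h x)" "(sz (the_inv_into S h x) = 1) = dvd_on (h ` S) x 1"
      using sz hu by (simp_all add: size_on_def the_inv_into_f_f[OF inj])
  qed
  have irr: "irred_on S p" if "p \<in> S" "irred_on (h ` S) (h p)" for p
    unfolding irred_on_def
  proof (intro conjI ballI impI that(1))
    show "p \<noteq> 0" "\<not> dvd_on S p 1" using that h0 hu by (auto simp: irred_on_def)
    fix b c assume "b \<in> S" "c \<in> S" "p = b * c"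
    then show "dvd_on S b 1 \<or> dvd_on S c 1" using that mult hu unfolding irred_on_def by (metis imageI)
  qed
  have 3: "prime_on (h ` S) y" if y: "irred_on (h ` S) y" for y
  proof -
    obtain p where p: "y = h p" "p \<in> S" using y unfolding irred_on_def by blast
    then have "prime_on S p" using S irr y by (auto simp: ufd_on_def)
    then show ?thesis unfolding p prime_on_def using sc(4) hd by (auto simp flip: mult)
  qed
  show ?thesis unfolding ufd_on_def using 1 2 3 by blast
qed

lemma ufd_on_int: "ufd_on (UNIV :: int set)"
proof -
  have "size_on (UNIV :: int set) (\<lambda>x. nat \<bar>x\<bar>)"
    unfolding size_on_def dvd_on_def bex_UNIV
    by (auto simp: nat_mult_distrib abs_mult nat_eq_iff eq_commute[of 1] simp flip: zdvd1_eq) (auto simp: dvd_def)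
  moreover have "prime_on UNIV p" if "irred_on UNIV p" for p :: int
  proof -
    have "irreducible p" using that by (auto simp: irred_on_def dvd_on_def irreducible_def dvd_def)
    then have "prime_elem p" by (rule irreducible_imp_prime_elem)
    then show ?thesis unfolding prime_on_def dvd_on_def bex_UNIV
      using prime_elem_dvd_multD unfolding dvd_def by blast
  qed
  ultimately show ?thesis unfolding ufd_on_def by (auto simp: domain_on_def ring_on_def)
qed

subsection \<open>Integer polynomials\<close>

abbreviation "lkp \<equiv> Poly_Mapping.lookup"
abbreviation "kys \<equiv> Poly_Mapping.keys"

type_synonym zv = "nat \<times> (nat \<Rightarrow> nat)"

definition zmon :: "(zv \<Rightarrow> 'r::comm_ring_1) \<Rightarrow> (zv \<Rightarrow>\<^sub>0 nat) \<Rightarrow> 'r" where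
  "zmon a m = (\<Prod>v\<in>kys m. a v ^ lkp m v)"

definition zvar :: "zv \<Rightarrow> zpoly" where
  "zvar v = Poly_Mapping.single (Poly_Mapping.single v 1) 1"

lemma zmon_superset:
  assumes "finite A" "kys m \<subseteq> A"
  shows "zmon a m = (\<Prod>v\<in>A. a v ^ lkp m v)"
  unfolding zmon_def by (rule prod.mono_neutral_left) (use assms in \<open>auto simp: in_keys_iff\<close>)

lemma zmon_0 [simp]: "zmon a 0 = 1"
  by (simp add: zmon_def)

lemma zmon_add: "zmon a (m + m') = zmon a m * zmon a m'"
proof -
  let ?A = "kys m \<union> kys m'"
  have "zmon a (m + m') = (\<Prod>v\<in>?A. a v ^ lkp (m + m') v)"
    by (rule zmon_superset) (auto simp: Poly_Mapping.keys_add)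
  also have "\<dots> = (\<Prod>v\<in>?A. a v ^ lkp m v) * (\<Prod>v\<in>?A. a v ^ lkp m' v)"
    by (simp add: lookup_add power_add prod.distrib)
  also have "\<dots> = zmon a m * zmon a m'"
    by (simp add: zmon_superset[of ?A])
  finally show ?thesis .
qed

lemma zmon_single: "zmon a (Poly_Mapping.single v k) = a v ^ k"
  by (cases "k = 0") (auto simp: zmon_def)

lemma zpoly_eval_zmon: "zpoly_eval R a = (\<Sum>m\<in>kys R. of_int (lkp R m) * zmon a m)"
  by (simp add: zpoly_eval_def zmon_def)

lemma zpoly_eval_superset:
  assumes "finite A" "kys R \<subseteq> A"
  shows "zpoly_eval R a = (\<Sum>m\<in>A. of_int (lkp R m) * zmon a m)"
  unfolding zpoly_eval_zmon
  by (rule sum.mono_neutral_left) (use assms in \<open>auto simp: in_keys_iff\<close>)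

lemma zpoly_eval_single: "zpoly_eval (Poly_Mapping.single m c) a = of_int c * zmon a m"
  by (cases "c = 0") (auto simp: zpoly_eval_zmon)

lemma zpoly_eval_0 [simp]: "zpoly_eval 0 a = 0"
  by (simp add: zpoly_eval_zmon)

lemma single_zero_eq_of_int: "Poly_Mapping.single 0 k = (of_int k :: zpoly)"
  by (rule poly_mapping_eqI) (simp add: lookup_of_int lookup_single when_def)

lemma zpoly_eval_of_int [simp]: "zpoly_eval (of_int k) a = of_int k"
  using zpoly_eval_single[of 0 k a] by (simp add: single_zero_eq_of_int)

lemma zpoly_eval_1 [simp]: "zpoly_eval 1 a = 1"
  using zpoly_eval_of_int[of 1 a] by simp

lemma zpoly_eval_zvar [simp]: "zpoly_eval (zvar v) a = a v"
  by (simp add: zvar_def zpoly_eval_single zmon_single)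

lemma zpoly_eval_add: "zpoly_eval (f + g) a = zpoly_eval f a + zpoly_eval g a"
proof -
  let ?A = "kys f \<union> kys g"
  have "zpoly_eval (f + g) a = (\<Sum>m\<in>?A. of_int (lkp (f + g) m) * zmon a m)"
    by (rule zpoly_eval_superset) (auto simp: Poly_Mapping.keys_add)
  also have "\<dots> = (\<Sum>m\<in>?A. of_int (lkp f m) * zmon a m) + (\<Sum>m\<in>?A. of_int (lkp g m) * zmon a m)"
    by (simp add: lookup_add distrib_right sum.distrib)
  finally show ?thesis
    by (simp add: zpoly_eval_superset[of ?A])
qed

lemma zpoly_induct [case_names single add]:
  fixes P :: "zpoly \<Rightarrow> bool"
  assumes single: "\<And>m c. P (Poly_Mapping.single m c)"
    and add: "\<And>f g. P f \<Longrightarrow> P g \<Longrightarrow> P (f + g)"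
  shows "P f"
proof (induction f rule: Poly_Mapping.update_induct)
  case const
  then show ?case using single[of 0 0] by simp
next
  case (update f a b)
  have "Poly_Mapping.update a b f = f + Poly_Mapping.single a b"
    using update(1)
    by (intro poly_mapping_eqI) (auto simp: lookup_update lookup_add lookup_single in_keys_iff when_def)
  then show ?case using add[OF update(3) single[of a b]] by simp
qed

lemma zpoly_eval_mult: "zpoly_eval (f * g) a = zpoly_eval f a * zpoly_eval g a"
proof (induction f rule: zpoly_induct)
  case (single m c)
  show ?case
  proof (induction g rule: zpoly_induct)
    case (single m' c')
    show ?case by (simp add: mult_single zpoly_eval_single zmon_add algebra_simps)
  next
    case (add f g)
    then show ?case by (simp add: distrib_left zpoly_eval_add)
  qed
next
  case (add f g)
  then show ?case by (simp add: distrib_right zpoly_eval_add)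
qed

lemma zpoly_eval_comm_ring_hom: "comm_ring_hom (\<lambda>f. zpoly_eval f a)"
  by unfold_locales (auto simp: zpoly_eval_add zpoly_eval_mult)

interpretation zeval: comm_ring_hom "\<lambda>f. zpoly_eval f a" for a :: "zv \<Rightarrow> 'r::comm_ring_1"
  by (rule zpoly_eval_comm_ring_hom)

lemma (in comm_ring_hom) hom_of_nat': "hom (of_nat k) = of_nat k"
  by (induction k) (simp_all add: hom_add)

lemma (in comm_ring_hom) hom_of_int': "hom (of_int k) = of_int k"
  by (cases k) (simp_all add: hom_minus hom_uminus hom_add hom_of_nat')

text \<open>With \<open>hom\<close> itself an evaluation this is the substitution rule, and it is
  how identities between integer polynomials are specialised to other rings.\<close>

lemma (in comm_ring_hom) hom_zpoly_eval: "hom (zpoly_eval f a) = zpoly_eval f (\<lambda>v. hom (a v))"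
  unfolding zpoly_eval_def by (simp add: hom_sum hom_mult hom_prod hom_power hom_of_int')

lemma zvar_power: "zvar v ^ k = Poly_Mapping.single (Poly_Mapping.single v k) 1"
  by (induction k) (auto simp: zvar_def mult_single simp flip: single_add)

lemma zmon_zvar: "zmon zvar m = Poly_Mapping.single m 1"
proof -
  have *: "(\<Prod>v\<in>A. zvar v ^ k v) = Poly_Mapping.single (\<Sum>v\<in>A. Poly_Mapping.single v (k v)) 1"
    if "finite A" for A and k :: "zv \<Rightarrow> nat"
    using that by induction (auto simp: zvar_power mult_single)
  have "(\<Sum>v\<in>kys m. Poly_Mapping.single v (lkp m v)) = m"
    by (intro poly_mapping_eqI)
      (auto simp: lookup_sum lookup_single when_def in_keys_iff sum.delta' if_distrib cong: if_cong)
  then show ?thesis by (simp add: zmon_def *)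
qed

lemma zpoly_eval_id [simp]: "zpoly_eval f zvar = f"
proof (induction f rule: zpoly_induct)
  case (single m c)
  show ?case
    by (simp add: zpoly_eval_single zmon_zvar mult_single flip: single_zero_eq_of_int)
next
  case (add f g)
  then show ?case by (simp add: zpoly_eval_add)
qed

lemma zpoly_vars_add: "zpoly_vars (f + g) \<subseteq> zpoly_vars f \<union> zpoly_vars g"
  unfolding zpoly_vars_def using Poly_Mapping.keys_add[of f g] by blast

lemma zpoly_vars_mult: "zpoly_vars (f * g) \<subseteq> zpoly_vars f \<union> zpoly_vars g"
proof
  fix v assume "v \<in> zpoly_vars (f * g)"
  then obtain m where m: "m \<in> kys (f * g)" "v \<in> kys m" by (auto simp: zpoly_vars_def)
  then obtain a b where "m = a + b" "a \<in> kys f" "b \<in> kys g" using keys_mult by blast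
  with m(2) Poly_Mapping.keys_add[of a b] show "v \<in> zpoly_vars f \<union> zpoly_vars g"
    by (auto simp: zpoly_vars_def)
qed

lemma zpoly_vars_zvar [simp]: "zpoly_vars (zvar v) = {v}"
  by (simp add: zpoly_vars_def zvar_def)

lemma zpoly_vars_single: "zpoly_vars (Poly_Mapping.single m c) = (if c = 0 then {} else kys m)"
  by (simp add: zpoly_vars_def)

lemma zpoly_vars_of_int [simp]: "zpoly_vars (of_int k) = {}"
  using zpoly_vars_single[of 0 k] by (simp add: single_zero_eq_of_int split: if_splits)

lemma zpoly_vars_0 [simp]: "zpoly_vars 0 = {}" by (simp add: zpoly_vars_def)
lemma zpoly_vars_1 [simp]: "zpoly_vars 1 = {}" by (simp add: zpoly_vars_def)

lemma zpoly_vars_uminus [simp]: "zpoly_vars (- f) = zpoly_vars f"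
  by (simp add: zpoly_vars_def)

lemma finite_zpoly_vars [simp]: "finite (zpoly_vars f)"
  by (simp add: zpoly_vars_def)

lemma zpoly_eval_cong:
  assumes "\<And>v. v \<in> zpoly_vars f \<Longrightarrow> a v = b v"
  shows "zpoly_eval f a = zpoly_eval f b"
  unfolding zpoly_eval_def
  by (intro sum.cong arg_cong2[of _ _ _ _ "(*)"] prod.cong refl arg_cong2[of _ _ _ _ "(^)"])
    (use assms in \<open>auto simp: zpoly_vars_def\<close>)

text \<open>A parametricity principle with two uses: membership in a subring, where the second
  argument is a dummy, and the relation \<open>near\<close>, where it expresses that integer
  polynomials are 1-Lipschitz.\<close>

lemma zpoly_eval_rel:
  fixes P :: "'r::comm_ring_1 \<Rightarrow> 's::comm_ring_1 \<Rightarrow> bool"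
  assumes int: "\<And>k. P (of_int k) (of_int k)"
    and add: "\<And>x y x' y'. P x x' \<Longrightarrow> P y y' \<Longrightarrow> P (x + y) (x' + y')"
    and mult: "\<And>x y x' y'. P x x' \<Longrightarrow> P y y' \<Longrightarrow> P (x * y) (x' * y')"
    and var: "\<And>v. v \<in> zpoly_vars f \<Longrightarrow> P (a v) (b v)"
  shows "P (zpoly_eval f a) (zpoly_eval f b)"
proof -
  have one: "P 1 1" using int[of 1] by simp
  have zero: "P 0 0" using int[of 0] by simp
  have pow: "P x y \<Longrightarrow> P (x ^ n) (y ^ n)" for x y and n :: nat by (induction n) (auto simp: mult one)
  have pr: "(\<And>i. i \<in> A \<Longrightarrow> P (h i) (g i)) \<Longrightarrow> P (prod h A) (prod g A)" for A :: "zv set" and h g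
    by (induction A rule: infinite_finite_induct) (auto simp: mult one)
  have su: "(\<And>i. i \<in> A \<Longrightarrow> P (h i) (g i)) \<Longrightarrow> P (sum h A) (sum g A)" for A :: "(zv \<Rightarrow>\<^sub>0 nat) set" and h g
    by (induction A rule: infinite_finite_induct) (auto simp: add zero)
  show ?thesis unfolding zpoly_eval_def
    by (intro su mult int pr pow var) (auto simp: zpoly_vars_def)
qed

lemma zpoly_eval_closed:
  assumes "\<And>k. of_int k \<in> S" "\<And>x y. x \<in> S \<Longrightarrow> y \<in> S \<Longrightarrow> x + y \<in> S" "\<And>x y. x \<in> S \<Longrightarrow> y \<in> S \<Longrightarrow> x * y \<in> S"
    and "\<And>v. v \<in> zpoly_vars f \<Longrightarrow> a v \<in> S"
  shows "zpoly_eval f a \<in> S"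
  using zpoly_eval_rel[of "\<lambda>x _ :: int. x \<in> S" f a "\<lambda>_. 0"] assms by auto

section \<open>Kronecker substitution and identity testing over the complex numbers\<close>

lemma exists_separating_weight:
  fixes M :: "('a \<Rightarrow> nat) set"
  assumes "finite U" "finite M"
  shows "\<exists>k :: 'a \<Rightarrow> nat. \<forall>m\<in>M. \<forall>m'\<in>M. (\<Sum>v\<in>U. m v * k v) = (\<Sum>v\<in>U. m' v * k v) \<longrightarrow> (\<forall>v\<in>U. m v = m' v)"
  using assms(1)
proof induction
  case empty
  then show ?case by simp
next
  case (insert w U)
  then obtain k where k: "\<And>m m'. m \<in> M \<Longrightarrow> m' \<in> M \<Longrightarrow> (\<Sum>v\<in>U. m v * k v) = (\<Sum>v\<in>U. m' v * k v) \<Longrightarrow> (\<forall>v\<in>U. m v = m' v)"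
    by blast
  \<comment> \<open>\<open>B\<close> exceeds every weighted sum over the old indices, so in base
    \<open>B\<close> the exponent at \<open>w\<close> is the quotient and the old weight is the
    remainder.\<close>
  define B where "B = Suc (\<Sum>m\<in>M. \<Sum>v\<in>U. m v * k v)"
  have B: "(\<Sum>v\<in>U. m v * k v) < B" if "m \<in> M" for m
    unfolding B_def using member_le_sum[OF that, of "\<lambda>m. \<Sum>v\<in>U. m v * k v"] assms(2) by auto
  let ?k = "k(w := B)"
  have eq: "(\<Sum>v\<in>insert w U. m v * ?k v) = m w * B + (\<Sum>v\<in>U. m v * k v)" for m
  proof -
    have "(\<Sum>v\<in>U. m v * ?k v) = (\<Sum>v\<in>U. m v * k v)"
      by (rule sum.cong) (use insert in auto)
    then show ?thesis using insert by simp
  qed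
  have "\<forall>v\<in>insert w U. m v = m' v"
    if m: "m \<in> M" "m' \<in> M" and "(\<Sum>v\<in>insert w U. m v * ?k v) = (\<Sum>v\<in>insert w U. m' v * ?k v)" for m m'
  proof -
    have e: "m w * B + (\<Sum>v\<in>U. m v * k v) = m' w * B + (\<Sum>v\<in>U. m' v * k v)" using that(3) unfolding eq .
    from arg_cong[OF e, of "\<lambda>x. x div B"] arg_cong[OF e, of "\<lambda>x. x mod B"] B[OF m(1)] B[OF m(2)]
    have "m w = m' w" "(\<Sum>v\<in>U. m v * k v) = (\<Sum>v\<in>U. m' v * k v)" by simp_all
    with k[OF m] show ?thesis by auto
  qed
  then show ?case by blast
qed

text \<open>Substituting \<open>v \<mapsto> t ^ k v\<close> with separating weights keeps the monomials distinct.\<close>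
lemma kronecker_poly:
  fixes c :: "('a \<Rightarrow> nat) \<Rightarrow> 'k::comm_ring_1"
  assumes "finite U" "finite M" and supp: "\<And>m m'. m \<in> M \<Longrightarrow> m' \<in> M \<Longrightarrow> \<forall>v\<in>U. m v = m' v \<Longrightarrow> m = m'"
    and nz: "m \<in> M" "c m \<noteq> 0"
  shows "\<exists>(k :: 'a \<Rightarrow> nat) p. p \<noteq> 0 \<and> (\<forall>t. (\<Sum>m\<in>M. c m * (\<Prod>v\<in>U. (t ^ k v) ^ m v)) = poly p t)"
proof -
  obtain k :: "'a \<Rightarrow> nat" where k: "\<And>m m'. m \<in> M \<Longrightarrow> m' \<in> M \<Longrightarrow> (\<Sum>v\<in>U. m v * k v) = (\<Sum>v\<in>U. m' v * k v) \<Longrightarrow> (\<forall>v\<in>U. m v = m' v)"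
    using exists_separating_weight[OF assms(1,2)] by blast
  define w where "w m = (\<Sum>v\<in>U. m v * k v)" for m
  define p where "p = (\<Sum>m\<in>M. monom (c m) (w m))"
  have "coeff p (w m) = (\<Sum>m'\<in>M. if m' = m then c m else 0)"
    unfolding p_def coeff_sum by (rule sum.cong) (use k supp nz(1) in \<open>auto simp: w_def\<close>)
  then have "coeff p (w m) = c m" using nz assms(2) by simp
  then have "p \<noteq> 0" using nz by auto
  moreover have "(\<Sum>m\<in>M. c m * (\<Prod>v\<in>U. (t ^ k v) ^ m v)) = poly p t" for t
    by (simp add: p_def poly_sum poly_monom w_def power_sum mult.commute flip: power_mult)
  ultimately show ?thesis by blast
qed

lemma zpoly_nonzero_eval:
  fixes f :: zpoly
  assumes "f \<noteq> 0"
  shows "\<exists>a :: zv \<Rightarrow> complex. zpoly_eval f a \<noteq> 0"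
proof -
  from assms obtain m0 where m0: "m0 \<in> kys f" by (metis Poly_Mapping.keys_eq_empty ex_in_conv)
  \<comment> \<open>\<open>kronecker_poly\<close> expects exponents as plain functions, so keys are
    passed through \<open>lkp\<close> and the coefficients are recovered through
    \<open>Abs_poly_mapping\<close>.\<close>
  let ?U = "zpoly_vars f" and ?M = "lkp ` kys f"
  let ?c = "\<lambda>m. of_int (lkp f (Abs_poly_mapping m)) :: complex"
  have "\<exists>(k :: zv \<Rightarrow> nat) p. p \<noteq> 0 \<and> (\<forall>t. (\<Sum>m\<in>?M. ?c m * (\<Prod>v\<in>?U. (t ^ k v) ^ m v)) = poly p t)"
  proof (rule kronecker_poly[where m = "lkp m0"])
    show "m = m'" if "m \<in> ?M" "m' \<in> ?M" "\<forall>v\<in>?U. m v = m' v" for m m'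
    proof
      fix v
      show "m v = m' v"
      proof (cases "v \<in> ?U")
        case False
        then show ?thesis using that(1,2) by (auto simp: zpoly_vars_def in_keys_iff)
      qed (use that in auto)
    qed
  qed (use m0 in \<open>auto simp: in_keys_iff\<close>)
  then obtain k :: "zv \<Rightarrow> nat" and p where p: "p \<noteq> 0" "\<And>t. (\<Sum>m\<in>?M. ?c m * (\<Prod>v\<in>?U. (t ^ k v) ^ m v)) = poly p t"
    by blast
  have "finite {t. poly p t = 0}" using p(1) by (rule poly_roots_finite)
  then obtain t where t: "poly p t \<noteq> 0"
    using infinite_UNIV_char_0[where 'a = complex] by (metis (mono_tags, lifting) UNIV_eq_I mem_Collect_eq)
  have "inj_on lkp (kys f)" by (meson inj_onI lookup_inject)
  then have "(\<Sum>m\<in>?M. ?c m * (\<Prod>v\<in>?U. (t ^ k v) ^ m v)) = (\<Sum>m\<in>kys f. of_int (lkp f m) * (\<Prod>v\<in>?U. (t ^ k v) ^ lkp m v))"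
    by (simp add: sum.reindex lookup_inverse)
  also have "\<dots> = zpoly_eval f (\<lambda>v. t ^ k v)"
    unfolding zpoly_eval_zmon
    by (intro sum.cong refl arg_cong2[of _ _ _ _ "(*)"] zmon_superset[symmetric]) (auto simp: zpoly_vars_def)
  finally show ?thesis using t p(2) by metis
qed

lemma zpoly_eqI:
  fixes f g :: zpoly
  assumes "\<And>a :: zv \<Rightarrow> complex. zpoly_eval f a = zpoly_eval g a"
  shows "f = g"
  using zpoly_nonzero_eval[of "f - g"] assms by (auto simp: zeval.hom_minus)

section \<open>Integer polynomials in a prescribed set of variables\<close>

definition zring :: "zv set \<Rightarrow> zpoly set" where
  "zring W = {f. zpoly_vars f \<subseteq> W}"

lemma zring_closed:
  "of_int k \<in> zring W" "0 \<in> zring W" "1 \<in> zring W" "v \<in> W \<Longrightarrow> zvar v \<in> zring W"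
  "f \<in> zring W \<Longrightarrow> g \<in> zring W \<Longrightarrow> f + g \<in> zring W"
  "f \<in> zring W \<Longrightarrow> g \<in> zring W \<Longrightarrow> f * g \<in> zring W"
  "f \<in> zring W \<Longrightarrow> - f \<in> zring W"
  using zpoly_vars_add[of f g] zpoly_vars_mult[of f g] by (auto simp: zring_def)

lemma zring_sum: "(\<And>i. i \<in> A \<Longrightarrow> f i \<in> zring W) \<Longrightarrow> sum f A \<in> zring W"
  by (induction A rule: infinite_finite_induct) (auto simp: zring_closed)

lemma zring_power: "f \<in> zring W \<Longrightarrow> f ^ n \<in> zring W"
  by (induction n) (auto simp: zring_closed)

lemma zring_mono: "W \<subseteq> W' \<Longrightarrow> zring W \<subseteq> zring W'"
  by (auto simp: zring_def)

lemma zring_empty: "zring {} = range of_int"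
proof -
  have "f \<in> range of_int" if "f \<in> zring {}" for f
  proof -
    have "zpoly_eval f zvar \<in> range of_int"
    proof (rule zpoly_eval_closed)
      show "x + y \<in> range of_int" "x * y \<in> range of_int" if "x \<in> range of_int" "y \<in> range of_int" for x y :: zpoly
        using that by (auto simp flip: of_int_add of_int_mult)
    qed (use that in \<open>auto simp: zring_def\<close>)
    then show ?thesis by simp
  qed
  then show ?thesis by (auto simp: zring_closed)
qed

text \<open>Reading \<open>v\<close> as the univariate indeterminate and all other variables as
  constants undoes the substitution of \<open>zvar v\<close>, because the coefficients of
  \<open>p\<close> do not involve \<open>v\<close>. This gives the injectivity in the identification
  of \<open>zring (insert v W)\<close> with a polynomial ring.\<close>

lemma zring_insert_inverse:
  assumes "v \<notin> W" "p \<in> poly_on (zring W)"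
  shows "zpoly_eval (poly p (zvar v)) (\<lambda>w. if w = v then [:0, 1:] else [:zvar w:]) = p"
proof -
  let ?a = "\<lambda>w. if w = v then [:0, 1:] else [:zvar w:]"
  interpret c: comm_ring_hom "\<lambda>c. [:c:] :: zpoly poly" by unfold_locales simp_all
  have s: "zpoly_eval s ?a = [:s:]" if "s \<in> zring W" for s
  proof -
    have "zpoly_eval s ?a = zpoly_eval s (\<lambda>w. [:zvar w:])"
      by (rule zpoly_eval_cong) (use that assms(1) in \<open>auto simp: zring_def\<close>)
    also have "\<dots> = [:s:]" using c.hom_zpoly_eval[of s zvar] by simp
    finally show ?thesis .
  qed
  have "zpoly_eval (poly p (zvar v)) ?a = (\<Sum>i\<le>degree p. zpoly_eval (coeff p i) ?a * [:0, 1:] ^ i)"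
    by (simp add: poly_altdef zeval.hom_sum zeval.hom_mult zeval.hom_power)
  also have "\<dots> = (\<Sum>i\<le>degree p. monom (coeff p i) i)"
  proof (rule sum.cong)
    fix i
    have "coeff p i \<in> zring W" using assms by (auto simp: poly_on_def)
    then show "zpoly_eval (coeff p i) ?a * [:0, 1:] ^ i = monom (coeff p i) i"
      by (simp only: s monom_altdef) (simp add: mult.commute)
  qed simp
  also have "\<dots> = p" by (rule poly_as_sum_of_monoms)
  finally show ?thesis .
qed

lemma zring_insert:
  assumes "v \<notin> W"
  shows "zring (insert v W) = (\<lambda>p. poly p (zvar v)) ` poly_on (zring W)"
proof (intro equalityI subsetI)
  fix f assume f: "f \<in> zring (insert v W)"
  let ?a = "\<lambda>w. if w = v then [:0, 1:] else [:zvar w:] :: zpoly poly"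
  have e: "comm_ring_hom (\<lambda>p. poly p (zvar v))" by unfold_locales simp_all
  have "zpoly_eval f ?a \<in> poly_on (zring W)"
  proof (rule zpoly_eval_closed)
    show "of_int k \<in> poly_on (zring W)" for k
      by (auto simp: poly_on_def zring_closed of_int_poly coeff_pCons split: nat.split)
    show "x + y \<in> poly_on (zring W)" if "x \<in> poly_on (zring W)" "y \<in> poly_on (zring W)" for x y
      using that by (auto simp: poly_on_def zring_closed)
    show "x * y \<in> poly_on (zring W)" if "x \<in> poly_on (zring W)" "y \<in> poly_on (zring W)" for x y
      using that by (auto simp: poly_on_def coeff_mult intro!: zring_sum zring_closed)
    show "?a w \<in> poly_on (zring W)" if "w \<in> zpoly_vars f" for w
      using that f by (auto simp: poly_on_def zring_def coeff_pCons split: nat.splits)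
  qed
  moreover have "f = poly (zpoly_eval f ?a) (zvar v)"
  proof -
    have "poly (zpoly_eval f ?a) (zvar v) = zpoly_eval f (\<lambda>w. poly (?a w) (zvar v))"
      by (rule comm_ring_hom.hom_zpoly_eval[OF e])
    also have "(\<lambda>w. poly (?a w) (zvar v)) = zvar" by auto
    finally show ?thesis by simp
  qed
  ultimately show "f \<in> (\<lambda>p. poly p (zvar v)) ` poly_on (zring W)" by blast
next
  fix f assume "f \<in> (\<lambda>p. poly p (zvar v)) ` poly_on (zring W)"
  then obtain p where p: "f = poly p (zvar v)" "p \<in> poly_on (zring W)" by blast
  then have "coeff p i \<in> zring (insert v W)" for i
    using zring_mono[of W "insert v W"] by (auto simp: poly_on_def)
  then show "f \<in> zring (insert v W)"
    unfolding p(1) poly_altdef by (auto intro!: zring_sum zring_closed zring_power)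
qed

lemma zring_insert_inj:
  assumes "v \<notin> W"
  shows "inj_on (\<lambda>p. poly p (zvar v)) (poly_on (zring W))"
  by (rule inj_on_inverseI) (rule zring_insert_inverse[OF assms])

lemma ufd_on_zring: "finite W \<Longrightarrow> ufd_on (zring W)"
proof (induction rule: finite_induct)
  case empty
  have "ufd_on (of_int ` (UNIV :: int set) :: zpoly set)"
    by (rule ufd_on_image[OF ufd_on_int]) (auto simp: inj_on_def)
  then show ?case by (simp add: zring_empty)
next
  case (insert v W)
  then obtain sz where "domain_on (zring W)" "size_on (zring W) sz" "\<And>p. irred_on (zring W) p \<Longrightarrow> prime_on (zring W) p"
    by (auto simp: ufd_on_def)
  then have "ufd_on (poly_on (zring W))" by (rule ufd_on_poly)
  from ufd_on_image[OF this zring_insert_inj[OF insert(2)]] show ?case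
    unfolding zring_insert[OF insert(2)] by simp
qed

lemma domain_on_zring: "finite W \<Longrightarrow> domain_on (zring W)"
  using ufd_on_zring by (auto simp: ufd_on_def)

lemma zpoly_no_zero_divisors:
  fixes f g :: zpoly
  assumes "f * g = 0"
  shows "f = 0 \<or> g = 0"
  using domain_onD(7)[OF domain_on_zring[of "zpoly_vars f \<union> zpoly_vars g"], of f g] assms
  by (auto simp: zring_def)

text \<open>Degrees in a variable outside \<open>W\<close> add up to 0, so neither factor involves
  it. Hence units and irreducibles of \<open>zring W\<close> are the same as in the whole ring,
  which is where \<open>is_macaulay_res\<close> demands irreducibility.\<close>

lemma zring_factor:
  assumes "f * g \<in> zring W" "f * g \<noteq> 0"
  shows "f \<in> zring W"
  unfolding zring_def
proof (intro CollectI subsetI, rule ccontr)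
  fix v assume v: "v \<in> zpoly_vars f" "v \<notin> W"
  let ?W = "zpoly_vars f \<union> zpoly_vars g \<union> zpoly_vars (f * g) - {v}"
  have W: "v \<notin> ?W" "finite ?W" by auto
  have "f \<in> zring (insert v ?W)" "g \<in> zring (insert v ?W)" by (auto simp: zring_def)
  then obtain p q where p: "f = poly p (zvar v)" "p \<in> poly_on (zring ?W)" and q: "g = poly q (zvar v)" "q \<in> poly_on (zring ?W)"
    unfolding zring_insert[OF W(1)] by auto
  note D = domain_on_zring[OF W(2)]
  have "f * g \<in> zring ?W" using assms v by (auto simp: zring_def)
  then have "[:f * g:] \<in> poly_on (zring ?W)" by (rule poly_on_const[OF D])
  moreover have "p * q \<in> poly_on (zring ?W)" using domain_onD(4)[OF domain_on_poly[OF D]] p q by blast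
  moreover have "poly (p * q) (zvar v) = poly [:f * g:] (zvar v)" using p q by simp
  ultimately have "p * q = [:f * g:]" using inj_onD[OF zring_insert_inj[OF W(1)]] by blast
  moreover have "p \<noteq> 0" "q \<noteq> 0" using p q assms(2) by auto
  ultimately have "degree [:f * g:] = degree p + degree q"
    using poly_on_degree_mult(1)[OF D p(2) q(2)] by metis
  then have "degree p = 0" by simp
  then have "p = [:coeff p 0:]" by (metis degree_0_id)
  then have "f = coeff p 0" using p(1) by (metis mult_zero_right poly_pCons poly_0 add.right_neutral)
  then have "f \<in> zring ?W" using p(2) by (simp add: poly_on_def)
  then show False using v by (auto simp: zring_def)
qed

lemma irred_on_zring_irreducible:
  assumes "irred_on (zring W) R"
  shows "irreducible R"
proof -
  have u: "dvd_on (zring W) a 1" if "a \<in> zring W" "a dvd 1" for a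
  proof -
    from that(2) obtain b where b: "1 = a * b" by (auto simp: dvd_def)
    have "b \<in> zring W" using zring_factor[of b a W] b by (simp add: mult.commute zring_closed flip: b)
    then show ?thesis using b by (auto simp: dvd_on_def)
  qed
  show ?thesis
  proof (rule irreducibleI)
    show "R \<noteq> 0" "\<not> R dvd 1" using assms u by (auto simp: irred_on_def)
    fix a b assume ab: "R = a * b"
    have "a * b \<in> zring W" "a * b \<noteq> 0" using assms ab by (auto simp: irred_on_def)
    then have "a \<in> zring W" "b \<in> zring W" using zring_factor[of a b W] zring_factor[of b a W] by (auto simp: mult.commute)
    then have "dvd_on (zring W) a 1 \<or> dvd_on (zring W) b 1" using assms ab unfolding irred_on_def by blast
    then show "a dvd 1 \<or> b dvd 1" unfolding dvd_on_def dvd_def by blast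
  qed
qed

lemma zpoly_unit:
  fixes k :: zpoly
  assumes "k dvd 1"
  shows "\<exists>c. k = of_int c"
proof -
  from assms obtain b where b: "1 = k * b" by (auto simp: dvd_def)
  then have "k \<in> zring {}" by (intro zring_factor[of k b]) (auto simp: zring_closed simp flip: b)
  then show ?thesis by (auto simp: zring_empty)
qed

text \<open>Pulls \<open>T\<close> back along the substitution of \<open>zvar v\<close> and returns
  the generator. The variable \<open>v\<close> plays the indeterminate, and \<open>T0\<close> says
  that no nonzero constant of that polynomial ring lies in \<open>T\<close>.\<close>

lemma zring_prime_ideal_principal:
  assumes W: "finite W" "v \<notin> W"
    and T: "ideal_on (zring (insert v W)) T" "1 \<notin> T"
    and Tp: "\<And>a b. a \<in> zring (insert v W) \<Longrightarrow> b \<in> zring (insert v W) \<Longrightarrow> a * b \<in> T \<Longrightarrow> a \<in> T \<or> b \<in> T"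
    and T0: "\<And>c. c \<in> zring W \<Longrightarrow> c \<in> T \<Longrightarrow> c = 0"
    and ne: "f0 \<in> T" "f0 \<noteq> 0"
  shows "\<exists>R\<in>T. irreducible R \<and> (\<forall>g\<in>T. R dvd g)"
proof -
  let ?h = "\<lambda>p. poly p (zvar v)"
  let ?S = "poly_on (zring W)"
  define T' where "T' = {p \<in> ?S. ?h p \<in> T}"
  note D = domain_on_zring[OF W(1)]
  note pc = domain_onD[OF domain_on_poly[OF D]]
  have hS: "?h p \<in> zring (insert v W)" if "p \<in> ?S" for p using zring_insert[OF W(2)] that by auto
  obtain sz where sz: "size_on (zring W) sz" "\<And>p. irred_on (zring W) p \<Longrightarrow> prime_on (zring W) p"
    using ufd_on_zring[OF W(1)] by (auto simp: ufd_on_def)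
  have "f0 \<in> zring (insert v W)" using T(1) ne by (auto simp: ideal_on_def)
  then obtain p0 where p0: "p0 \<in> ?S" "f0 = ?h p0" using zring_insert[OF W(2)] by auto
  have "\<exists>R\<in>T'. irred_on ?S R \<and> (\<forall>g\<in>T'. dvd_on ?S R g)"
  proof (rule prime_ideal_principal[OF D sz])
    show "ideal_on ?S T'" using T(1) pc hS unfolding ideal_on_def T'_def by auto
    show "1 \<notin> T'" using T(2) by (auto simp: T'_def)
    show "a \<in> T' \<or> b \<in> T'" if "a \<in> ?S" "b \<in> ?S" "a * b \<in> T'" for a b
      using Tp[OF hS[OF that(1)] hS[OF that(2)]] that by (auto simp: T'_def)
    show "c = 0" if "[:c:] \<in> T'" for c
    proof -
      have "coeff [:c:] 0 \<in> zring W" using that unfolding T'_def poly_on_def by blast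
      with that show ?thesis using T0[of c] by (auto simp: T'_def)
    qed
    show "p0 \<in> T'" "p0 \<noteq> 0" using p0 ne by (auto simp: T'_def)
  qed
  then obtain R where R: "R \<in> T'" "irred_on ?S R" "\<And>g. g \<in> T' \<Longrightarrow> dvd_on ?S R g" by blast
  have d: "?h R dvd g" if g: "g \<in> T" for g
  proof -
    have "g \<in> zring (insert v W)" using T(1) g by (auto simp: ideal_on_def)
    then obtain p where p: "p \<in> ?S" "g = ?h p" using zring_insert[OF W(2)] by auto
    then have "dvd_on ?S R p" using R(3) g by (auto simp: T'_def)
    then show ?thesis using p by (auto simp: dvd_on_def)
  qed
  have inj: "p = q" if "?h p = ?h q" "p \<in> ?S" "q \<in> ?S" for p q
    using zring_insert_inj[OF W(2)] that by (auto dest: inj_onD)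
  have unit: "dvd_on ?S p 1" if "dvd_on (zring (insert v W)) (?h p) 1" "p \<in> ?S" for p
  proof -
    from that(1) obtain k where "k \<in> zring (insert v W)" "1 = ?h p * k" by (auto simp: dvd_on_def)
    then obtain q where "q \<in> ?S" "?h 1 = ?h (p * q)" using zring_insert[OF W(2)] by auto
    then show ?thesis using inj[OF _ pc(1) pc(4)[OF that(2)]] unfolding dvd_on_def by blast
  qed
  have unit': "dvd_on (zring (insert v W)) (?h p) 1" if "dvd_on ?S p 1" for p
  proof -
    from that obtain k where k: "k \<in> ?S" "1 = p * k" by (auto simp: dvd_on_def)
    from arg_cong[OF k(2), of ?h] have "1 = ?h p * ?h k" by simp
    then show ?thesis using hS[OF k(1)] unfolding dvd_on_def by blast
  qed
  have RS: "R \<in> ?S" "R \<noteq> 0" using R(2) by (auto simp: irred_on_def)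
  have "irred_on (zring (insert v W)) (?h R)"
    unfolding irred_on_def
  proof (intro conjI ballI impI)
    show "?h R \<in> zring (insert v W)" by (rule hS[OF RS(1)])
    show "?h R \<noteq> 0" using inj[OF _ RS(1) pc(2)] RS(2) by auto
    show "\<not> dvd_on (zring (insert v W)) (?h R) 1" using R(2) unit[OF _ RS(1)] by (auto simp: irred_on_def)
    fix b c assume bc: "b \<in> zring (insert v W)" "c \<in> zring (insert v W)" "?h R = b * c"
    then obtain p q where pq: "b = ?h p" "c = ?h q" "p \<in> ?S" "q \<in> ?S" using zring_insert[OF W(2)] by auto
    then have "R = p * q" using inj[OF _ RS(1) pc(4)[OF pq(3,4)]] bc by simp
    then have "dvd_on ?S p 1 \<or> dvd_on ?S q 1" using R(2) pq unfolding irred_on_def by blast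
    then show "dvd_on (zring (insert v W)) b 1 \<or> dvd_on (zring (insert v W)) c 1" using unit' pq by blast
  qed
  then have "irreducible (?h R)" by (rule irred_on_zring_irreducible)
  moreover have "?h R \<in> T" using R(1) by (simp add: T'_def)
  ultimately show ?thesis using d by blast
qed

subsection \<open>The homogeneous Nullstellensatz\<close>

lemma ring_on_det:
  assumes "ring_on R" "A \<in> carrier_mat n n" "\<And>i j. i < n \<Longrightarrow> j < n \<Longrightarrow> A $$ (i, j) \<in> R"
  shows "det A \<in> R"
proof -
  have "signof p \<in> R" for p :: "nat \<Rightarrow> nat" using ring_onD[OF assms(1)] by (simp add: sign_def)
  then show ?thesis unfolding det_def'[OF assms(2)]
    by (intro ring_on_sum[OF assms(1)] ring_onD(4)[OF assms(1)] ring_on_prod[OF assms(1)] assms(3))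
      (auto dest: permutes_in_image)
qed

lemma ring_on_adj_mat:
  assumes "ring_on R" "A \<in> carrier_mat n n" "\<And>i j. i < n \<Longrightarrow> j < n \<Longrightarrow> A $$ (i, j) \<in> R" "i < n" "j < n"
  shows "adj_mat A $$ (i, j) \<in> R"
proof -
  have "det (mat_delete A j i) \<in> R"
  proof (rule ring_on_det[OF assms(1)])
    show "mat_delete A j i \<in> carrier_mat (n - 1) (n - 1)" using mat_delete_carrier[OF assms(2)] .
    show "mat_delete A j i $$ (k, l) \<in> R" if "k < n - 1" "l < n - 1" for k l
      using that assms(2,3) by (auto simp: mat_delete_def)
  qed
  then have "cofactor A j i \<in> R"
    unfolding cofactor_def by (intro ring_onD(4)[OF assms(1)] ring_on_power[OF assms(1)]) (auto simp: ring_onD[OF assms(1)])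
  then show ?thesis using assms by (simp add: adj_mat_def)
qed

lemma poly_truncate:
  fixes p :: "'a::comm_ring_1 poly"
  assumes "\<And>i. i \<ge> n \<Longrightarrow> coeff p i = 0"
  shows "poly p x = (\<Sum>i<n. coeff p i * x ^ i)"
proof -
  have "p = (\<Sum>i<n. monom (coeff p i) i)"
    by (rule poly_eqI) (use assms in \<open>auto simp: coeff_sum\<close>)
  from arg_cong[OF this, of "\<lambda>p. poly p x"] show ?thesis by (simp add: poly_sum poly_monom)
qed

text \<open>A leading coefficient 1 allows division without leaving \<open>R\<close>. The remainder
  is bounded through its coefficients rather than its degree, so that a constant divisor correctly
  forces the remainder 0.\<close>

lemma monic_division:
  assumes R: "ring_on R" and g: "g \<in> poly_on R" "lead_coeff g = 1" and p: "p \<in> poly_on R"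
  shows "\<exists>q\<in>poly_on R. \<exists>r\<in>poly_on R. p = g * q + r \<and> (\<forall>i\<ge>degree g. coeff r i = 0)"
proof -
  note pr = ring_onD[OF ring_on_poly_on[OF R]]
  have "\<forall>p\<in>poly_on R. (\<forall>i\<ge>n. coeff p i = 0) \<longrightarrow>
    (\<exists>q\<in>poly_on R. \<exists>r\<in>poly_on R. p = g * q + r \<and> (\<forall>i\<ge>degree g. coeff r i = 0))" for n
  proof (induction n)
    case 0
    show ?case
    proof (intro ballI impI)
      fix p :: "'a poly" assume "p \<in> poly_on R" "\<forall>i\<ge>0. coeff p i = 0"
      then show "\<exists>q\<in>poly_on R. \<exists>r\<in>poly_on R. p = g * q + r \<and> (\<forall>i\<ge>degree g. coeff r i = 0)"
        using pr(2) by (intro bexI[of _ 0]) (auto simp: poly_eq_iff)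
    qed
  next
    case (Suc n)
    show ?case
    proof (intro ballI impI)
      fix p :: "'a poly" assume p: "p \<in> poly_on R" "\<forall>i\<ge>Suc n. coeff p i = 0"
      show "\<exists>q\<in>poly_on R. \<exists>r\<in>poly_on R. p = g * q + r \<and> (\<forall>i\<ge>degree g. coeff r i = 0)"
      proof (cases "degree g \<le> n")
        case False
        then show ?thesis using p pr(2) by (intro bexI[of _ 0] bexI[of _ p]) auto
      next
        case True
        let ?m = "monom (coeff p n) (n - degree g)"
        have m: "?m \<in> poly_on R" using p ring_onD(2)[OF R] by (auto simp: poly_on_def)
        have z: "coeff (p - g * ?m) i = 0" if "i \<ge> n" for i
        proof (cases "i = n")
          case True
          then show ?thesis using g(2) \<open>degree g \<le> n\<close> by (simp add: mult.commute[of g] coeff_monom_mult)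
        next
          case False
          then have "coeff g (i - (n - degree g)) = 0" using that \<open>degree g \<le> n\<close> by (intro coeff_eq_0) auto
          then show ?thesis using p(2) that False by (simp add: mult.commute[of g] coeff_monom_mult)
        qed
        have "p - g * ?m \<in> poly_on R" using pr(6)[OF p(1) pr(4)[OF g(1) m]] .
        with Suc z obtain q r where qr: "q \<in> poly_on R" "r \<in> poly_on R" "p - g * ?m = g * q + r" "\<forall>i\<ge>degree g. coeff r i = 0"
          by blast
        then have "p = g * (q + ?m) + r" by (simp add: algebra_simps)
        then show ?thesis using qr pr(3)[OF qr(1) m] by blast
      qed
    qed
  qed
  from this[of "Suc (degree p)"] p show ?thesis by (auto simp: coeff_eq_0)
qed

text \<open>The element produced is the determinant of multiplication by \<open>p\<close> on the free module of
  polynomials modulo the monic \<open>g\<close>, which lies in the ideal generated by \<open>g\<close> and \<open>p\<close>.\<close>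
lemma elimination:
  fixes ev :: "'r::comm_ring_1 \<Rightarrow> 's::comm_ring_1"
  assumes ev: "comm_ring_hom ev" and R: "ring_on R" and RB: "R \<subseteq> B"
    and J: "ideal_on B J"
    and g: "g \<in> poly_on R" "lead_coeff g = 1" "poly g X \<in> J"
    and p: "p \<in> poly_on R" "poly p X \<in> J" "map_poly ev p = 1" and B: "ring_on B" "X \<in> B"
  shows "\<exists>h\<in>J \<inter> R. ev h = 1"
proof (cases "degree g = 0")
  case True
  interpret ev: comm_ring_hom ev by (rule ev)
  from True have "g = [:1:]" using g(2) by (metis degree_0_id)
  then show ?thesis using g(3) ring_onD(1)[OF R] by (intro bexI[of _ 1]) auto
next
  case False
  interpret ev: comm_ring_hom ev by (rule ev)
  interpret mp: map_poly_comm_ring_hom ev ..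
  let ?e = "degree g"
  \<comment> \<open>The remainders of \<open>monom 1 i * p\<close> modulo \<open>g\<close> are the
    rows of the multiplication matrix.\<close>
  have "\<forall>i. \<exists>q r. q \<in> poly_on R \<and> r \<in> poly_on R \<and> monom 1 i * p = g * q + r \<and> (\<forall>k\<ge>?e. coeff r k = 0)"
  proof
    fix i
    have "monom 1 i * p \<in> poly_on R"
      using ring_onD(4)[OF ring_on_poly_on[OF R] _ p(1)] ring_onD[OF R] by (auto simp: poly_on_def)
    from monic_division[OF R g(1,2) this]
    show "\<exists>q r. q \<in> poly_on R \<and> r \<in> poly_on R \<and> monom 1 i * p = g * q + r \<and> (\<forall>k\<ge>?e. coeff r k = 0)" by blast
  qed
  from choice[OF this] obtain q
    where "\<forall>i. \<exists>r. q i \<in> poly_on R \<and> r \<in> poly_on R \<and> monom 1 i * p = g * q i + r \<and> (\<forall>k\<ge>?e. coeff r k = 0)" ..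
  from choice[OF this] obtain r
    where "\<forall>i. q i \<in> poly_on R \<and> r i \<in> poly_on R \<and> monom 1 i * p = g * q i + r i \<and> (\<forall>k\<ge>?e. coeff (r i) k = 0)" ..
  then have q: "q i \<in> poly_on R" and r: "r i \<in> poly_on R" and qr: "monom 1 i * p = g * q i + r i"
    and r0: "k \<ge> ?e \<Longrightarrow> coeff (r i) k = 0" for i k
    by auto
  define M where "M = mat ?e ?e (\<lambda>(i, j). coeff (r i) j)"
  have M: "M \<in> carrier_mat ?e ?e" by (simp add: M_def)
  have MR: "M $$ (i, j) \<in> R" if "i < ?e" "j < ?e" for i j
    using that r by (auto simp: M_def poly_on_def)
  have J': "x + y \<in> J" "0 \<in> J" "s \<in> B \<Longrightarrow> s * x \<in> J" if "x \<in> J" "y \<in> J" for x y s using J that by (auto simp: ideal_on_def)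
  have polyB: "poly f X \<in> B" if "f \<in> poly_on R" for f
    unfolding poly_altdef using that RB by (intro ring_on_sum[OF B(1)] ring_onD(4)[OF B(1)] ring_on_power[OF B(1)] B(2)) (auto simp: poly_on_def)
  have rJ: "poly (r i) X \<in> J" for i
  proof -
    have "X ^ i * poly p X = poly g X * poly (q i) X + poly (r i) X"
      using arg_cong[OF qr[of i], of "\<lambda>p. poly p X"] by (simp add: poly_monom)
    then have "poly (r i) X = X ^ i * poly p X + (- poly (q i) X) * poly g X" by (simp add: algebra_simps)
    then show ?thesis
      using J'(1)[OF J'(3)[OF p(2) p(2) ring_on_power[OF B]] J'(3)[OF g(3) g(3) ring_onD(5)[OF B(1) polyB[OF q]]]] by metis
  qed
  define h where "h = det M"
  have "h \<in> R" unfolding h_def using ring_on_det[OF R M MR] .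
  moreover have "h \<in> J"
  proof -
    \<comment> \<open>Cramer's rule: row 0 of adjugate times \<open>M\<close>, applied to the powers
      of \<open>X\<close>, writes \<open>h\<close> as a combination of the values
      \<open>poly (r i) X\<close>, all of which lie in \<open>J\<close>.\<close>
    have adj: "(\<Sum>i<?e. adj_mat M $$ (0, i) * M $$ (i, j)) = (if j = 0 then h else 0)" if "j < ?e" for j
    proof -
      have "(\<Sum>i<?e. adj_mat M $$ (0, i) * M $$ (i, j)) = (adj_mat M * M) $$ (0, j)"
        using M adj_mat(1)[OF M] that False
        by (auto simp: scalar_prod_def atLeast0LessThan)
      then show ?thesis unfolding adj_mat(3)[OF M] using that False by (auto simp: h_def)
    qed
    have "(\<Sum>i<?e. adj_mat M $$ (0, i) * poly (r i) X) = (\<Sum>i<?e. \<Sum>j<?e. adj_mat M $$ (0, i) * M $$ (i, j) * X ^ j)"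
      by (simp add: poly_truncate[OF r0] sum_distrib_left M_def mult.assoc)
    also have "\<dots> = (\<Sum>j<?e. (\<Sum>i<?e. adj_mat M $$ (0, i) * M $$ (i, j)) * X ^ j)"
      by (subst sum.swap) (simp add: sum_distrib_right)
    also have "\<dots> = (\<Sum>j<?e. if j = 0 then h else 0)"
      by (rule sum.cong) (auto simp: adj)
    also have "\<dots> = h" using False by simp
    finally have h: "h = (\<Sum>i<?e. adj_mat M $$ (0, i) * poly (r i) X)" ..
    have sJ: "(\<And>i. i \<in> A \<Longrightarrow> f i \<in> J) \<Longrightarrow> sum f A \<in> J" for f and A :: "nat set"
      by (induction A rule: infinite_finite_induct) (use J'[OF p(2) p(2)] J' in auto)
    show ?thesis unfolding h
      by (intro sJ J'(3)[OF rJ rJ] subsetD[OF RB] ring_on_adj_mat[OF R M MR]) (use False in auto)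
  qed
  \<comment> \<open>Under \<open>ev\<close> the polynomial \<open>p\<close> becomes 1, so
    multiplication by it becomes the identity. Uniqueness of division by the monic image of
    \<open>g\<close> makes this visible in the matrix.\<close>
  moreover have "ev h = 1"
  proof -
    have lc: "coeff (map_poly ev g) ?e = 1" using g(2) by simp
    then have dg: "degree (map_poly ev g) = ?e"
      by (intro antisym degree_map_poly_le le_degree) simp
    have c: "coeff (map_poly ev (r i)) j = (if i = j then 1 else 0)" if "i < ?e" for i j
    proof -
      have e: "monom 1 i = map_poly ev g * map_poly ev (q i) + map_poly ev (r i)"
        using arg_cong[OF qr[of i], of "map_poly ev"] p(3) by (simp add: mp.hom_add mp.hom_mult map_poly_monom)
      have "map_poly ev (q i) = 0"
      proof (rule ccontr)
        let ?q = "map_poly ev (q i)"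
        assume "?q \<noteq> 0"
        have "coeff (map_poly ev g * ?q) (?e + degree ?q) = lead_coeff ?q"
          using coeff_mult_degree_sum[of "map_poly ev g" ?q] lc dg by simp
        moreover have "coeff (map_poly ev (r i)) (?e + degree ?q) = 0" by (simp add: r0)
        moreover have "coeff (monom 1 i) (?e + degree ?q) = (0::'s)" using that by simp
        ultimately have "lead_coeff ?q = 0" using arg_cong[OF e, of "\<lambda>p. coeff p (?e + degree ?q)"] by simp
        then show False using \<open>?q \<noteq> 0\<close> leading_coeff_0_iff[of ?q] by blast
      qed
      with e have "map_poly ev (r i) = monom 1 i" by simp
      then show ?thesis by simp
    qed
    have "map_mat ev M = 1\<^sub>m ?e"
      by (rule eq_matI) (use c in \<open>auto simp: M_def coeff_map_poly\<close>)
    then have "det (map_mat ev M) = 1" by simp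
    then show ?thesis by (simp add: h_def)
  qed
  ultimately show ?thesis by blast
qed

text \<open>A nonzero element of least degree generates, and a root of it would be a common root.
  Closure under \<open>a - s * b\<close> encodes an ideal in one condition and is exactly what a
  division remainder needs.\<close>

lemma poly_ideal_contains_1:
  fixes A :: "'k::field poly set"
  assumes ac: "alg_closed TYPE('k)" and A: "\<And>a b s. a \<in> A \<Longrightarrow> b \<in> A \<Longrightarrow> a - s * b \<in> A"
    and ne: "a0 \<in> A" "a0 \<noteq> 0" and nz: "\<And>t. \<exists>a\<in>A. poly a t \<noteq> 0"
  shows "1 \<in> A"
proof -
  obtain r where r: "r \<in> A" "r \<noteq> 0" "\<And>a. a \<in> A \<Longrightarrow> a \<noteq> 0 \<Longrightarrow> degree r \<le> degree a"
    using ideal_minimal_degree[OF ne] by blast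
  have dvd: "r dvd a" if "a \<in> A" for a
  proof (rule ccontr)
    assume "\<not> r dvd a"
    then have n: "a mod r \<noteq> 0" by (simp add: dvd_eq_mod_eq_0)
    have "a mod r \<in> A" using A[OF that r(1), of "a div r"] by (simp add: minus_div_mult_eq_mod)
    then show False using r(3)[OF _ n] degree_mod_less[OF r(2), of a] n by simp
  qed
  have "degree r = 0"
  proof (rule ccontr)
    assume "degree r \<noteq> 0"
    then obtain t where t: "poly r t = 0" using ac by (auto simp: alg_closed_def)
    then have "poly a t = 0" if "a \<in> A" for a using dvd[OF that] by (auto elim!: dvdE)
    then show False using nz by blast
  qed
  then obtain b where b: "r = [:b:]" by (metis degree_0_id)
  then have b0: "b \<noteq> 0" using r(2) by auto
  have "1 = 0 - [:- 1 / b:] * r" using b b0 by (simp add: one_pCons)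
  moreover have "0 \<in> A" using A[OF r(1) r(1), of 1] by simp
  ultimately show ?thesis using A[OF _ r(1)] by metis
qed

section \<open>Forms and polynomial functions of the coordinates\<close>

type_synonym 'k vecfun = "(nat \<Rightarrow> 'k) \<Rightarrow> 'k"

lemma finite_mons_deg [simp]: "finite (mons_deg N d)"
proof (rule finite_subset)
  have "\<alpha> i \<le> d" if "\<alpha> \<in> mons_deg N d" for \<alpha> i
  proof (cases "i \<le> N")
    case True
    then show ?thesis using that member_le_sum[of i "{..N}" \<alpha>] by (auto simp: mons_deg_def)
  qed (use that in \<open>auto simp: mons_deg_def\<close>)
  then show "mons_deg N d \<subseteq> {f. \<forall>x. (x \<in> {..N} \<longrightarrow> f x \<in> {..d}) \<and> (x \<notin> {..N} \<longrightarrow> f x = 0)}"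
    by (auto simp: mons_deg_def)
  show "finite {f. \<forall>x. (x \<in> {..N} \<longrightarrow> f x \<in> {..d}) \<and> (x \<notin> {..N} \<longrightarrow> f x = (0::nat))}"
    by (rule finite_set_of_finite_funs) auto
qed

lemma heval_scale: "heval N d c (\<lambda>i. s * x i) = s ^ d * heval N d c x"
  unfolding heval_def sum_distrib_left
proof (rule sum.cong)
  fix \<alpha> assume "\<alpha> \<in> mons_deg N d"
  then have "(\<Prod>i\<le>N. s ^ \<alpha> i) = s ^ d" by (simp add: mons_deg_def flip: power_sum)
  then show "c \<alpha> * (\<Prod>i\<le>N. (s * x i) ^ \<alpha> i) = s ^ d * (c \<alpha> * (\<Prod>i\<le>N. x i ^ \<alpha> i))"
    by (simp add: power_mult_distrib prod.distrib mult_ac)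
qed simp

lemma heval_cong: "(\<And>i. i \<le> N \<Longrightarrow> x i = y i) \<Longrightarrow> heval N d c x = heval N d c y"
  unfolding heval_def by (intro sum.cong refl arg_cong2[of _ _ _ _ "(*)"] prod.cong) auto

lemma heval_single:
  assumes "\<alpha> \<in> mons_deg N d"
  shows "heval N d (\<lambda>\<beta>. if \<beta> = \<alpha> then c else 0) x = c * (\<Prod>i\<le>N. x i ^ \<alpha> i)"
proof -
  have "heval N d (\<lambda>\<beta>. if \<beta> = \<alpha> then c else 0) x
      = (\<Sum>\<beta>\<in>mons_deg N d. if \<beta> = \<alpha> then c * (\<Prod>i\<le>N. x i ^ \<alpha> i) else 0)"
    unfolding heval_def by (rule sum.cong) auto
  then show ?thesis using assms by simp
qed

lemma prod_delta_power:
  fixes x :: "nat \<Rightarrow> 'k::comm_ring_1"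
  assumes "k \<le> N"
  shows "(\<Prod>i\<le>N. x i ^ (if i = k then e else 0)) = x k ^ e"
proof -
  have "(\<Prod>i\<le>N. x i ^ (if i = k then e else 0)) = (\<Prod>i\<le>N. if i = k then x k ^ e else 1)"
    by (rule prod.cong) auto
  then show ?thesis using assms by simp
qed

lemma delta_mons_deg: "k \<le> N \<Longrightarrow> (\<lambda>i. if i = k then e else 0) \<in> mons_deg N e"
  by (auto simp: mons_deg_def)

definition forms :: "nat \<Rightarrow> nat set \<Rightarrow> nat \<Rightarrow> 'k::comm_ring_1 vecfun set" where
  "forms N I e = {heval N e c | c. \<forall>\<alpha>. c \<alpha> \<noteq> 0 \<longrightarrow> (\<forall>i. i \<notin> I \<longrightarrow> \<alpha> i = 0)}"

lemma forms_scale: "f \<in> forms N I e \<Longrightarrow> f (\<lambda>i. s * x i) = s ^ e * f x"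
  by (auto simp: forms_def heval_scale)

lemma forms_add: "f \<in> forms N I e \<Longrightarrow> g \<in> forms N I e \<Longrightarrow> f + g \<in> forms N I e"
proof -
  assume "f \<in> forms N I e" "g \<in> forms N I e"
  then obtain c c' where c: "f = heval N e c" "\<forall>\<alpha>. c \<alpha> \<noteq> 0 \<longrightarrow> (\<forall>i. i \<notin> I \<longrightarrow> \<alpha> i = 0)"
    and c': "g = heval N e c'" "\<forall>\<alpha>. c' \<alpha> \<noteq> 0 \<longrightarrow> (\<forall>i. i \<notin> I \<longrightarrow> \<alpha> i = 0)" by (auto simp: forms_def)
  have "f + g = heval N e (\<lambda>\<alpha>. c \<alpha> + c' \<alpha>)"
    by (rule ext) (simp add: c c' heval_def distrib_right sum.distrib)
  moreover have "\<forall>\<alpha>. c \<alpha> + c' \<alpha> \<noteq> 0 \<longrightarrow> (\<forall>i. i \<notin> I \<longrightarrow> \<alpha> i = 0)" using c(2) c'(2) by (metis add_cancel_left_left)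
  ultimately show ?thesis unfolding forms_def by blast
qed

lemma forms_0: "0 \<in> forms N I e"
  unfolding forms_def by (rule CollectI, rule exI[of _ "\<lambda>_. 0"]) (auto simp: heval_def fun_eq_iff)

lemma forms_sum: "(\<And>i. i \<in> A \<Longrightarrow> f i \<in> forms N I e) \<Longrightarrow> sum f A \<in> forms N I e"
  by (induction A rule: infinite_finite_induct) (auto simp: forms_0 forms_add)

lemma forms_monomial:
  assumes "\<alpha> \<in> mons_deg N e" "c \<noteq> 0 \<Longrightarrow> \<forall>i. i \<notin> I \<longrightarrow> \<alpha> i = 0"
  shows "(\<lambda>x. c * (\<Prod>i\<le>N. x i ^ \<alpha> i)) \<in> forms N I e"
  unfolding forms_def
proof (rule CollectI, rule exI[of _ "\<lambda>\<beta>. if \<beta> = \<alpha> then c else 0"], intro conjI)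
  show "(\<lambda>x. c * (\<Prod>i\<le>N. x i ^ \<alpha> i)) = heval N e (\<lambda>\<beta>. if \<beta> = \<alpha> then c else 0)"
    by (rule ext) (rule heval_single[OF assms(1), symmetric])
qed (use assms(2) in auto)

lemma sum_fun_apply: "(\<Sum>i\<in>A. f i) x = (\<Sum>i\<in>A. f i x)"
  for f :: "'i \<Rightarrow> 'a \<Rightarrow> 'b::comm_ring_1"
  by (induction A rule: infinite_finite_induct) auto

lemma power_fun_apply: "(f ^ n) x = f x ^ n" for f :: "'a \<Rightarrow> 'b::comm_ring_1"
  by (induction n) auto

lemma forms_mult:
  assumes "f \<in> forms N I a" "g \<in> forms N I b"
  shows "f * g \<in> forms N I (a + b)"
proof -
  obtain c c' where c: "f = heval N a c" "\<forall>\<alpha>. c \<alpha> \<noteq> 0 \<longrightarrow> (\<forall>i. i \<notin> I \<longrightarrow> \<alpha> i = 0)"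
    and c': "g = heval N b c'" "\<forall>\<alpha>. c' \<alpha> \<noteq> 0 \<longrightarrow> (\<forall>i. i \<notin> I \<longrightarrow> \<alpha> i = 0)" using assms by (auto simp: forms_def)
  have "f * g = (\<Sum>\<alpha>\<in>mons_deg N a. \<Sum>\<beta>\<in>mons_deg N b. (\<lambda>x. (c \<alpha> * c' \<beta>) * (\<Prod>i\<le>N. x i ^ (\<alpha> i + \<beta> i))))"
    unfolding c(1) c'(1)
    by (rule ext, simp only: times_fun_apply heval_def sum_fun_apply sum_product)
      (intro sum.cong refl, simp add: power_add prod.distrib mult_ac)
  also have "\<dots> \<in> forms N I (a + b)"
  proof (intro forms_sum forms_monomial)
    fix \<alpha> \<beta> assume "\<alpha> \<in> mons_deg N a" "\<beta> \<in> mons_deg N b"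
    then show "(\<lambda>i. \<alpha> i + \<beta> i) \<in> mons_deg N (a + b)" by (auto simp: mons_deg_def sum.distrib)
    assume "c \<alpha> * c' \<beta> \<noteq> 0"
    then have "c \<alpha> \<noteq> 0" "c' \<beta> \<noteq> 0" by auto
    then show "\<forall>i. i \<notin> I \<longrightarrow> \<alpha> i + \<beta> i = 0" using c(2) c'(2) by simp
  qed
  finally show ?thesis .
qed

lemma forms_const: "(\<lambda>x. c) \<in> forms N I 0"
proof -
  have "(\<lambda>x. c * (\<Prod>i\<le>N. x i ^ 0)) \<in> forms N I 0"
    by (rule forms_monomial) (auto simp: mons_deg_def)
  then show ?thesis by simp
qed

definition coord :: "nat \<Rightarrow> (nat \<Rightarrow> 'k) \<Rightarrow> 'k" where
  "coord k = (\<lambda>x. x k)"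

lemma forms_coord:
  assumes "k \<in> I" "k \<le> N"
  shows "coord k \<in> forms N I 1"
proof -
  have "(\<lambda>x. 1 * (\<Prod>i\<le>N. x i ^ (if i = k then 1 else 0))) \<in> forms N I 1"
    using assms by (intro forms_monomial delta_mons_deg) auto
  then show ?thesis using assms(2) by (simp add: prod_delta_power coord_def)
qed

lemma forms_coord_power: "k \<in> I \<Longrightarrow> k \<le> N \<Longrightarrow> coord k ^ n \<in> forms N I n"
proof (induction n)
  case 0
  then show ?case using forms_const[of 1 N I] by (simp add: one_fun_def)
next
  case (Suc n)
  then show ?case using forms_mult[OF forms_coord[of k I N] Suc(1)] unfolding power_Suc plus_1_eq_Suc by blast
qed

text \<open>Polynomials are represented by the functions they induce. Nothing is lost over an
  infinite field, and evaluation at a point, restriction to fewer coordinates and comparison of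
  expressions become immediate.\<close>

inductive_set polyfun :: "nat set \<Rightarrow> 'k::comm_ring_1 vecfun set" for I where
  const: "(\<lambda>x. c) \<in> polyfun I"
| coord: "i \<in> I \<Longrightarrow> coord i \<in> polyfun I"
| add: "f \<in> polyfun I \<Longrightarrow> g \<in> polyfun I \<Longrightarrow> f + g \<in> polyfun I"
| mult: "f \<in> polyfun I \<Longrightarrow> g \<in> polyfun I \<Longrightarrow> f * g \<in> polyfun I"

lemma ring_on_polyfun: "ring_on (polyfun I)"
proof -
  have "(\<lambda>x. c) \<in> polyfun I" for c by (rule polyfun.const)
  moreover from this have "(\<lambda>x. - 1) * f \<in> polyfun I" if "f \<in> polyfun I" for f using that by (rule polyfun.mult)
  moreover have "(\<lambda>x. - 1) * f = - f" for f :: "(nat \<Rightarrow> 'a) \<Rightarrow> 'a" by (rule ext) simp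
  ultimately show ?thesis
    unfolding ring_on_def one_fun_def using polyfun.add polyfun.mult by metis
qed

lemma polyfun_mono:
  assumes "I \<subseteq> I'"
  shows "polyfun I \<subseteq> polyfun I'"
proof
  fix f :: "(nat \<Rightarrow> 'a) \<Rightarrow> 'a" assume "f \<in> polyfun I"
  then show "f \<in> polyfun I'" by induction (use assms polyfun.intros in blast)+
qed

lemma polyfun_cong: "f \<in> polyfun I \<Longrightarrow> (\<And>i. i \<in> I \<Longrightarrow> x i = y i) \<Longrightarrow> f x = f y"
  by (induction rule: polyfun.induct) (auto simp: coord_def)

lemma forms_polyfun: "forms N I e \<subseteq> polyfun I"
proof
  fix f :: "(nat \<Rightarrow> 'a) \<Rightarrow> 'a" assume "f \<in> forms N I e"
  then obtain c where c: "f = heval N e c" "\<And>\<alpha> i. c \<alpha> \<noteq> 0 \<Longrightarrow> i \<notin> I \<Longrightarrow> \<alpha> i = 0" by (auto simp: forms_def)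
  have "f = (\<Sum>\<alpha>\<in>mons_deg N e. (\<lambda>x. c \<alpha>) * (\<lambda>x. \<Prod>i\<le>N. x i ^ \<alpha> i))"
    by (rule ext) (simp add: c heval_def sum_fun_apply)
  also have "\<dots> \<in> polyfun I"
  proof (rule ring_on_sum[OF ring_on_polyfun])
    fix \<alpha> assume "\<alpha> \<in> mons_deg N e"
    show "(\<lambda>x. c \<alpha>) * (\<lambda>x. \<Prod>i\<le>N. x i ^ \<alpha> i) \<in> polyfun I"
    proof (cases "c \<alpha> = 0")
      case True
      then have "(\<lambda>x. c \<alpha>) * (\<lambda>x. \<Prod>i\<le>N. x i ^ \<alpha> i) = (\<lambda>x. 0)" by (auto simp: fun_eq_iff)
      then show ?thesis by (simp add: polyfun.const)
    next
      case False
      have "(\<lambda>x :: nat \<Rightarrow> 'a. \<Prod>i\<le>N. x i ^ \<alpha> i) = (\<Prod>i\<le>N. coord i ^ \<alpha> i)"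
      proof -
        have "(\<Prod>i\<in>A. coord i ^ \<alpha> i) x = (\<Prod>i\<in>A. x i ^ \<alpha> i)" for A and x :: "nat \<Rightarrow> 'a"
          by (induction A rule: infinite_finite_induct) (auto simp: power_fun_apply coord_def)
        from this[of "{..N}"] show ?thesis by (simp add: fun_eq_iff)
      qed
      also have "\<dots> \<in> polyfun I"
      proof (rule ring_on_prod[OF ring_on_polyfun])
        fix i
        show "coord i ^ \<alpha> i \<in> polyfun I"
          using c(2)[OF False, of i] ring_onD(1)[OF ring_on_polyfun, of I]
          by (cases "i \<in> I") (auto intro: ring_on_power[OF ring_on_polyfun] polyfun.coord)
      qed
      finally show ?thesis by (intro polyfun.mult polyfun.const)
    qed
  qed
  finally show "f \<in> polyfun I" .
qed

lemma ev_hom: "comm_ring_hom (\<lambda>f :: 'a \<Rightarrow> 'k::comm_ring_1. f x)"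
  by unfold_locales auto

lemma poly_fun_eval: "(poly p F) x = poly (map_poly (\<lambda>f. f x) p) (F x)"
  for p :: "('a \<Rightarrow> 'k::comm_ring_1) poly"
proof -
  interpret comm_ring_hom "\<lambda>f :: 'a \<Rightarrow> 'k. f x" by (rule ev_hom)
  show ?thesis by simp
qed

lemma polyfun_split_coord:
  assumes "f \<in> polyfun I"
  shows "\<exists>p\<in>poly_on (polyfun (I - {k})). f = poly p (coord k)"
  using assms
proof induction
  case (const c)
  have "[:\<lambda>x. c:] \<in> poly_on (polyfun (I - {k}))"
    using ring_onD(2)[OF ring_on_polyfun] by (auto simp: poly_on_def coeff_pCons polyfun.const split: nat.split)
  then show ?case by (rule rev_bexI) simp
next
  case (coord i)
  show ?case
  proof (cases "i = k")
    case True
    have "[:0, 1:] \<in> poly_on (polyfun (I - {k}))"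
      using ring_onD(1,2)[OF ring_on_polyfun] by (auto simp: poly_on_def coeff_pCons split: nat.split)
    then show ?thesis by (rule rev_bexI) (simp add: True)
  next
    case False
    then have "[:coord i:] \<in> poly_on (polyfun (I - {k}))"
      using ring_onD(2)[OF ring_on_polyfun] coord by (auto simp: poly_on_def coeff_pCons polyfun.coord split: nat.split)
    then show ?thesis by (rule rev_bexI) simp
  qed
next
  case (add f g)
  then obtain p q where "p \<in> poly_on (polyfun (I - {k}))" "q \<in> poly_on (polyfun (I - {k}))" "f = poly p (coord k)" "g = poly q (coord k)" by blast
  then show ?case using ring_onD(3)[OF ring_on_poly_on[OF ring_on_polyfun]] by (metis poly_add)
next
  case (mult f g)
  then obtain p q where "p \<in> poly_on (polyfun (I - {k}))" "q \<in> poly_on (polyfun (I - {k}))" "f = poly p (coord k)" "g = poly q (coord k)" by blast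
  then show ?case using ring_onD(4)[OF ring_on_poly_on[OF ring_on_polyfun]] by (metis poly_mult)
qed

section \<open>Homogeneous components and homogeneous ideals\<close>

text \<open>The homogeneous components of \<open>f\<close> are encoded as the coefficients of a polynomial \<open>p\<close>.\<close>
definition homog_parts :: "nat \<Rightarrow> nat set \<Rightarrow> 'k::comm_ring_1 vecfun poly \<Rightarrow> 'k vecfun \<Rightarrow> bool" where
  "homog_parts N I p f \<longleftrightarrow> poly p 1 = f \<and> (\<forall>e. coeff p e \<in> forms N I e)"

lemma homog_parts_mult:
  assumes "homog_parts N I p f" "homog_parts N I q g"
  shows "homog_parts N I (p * q) (f * g)"
proof -
  have "coeff p i * coeff q (e - i) \<in> forms N I e" if "i \<in> {..e}" for e i :: nat
    using forms_mult[of "coeff p i" N I i "coeff q (e - i)" "e - i"] assms that by (auto simp: homog_parts_def)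
  then have "coeff (p * q) e \<in> forms N I e" for e unfolding coeff_mult by (rule forms_sum)
  moreover have "poly (p * q) 1 = f * g" using assms by (simp only: homog_parts_def poly_mult)
  ultimately show ?thesis unfolding homog_parts_def by blast
qed

lemma homog_parts_add:
  "homog_parts N I p f \<Longrightarrow> homog_parts N I q g \<Longrightarrow> homog_parts N I (p + q) (f + g)"
  by (auto simp: homog_parts_def forms_add)

lemma homog_parts_form:
  "f \<in> forms N I e \<Longrightarrow> homog_parts N I (monom f e) f"
  by (auto simp: homog_parts_def poly_monom forms_0)

lemma polyfun_homog_parts:
  assumes "f \<in> polyfun I" "I \<subseteq> {..N}"
  shows "\<exists>p. homog_parts N I p f"
  using assms(1)
proof induction
  case (const c)
  show ?case using homog_parts_form[OF forms_const] by blast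
next
  case (coord i)
  then show ?case using homog_parts_form[OF forms_coord[of i I N]] assms(2) by blast
next
  case (add f g)
  then show ?case using homog_parts_add by blast
next
  case (mult f g)
  then show ?case using homog_parts_mult by blast
qed

text \<open>Along the ray through \<open>x\<close>, the function becomes a univariate polynomial in
  the scaling factor whose coefficients are the values of the components at \<open>x\<close>; over
  an infinite field these are determined. The index sets may differ, so components can be compared
  after variables have been removed.\<close>

lemma homog_parts_unique:
  fixes f :: "'k::field vecfun"
  assumes inf: "infinite (UNIV :: 'k set)" and p: "homog_parts N I p f" and q: "homog_parts N I' q f"
  shows "p = q"
proof -
  have scale: "poly (map_poly (\<lambda>f. f x) p) s = f (\<lambda>i. s * x i)" if "homog_parts N I p f"
    for p :: "'k vecfun poly" and I s x
  proof -
    have "poly (map_poly (\<lambda>f. f x) p) s = (\<Sum>e<Suc (degree p). coeff p e x * s ^ e)"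
      by (subst poly_truncate[of "Suc (degree p)"]) (auto simp: coeff_map_poly coeff_eq_0)
    also have "\<dots> = (\<Sum>e<Suc (degree p). coeff p e (\<lambda>i. s * x i))"
    proof (rule sum.cong)
      fix e
      have "coeff p e \<in> forms N I e" using that by (simp add: homog_parts_def)
      then show "coeff p e x * s ^ e = coeff p e (\<lambda>i. s * x i)" by (simp add: forms_scale)
    qed simp
    also have "\<dots> = (poly p 1) (\<lambda>i. s * x i)"
      by (subst poly_truncate[of "Suc (degree p)"]) (auto simp: sum_fun_apply coeff_eq_0)
    also have "\<dots> = f (\<lambda>i. s * x i)" using that by (simp add: homog_parts_def)
    finally show ?thesis .
  qed
  have eq: "map_poly (\<lambda>f. f x) p = map_poly (\<lambda>f. f x) q" for x
  proof (rule ccontr)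
    let ?d = "map_poly (\<lambda>f. f x) p - map_poly (\<lambda>f. f x) q"
    assume "\<not> ?thesis"
    then have "finite {s. poly ?d s = 0}" by (intro poly_roots_finite) simp
    moreover have "{s. poly ?d s = 0} = UNIV" using scale[OF p] scale[OF q] by auto
    ultimately show False using inf by simp
  qed
  show ?thesis
  proof (rule poly_eqI, rule ext)
    fix e x
    show "coeff p e x = coeff q e x" using arg_cong[OF eq[of x], of "\<lambda>p. coeff p e"] by (simp add: coeff_map_poly)
  qed
qed

definition hom_ideal :: "nat \<Rightarrow> nat set \<Rightarrow> 'k::comm_ring_1 vecfun set \<Rightarrow> bool" where
  "hom_ideal N I J \<longleftrightarrow> ideal_on (polyfun I) J \<and> (\<forall>f\<in>J. \<exists>p. homog_parts N I p f \<and> (\<forall>e. coeff p e \<in> J))"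

lemma hom_ideal_form:
  assumes "hom_ideal N I J" "f \<in> J" "f x \<noteq> 0"
  shows "\<exists>e. \<exists>g\<in>J \<inter> forms N I e. g x \<noteq> 0"
proof -
  obtain p where p: "homog_parts N I p f" "\<And>e. coeff p e \<in> J" using assms by (auto simp: hom_ideal_def)
  have "poly p 1 = (\<Sum>e<Suc (degree p). coeff p e)"
    by (subst poly_truncate[of "Suc (degree p)"]) (auto simp: coeff_eq_0)
  then have "f x = (\<Sum>e<Suc (degree p). coeff p e x)"
    using p(1) by (simp only: homog_parts_def sum_fun_apply[symmetric])
  then obtain e where "coeff p e x \<noteq> 0" using assms(3) by (metis sum.neutral)
  then show ?thesis using p by (auto simp: homog_parts_def)
qed

definition axis_vec :: "nat \<Rightarrow> nat \<Rightarrow> 'k::comm_ring_1" where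
  "axis_vec k = (\<lambda>i. if i = k then 1 else 0)"

lemma mons_deg_eq_delta:
  assumes "\<alpha> \<in> mons_deg N e" "k \<le> N" "\<And>i. i \<le> N \<Longrightarrow> i \<noteq> k \<Longrightarrow> \<alpha> i = 0"
  shows "\<alpha> = (\<lambda>i. if i = k then e else 0)"
proof -
  have "(\<Sum>i\<le>N. \<alpha> i) = (\<Sum>i\<in>{k}. \<alpha> i)"
    by (rule sum.mono_neutral_right) (use assms(2,3) in auto)
  then have "\<alpha> k = e" using assms(1) by (simp add: mons_deg_def)
  moreover have "\<alpha> i = 0" if "i \<noteq> k" for i
    using assms(1,3) that by (cases "i \<le> N") (auto simp: mons_deg_def)
  ultimately show ?thesis by auto
qed

lemma heval_axis:
  assumes "k \<le> N"
  shows "heval N e c (axis_vec k) = c (\<lambda>i. if i = k then e else 0)"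
proof -
  let ?\<delta> = "\<lambda>i. if i = k then e else 0"
  have "heval N e c (axis_vec k) = (\<Sum>\<alpha>\<in>mons_deg N e. if \<alpha> = ?\<delta> then c ?\<delta> else 0)"
    unfolding heval_def
  proof (rule sum.cong)
    fix \<alpha> assume \<alpha>: "\<alpha> \<in> mons_deg N e"
    show "c \<alpha> * (\<Prod>i\<le>N. axis_vec k i ^ \<alpha> i) = (if \<alpha> = ?\<delta> then c ?\<delta> else 0)"
    proof (cases "\<alpha> = ?\<delta>")
      case True
      have "(\<Prod>i\<le>N. axis_vec k i ^ \<alpha> i) = (1 :: 'a)" by (rule prod.neutral) (auto simp: True axis_vec_def)
      with True show ?thesis by simp
    next
      case False
      then obtain i where "i \<le> N" "i \<noteq> k" "\<alpha> i \<noteq> 0" using mons_deg_eq_delta[OF \<alpha> assms] by blast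
      then have "(\<Prod>i\<le>N. axis_vec k i ^ \<alpha> i) = (0 :: 'a)" by (intro prod_zero finite_atMost bexI[of _ i]) (simp_all add: axis_vec_def power_0_left)
      with False show ?thesis by simp
    qed
  qed simp
  then show ?thesis using delta_mons_deg[OF assms, of e] by simp
qed

text \<open>A form not vanishing at the \<open>k\<close>-th axis is monic in the \<open>k\<close>-th variable up to a scalar, so no
  change of coordinates is needed before eliminating.\<close>
lemma monic_element:
  fixes J :: "'k::field vecfun set"
  assumes J: "hom_ideal N I J" and k: "k \<in> I" "I \<subseteq> {..N}" and f: "f \<in> J" "f (axis_vec k) \<noteq> 0"
  shows "\<exists>p\<in>poly_on (polyfun (I - {k})). lead_coeff p = 1 \<and> poly p (coord k) \<in> J"
proof -
  obtain e g where g: "g \<in> J" "g \<in> forms N I e" "g (axis_vec k) \<noteq> 0" using hom_ideal_form[OF J f] by blast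
  have kN: "k \<le> N" using k by auto
  let ?\<delta> = "\<lambda>i. if i = k then e else 0"
  obtain c where c: "g = heval N e c" "\<And>\<alpha> i. c \<alpha> \<noteq> 0 \<Longrightarrow> i \<notin> I \<Longrightarrow> \<alpha> i = 0" using g(2) by (auto simp: forms_def)
  define a where "a = c ?\<delta>"
  have a: "a \<noteq> 0" using g(3) by (simp add: c(1) heval_axis[OF kN] a_def)
  \<comment> \<open>\<open>a\<close> is the coefficient of the pure power of degree \<open>e\<close>
    of the \<open>k\<close>-th variable. Each term is normalised by \<open>a\<close> and stripped of
    its power of that variable, which \<open>p\<close> will carry as its indeterminate.\<close>
  define m where "m \<alpha> = (\<lambda>x. c \<alpha> / a * (\<Prod>i\<in>{..N} - {k}. x i ^ \<alpha> i))" for \<alpha> :: "nat \<Rightarrow> nat"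
  have mR: "m \<alpha> \<in> polyfun (I - {k})" if "\<alpha> \<in> mons_deg N e" for \<alpha>
  proof -
    have "(\<lambda>x. c \<alpha> / a * (\<Prod>i\<le>N. x i ^ (\<alpha>(k := 0)) i)) \<in> forms N (I - {k}) (e - \<alpha> k)"
    proof (rule forms_monomial)
      have "(\<Sum>i\<le>N. \<alpha> i) = \<alpha> k + (\<Sum>i\<in>{..N} - {k}. \<alpha> i)" using kN by (intro sum.remove) auto
      moreover have "(\<Sum>i\<le>N. (\<alpha>(k := 0)) i) = (\<alpha>(k := 0)) k + (\<Sum>i\<in>{..N} - {k}. (\<alpha>(k := 0)) i)" using kN by (intro sum.remove) auto
      moreover have "(\<Sum>i\<in>{..N} - {k}. (\<alpha>(k := 0)) i) = (\<Sum>i\<in>{..N} - {k}. \<alpha> i)" by (rule sum.cong) auto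
      ultimately show "\<alpha>(k := 0) \<in> mons_deg N (e - \<alpha> k)" using that kN by (auto simp: mons_deg_def)
    qed (use c(2) in auto)
    moreover have "(\<Prod>i\<le>N. x i ^ (\<alpha>(k := 0)) i) = (\<Prod>i\<in>{..N} - {k}. x i ^ \<alpha> i)" for x :: "nat \<Rightarrow> 'k"
      by (rule prod.mono_neutral_cong_right) auto
    ultimately show ?thesis using forms_polyfun unfolding m_def by fastforce
  qed
  define p where "p = (\<Sum>\<alpha>\<in>mons_deg N e. monom (m \<alpha>) (\<alpha> k))"
  have cp: "coeff p n = (\<Sum>\<alpha>\<in>mons_deg N e. if \<alpha> k = n then m \<alpha> else 0)" for n
    unfolding p_def coeff_sum coeff_monom ..
  have "coeff p n \<in> polyfun (I - {k})" for n
    unfolding cp using mR ring_onD(2)[OF ring_on_polyfun] by (intro ring_on_sum[OF ring_on_polyfun]) auto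
  then have pR: "p \<in> poly_on (polyfun (I - {k}))" by (simp add: poly_on_def)
  have le: "\<alpha> k \<le> e" if "\<alpha> \<in> mons_deg N e" for \<alpha>
    using that kN member_le_sum[of k "{..N}" \<alpha>] by (auto simp: mons_deg_def)
  have eq\<delta>: "\<alpha> = ?\<delta>" if "\<alpha> \<in> mons_deg N e" "\<alpha> k = e" for \<alpha>
  proof (rule mons_deg_eq_delta[OF that(1) kN])
    fix i assume i: "i \<le> N" "i \<noteq> k"
    have "(\<Sum>i\<le>N. \<alpha> i) = \<alpha> k + (\<Sum>i\<in>{..N} - {k}. \<alpha> i)" using kN by (intro sum.remove) auto
    then have "(\<Sum>i\<in>{..N} - {k}. \<alpha> i) = 0" using that by (simp add: mons_deg_def)
    then show "\<alpha> i = 0" using i by simp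
  qed
  have "coeff p e = (\<Sum>\<alpha>\<in>mons_deg N e. if \<alpha> = ?\<delta> then m ?\<delta> else 0)"
    unfolding cp
  proof (rule sum.cong)
    fix \<alpha> assume \<alpha>: "\<alpha> \<in> mons_deg N e"
    show "(if \<alpha> k = e then m \<alpha> else 0) = (if \<alpha> = ?\<delta> then m ?\<delta> else 0)"
    proof (cases "\<alpha> = ?\<delta>")
      case False
      then have "\<alpha> k \<noteq> e" using eq\<delta>[OF \<alpha>] by blast
      with False show ?thesis by simp
    qed simp
  qed simp
  also have "\<dots> = m ?\<delta>" using delta_mons_deg[OF kN, of e] by simp
  also have "\<dots> = 1" using a by (auto simp: m_def a_def fun_eq_iff)
  finally have pe: "coeff p e = 1" .
  have "coeff p n = 0" if "n > e" for n
    unfolding cp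
  proof (rule sum.neutral, rule ballI)
    fix \<alpha> assume "\<alpha> \<in> mons_deg N e"
    then have "\<alpha> k \<noteq> n" using le[of \<alpha>] that by simp
    then show "(if \<alpha> k = n then m \<alpha> else 0) = 0" by simp
  qed
  then have "degree p \<le> e" by (intro degree_le) auto
  then have "degree p = e" using pe le_degree[of p e] by (metis antisym one_neq_zero)
  then have lc: "lead_coeff p = 1" using pe by simp
  have "poly p (coord k) = (\<lambda>x. 1 / a) * g"
  proof (rule ext)
    fix x :: "nat \<Rightarrow> 'k"
    have "(poly p (coord k)) x = (\<Sum>\<alpha>\<in>mons_deg N e. m \<alpha> x * x k ^ \<alpha> k)"
      by (simp add: p_def poly_sum poly_monom sum_fun_apply power_fun_apply coord_def)
    also have "\<dots> = (\<Sum>\<alpha>\<in>mons_deg N e. 1 / a * (c \<alpha> * (\<Prod>i\<le>N. x i ^ \<alpha> i)))"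
    proof (rule sum.cong)
      fix \<alpha>
      have "(\<Prod>i\<le>N. x i ^ \<alpha> i) = x k ^ \<alpha> k * (\<Prod>i\<in>{..N} - {k}. x i ^ \<alpha> i)" using kN by (intro prod.remove) auto
      then show "m \<alpha> x * x k ^ \<alpha> k = 1 / a * (c \<alpha> * (\<Prod>i\<le>N. x i ^ \<alpha> i))" by (simp add: m_def mult_ac)
    qed simp
    also have "\<dots> = ((\<lambda>x. 1 / a) * g) x" by (simp add: c(1) heval_def sum_distrib_left)
    finally show "(poly p (coord k)) x = ((\<lambda>x. 1 / a) * g) x" .
  qed
  moreover have "(\<lambda>x. 1 / a) * g \<in> J" using J g(1) polyfun.const[of "1 / a" I] unfolding hom_ideal_def ideal_on_def by blast
  ultimately show ?thesis using pR lc by metis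
qed

text \<open>Specialising the other coordinates to \<open>x\<close> turns \<open>J\<close> into an
  ideal \<open>A\<close> of univariate polynomials, nonzero because of the monic \<open>g\<close>.
  If no \<open>t\<close> worked, \<open>A\<close> would contain 1, that is, some member of
  \<open>J\<close> specialises to 1; \<open>elimination\<close> then produces a member of
  \<open>J\<close> free of the \<open>k\<close>-th coordinate with value 1 at \<open>x\<close>,
  contrary to the assumption on \<open>x\<close>.\<close>

lemma zero_extends:
  fixes J :: "'k::field vecfun set"
  assumes ac: "alg_closed TYPE('k)" and J: "ideal_on (polyfun I) J" and k: "k \<in> I"
    and g: "g \<in> poly_on (polyfun (I - {k}))" "lead_coeff g = 1" "poly g (coord k) \<in> J"
    and x: "\<And>f. f \<in> J \<Longrightarrow> f \<in> polyfun (I - {k}) \<Longrightarrow> f x = 0"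
  shows "\<exists>t. \<forall>f\<in>J. f (x(k := t)) = 0"
proof -
  let ?R = "polyfun (I - {k}) :: 'k vecfun set"
  let ?ev = "\<lambda>f :: (nat \<Rightarrow> 'k) \<Rightarrow> 'k. f x"
  interpret ev: comm_ring_hom ?ev by (rule ev_hom)
  interpret mp: map_poly_comm_ring_hom ?ev ..
  note R = ring_on_polyfun[of "I - {k}"]
  note pr = ring_onD[OF ring_on_poly_on[OF R]]
  have J': "0 \<in> J" "a \<in> J \<Longrightarrow> b \<in> J \<Longrightarrow> a + b \<in> J" "s \<in> polyfun I \<Longrightarrow> a \<in> J \<Longrightarrow> s * a \<in> J" "a \<in> J \<Longrightarrow> a \<in> polyfun I" for a b s
    using J by (auto simp: ideal_on_def)
  define A where "A = {map_poly ?ev q | q. q \<in> poly_on ?R \<and> poly q (coord k) \<in> J}"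
  have polyB: "poly q (coord k) \<in> polyfun I" if "q \<in> poly_on ?R" for q
    unfolding poly_altdef using that polyfun_mono[of "I - {k}" I]
    by (intro ring_on_sum[OF ring_on_polyfun] ring_onD(4)[OF ring_on_polyfun] ring_on_power[OF ring_on_polyfun] polyfun.coord k)
      (auto simp: poly_on_def)
  have A: "a - s * b \<in> A" if ab: "a \<in> A" "b \<in> A" for a b s
  proof -
    obtain p q where p: "a = map_poly ?ev p" "p \<in> poly_on ?R" "poly p (coord k) \<in> J"
      and q: "b = map_poly ?ev q" "q \<in> poly_on ?R" "poly q (coord k) \<in> J" using ab by (auto simp: A_def)
    \<comment> \<open>A lift of \<open>s\<close> with constant functions as coefficients; it
      specialises back to \<open>s\<close>, so \<open>A\<close> absorbs multiplication by arbitrary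
      polynomials.\<close>
    define s' where "s' = map_poly (\<lambda>c. \<lambda>y :: nat \<Rightarrow> 'k. c) s"
    have cs: "coeff s' i = (\<lambda>y. coeff s i)" for i by (simp add: s'_def coeff_map_poly zero_fun_def)
    have s'R: "- s' \<in> poly_on ?R" by (rule pr(5)) (auto simp: poly_on_def cs polyfun.const)
    have s's: "map_poly ?ev s' = s" by (rule poly_eqI) (simp add: coeff_map_poly cs)
    have "a - s * b = map_poly ?ev (p + (- s') * q)"
      using s's p(1) q(1) by (simp add: mp.hom_minus mp.hom_mult)
    moreover have "p + (- s') * q \<in> poly_on ?R" using pr(3)[OF p(2) pr(4)[OF s'R q(2)]] .
    moreover have "poly (p + (- s') * q) (coord k) \<in> J"
      unfolding poly_add poly_mult using J'(2)[OF p(3) J'(3)[OF polyB[OF s'R] q(3)]] .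
    ultimately show ?thesis unfolding A_def by blast
  qed
  have gA: "map_poly ?ev g \<in> A" using g by (auto simp: A_def)
  have "coeff (map_poly ?ev g) (degree g) = 1" using g(2) by (simp add: coeff_map_poly)
  then have g0: "map_poly ?ev g \<noteq> 0" by (metis coeff_0 zero_neq_one)
  show ?thesis
  proof (rule ccontr)
    assume no_zero: "\<nexists>t. \<forall>f\<in>J. f (x(k := t)) = 0"
    have "1 \<in> A"
    proof (rule poly_ideal_contains_1[OF ac A gA g0])
      fix t
      obtain f where f: "f \<in> J" "f (x(k := t)) \<noteq> 0" using no_zero by blast
      obtain p where p: "p \<in> poly_on ?R" "f = poly p (coord k)" using polyfun_split_coord[OF J'(4)[OF f(1)]] by blast
      have "map_poly (\<lambda>f. f (x(k := t))) p = map_poly ?ev p"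
      proof (rule poly_eqI)
        fix i
        have "coeff p i \<in> ?R" using p(1) by (simp add: poly_on_def)
        from polyfun_cong[OF this, of "x(k := t)" x]
        show "coeff (map_poly (\<lambda>f. f (x(k := t))) p) i = coeff (map_poly ?ev p) i" by (simp add: coeff_map_poly)
      qed
      then have "poly (map_poly ?ev p) t \<noteq> 0"
        using f(2) p(2) poly_fun_eval[of p "coord k" "x(k := t)"] by (simp add: coord_def)
      moreover have "map_poly ?ev p \<in> A" using p f(1) by (auto simp: A_def)
      ultimately show "\<exists>a\<in>A. poly a t \<noteq> 0" by blast
    qed
    then obtain q where q: "map_poly ?ev q = 1" "q \<in> poly_on ?R" "poly q (coord k) \<in> J" by (auto simp: A_def)
    have "\<exists>h\<in>J \<inter> ?R. ?ev h = 1"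
      by (rule elimination[OF ev_hom R polyfun_mono J g q(2,3,1) ring_on_polyfun polyfun.coord[OF k]]) auto
    then show False using x by force
  qed
qed

text \<open>Induction on the number of variables, eliminating one other than \<open>i\<close>. The
  elimination ideal inherits the hypothesis: a nonzero common zero of it would extend to one of
  \<open>J\<close> by \<open>zero_extends\<close>. With a single variable left, a form not vanishing
  on the axis is a scalar multiple of a power of the variable.\<close>

theorem homogeneous_nullstellensatz:
  fixes J :: "'k::field vecfun set"
  assumes ac: "alg_closed TYPE('k)" and inf: "infinite (UNIV :: 'k set)"
    and "I \<subseteq> {..N}" "hom_ideal N I J" "\<And>x. \<exists>i\<in>I. x i \<noteq> 0 \<Longrightarrow> \<exists>f\<in>J. f x \<noteq> 0" "i \<in> I"
  shows "\<exists>D. coord i ^ D \<in> J"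
  using assms(3-)
proof (induction "card I" arbitrary: I J rule: less_induct)
  case less
  note I = less(2) and J = less(3) and nz = less(4) and i = less(5)
  have fin: "finite I" using I finite_subset by blast
  have Jid: "ideal_on (polyfun I) J" using J by (simp add: hom_ideal_def)
  have Jm: "s * f \<in> J" if "s \<in> polyfun I" "f \<in> J" for s f using Jid that by (auto simp: ideal_on_def)
  have ax: "\<exists>f\<in>J. f (axis_vec k) \<noteq> 0" if "k \<in> I" for k
    using nz[of "axis_vec k"] that by (auto simp: axis_vec_def)
  show ?case
  proof (cases "I = {i}")
    case True
    obtain f where f: "f \<in> J" "f (axis_vec i) \<noteq> 0" using ax[OF i] by blast
    obtain e g where g: "g \<in> J" "g \<in> forms N I e" "g (axis_vec i) \<noteq> 0" using hom_ideal_form[OF J f] by blast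
    have gy: "g y = y i ^ e * g (axis_vec i)" for y
    proof -
      have "g \<in> polyfun {i}" using g(2) forms_polyfun[of N I e] unfolding True by blast
      then have "g y = g (\<lambda>j. y i * axis_vec i j)"
        by (rule polyfun_cong) (simp add: axis_vec_def)
      then show ?thesis using forms_scale[OF g(2)] by simp
    qed
    have "coord i ^ e = (\<lambda>x. 1 / g (axis_vec i)) * g"
    proof (rule ext)
      fix y :: "nat \<Rightarrow> 'k"
      show "(coord i ^ e) y = ((\<lambda>x. 1 / g (axis_vec i)) * g) y"
        using gy[of y] g(3) by (simp add: power_fun_apply coord_def)
    qed
    then show ?thesis using Jm[OF polyfun.const g(1)] by metis
  next
    case False
    then obtain k where k: "k \<in> I" "k \<noteq> i" using i by blast
    let ?I = "I - {k}"
    let ?J = "J \<inter> polyfun ?I"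
    obtain f where f: "f \<in> J" "f (axis_vec k) \<noteq> 0" using ax[OF k(1)] by blast
    obtain g where g: "g \<in> poly_on (polyfun ?I)" "lead_coeff g = 1" "poly g (coord k) \<in> J"
      using monic_element[OF J k(1) I f] by blast
    have "\<exists>D. coord i ^ D \<in> ?J"
    proof (rule less(1))
      show "card ?I < card I" using k fin by (intro psubset_card_mono) auto
      show "?I \<subseteq> {..N}" "i \<in> ?I" using I i k by auto
      show "hom_ideal N ?I ?J"
        unfolding hom_ideal_def
      proof (intro conjI ballI)
        have "x + y \<in> J" "0 \<in> J" if "x \<in> J" "y \<in> J" for x y using Jid that by (auto simp: ideal_on_def)
        then show "ideal_on (polyfun ?I) ?J"
          unfolding ideal_on_def using Jm polyfun_mono[of ?I I] f(1) ring_onD(2)[OF ring_on_polyfun]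
          by (auto intro: polyfun.add polyfun.mult)
        fix h assume h: "h \<in> ?J"
        then obtain p where p: "homog_parts N I p h" "\<And>e. coeff p e \<in> J" using J by (auto simp: hom_ideal_def)
        obtain q where q: "homog_parts N ?I q h" using polyfun_homog_parts[of h ?I N] h I by blast
        \<comment> \<open>\<open>p\<close> has its components in \<open>J\<close> and
          \<open>q\<close> has its components in fewer variables; since they agree, the elimination
          ideal is homogeneous.\<close>
        have "p = q" by (rule homog_parts_unique[OF inf p(1) q])
        then show "\<exists>p. homog_parts N ?I p h \<and> (\<forall>e. coeff p e \<in> ?J)"
          using p(2) q forms_polyfun[of N ?I] unfolding homog_parts_def by blast
      qed
      fix x :: "nat \<Rightarrow> 'k" assume x: "\<exists>i\<in>?I. x i \<noteq> 0"
      show "\<exists>f\<in>?J. f x \<noteq> 0"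
      proof (rule ccontr)
        assume "\<not> ?thesis"
        then obtain t where t: "\<And>f. f \<in> J \<Longrightarrow> f (x(k := t)) = 0" using zero_extends[OF ac Jid k(1) g, of x] by blast
        have "\<exists>i\<in>I. (x(k := t)) i \<noteq> 0" using x by auto
        from nz[OF this] t show False by blast
      qed
    qed
    then show ?thesis by blast
  qed
qed

lemma alg_closed_infinite:
  assumes "alg_closed TYPE('k::field)"
  shows "infinite (UNIV :: 'k set)"
proof
  assume fin: "finite (UNIV :: 'k set)"
  \<comment> \<open>On a finite field this polynomial would take the value 1 everywhere.\<close>
  let ?p = "(\<Prod>a\<in>(UNIV :: 'k set). [:- a, 1:]) + 1"
  have d: "degree (\<Prod>a\<in>(UNIV :: 'k set). [:- a, 1:]) = card (UNIV :: 'k set)"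
    by (subst degree_prod_eq_sum_degree) auto
  have "card (UNIV :: 'k set) > 0" using fin by (simp add: card_gt_0_iff)
  then have "degree ?p = card (UNIV :: 'k set)" using d by (subst degree_add_eq_left) auto
  then obtain x where "poly ?p x = 0" using assms \<open>card UNIV > 0\<close> unfolding alg_closed_def by metis
  moreover have "poly (\<Prod>a\<in>(UNIV :: 'k set). [:- a, 1:]) x = 0"
    unfolding poly_prod by (rule prod_zero[OF fin]) auto
  ultimately show False by simp
qed

text \<open>The Nullstellensatz for the ideal generated by the forms gives some cofactors. Since the
  forms all have degree \<open>d\<close> and the left side is homogeneous, the cofactors may be
  replaced by their components of degree \<open>D - d\<close>.\<close>

lemma coord_power_in_ideal:
  fixes F :: "'k::field hmap"
  assumes ac: "alg_closed TYPE('k)" and F: "no_common_zero N d F" and i: "i \<le> N"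
  shows "\<exists>D\<ge>d. \<exists>G. (\<forall>j\<le>N. G j \<in> forms N {..N} (D - d)) \<and> coord i ^ D = (\<Sum>j\<le>N. G j * heval N d (F j))"
proof -
  let ?I = "{..N}"
  note inf = alg_closed_infinite[OF ac]
  have Ff: "heval N d (F j) \<in> forms N ?I d" for j
  proof -
    \<comment> \<open>The support condition in \<open>forms\<close> concerns all exponents, while
      \<open>F j\<close> is arbitrary outside \<open>mons_deg N d\<close>.\<close>
    have "heval N d (F j) = heval N d (\<lambda>\<alpha>. if \<alpha> \<in> mons_deg N d then F j \<alpha> else 0)"
      unfolding heval_def by (intro ext sum.cong) auto
    then show ?thesis unfolding forms_def
      by (intro CollectI exI[of _ "\<lambda>\<alpha>. if \<alpha> \<in> mons_deg N d then F j \<alpha> else 0"]) (auto simp: mons_deg_def)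
  qed
  define J where "J = {(\<Sum>j\<le>N. H j * heval N d (F j)) | H. \<forall>j. H j \<in> polyfun ?I}"
  have parts: "\<exists>q. (\<forall>j e. coeff (q j) e \<in> forms N ?I e) \<and> homog_parts N ?I (\<Sum>j\<le>N. q j * monom (heval N d (F j)) d) (\<Sum>j\<le>N. H j * heval N d (F j))"
    if "\<forall>j. H j \<in> polyfun ?I" for H
  proof -
    have "\<forall>j. \<exists>q. homog_parts N ?I q (H j)" using polyfun_homog_parts that by blast
    from choice[OF this] obtain q where q: "\<forall>j. homog_parts N ?I (q j) (H j)" ..
    have "homog_parts N ?I (\<Sum>j\<in>A. q j * monom (heval N d (F j)) d) (\<Sum>j\<in>A. H j * heval N d (F j))" for A
    proof (induction A rule: infinite_finite_induct)
      case (insert j A)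
      have "homog_parts N ?I (q j * monom (heval N d (F j)) d) (H j * heval N d (F j))"
        using q homog_parts_mult homog_parts_form[OF Ff] by blast
      from homog_parts_add[OF this insert(3)] show ?case unfolding sum.insert[OF insert(1,2)] .
    qed (auto simp: homog_parts_def forms_0)
    then show ?thesis using q unfolding homog_parts_def by blast
  qed
  have cq: "coeff (\<Sum>j\<le>N. q j * monom (heval N d (F j)) d) e = (\<Sum>j\<le>N. (if d \<le> e then coeff (q j) (e - d) else 0) * heval N d (F j))"
    for q :: "nat \<Rightarrow> 'k vecfun poly" and e
    unfolding coeff_sum by (rule sum.cong) (simp_all only: mult.commute[of "q _"] coeff_monom_mult mult.commute[of "coeff _ _"] split: if_split, simp_all)
  have Jid: "ideal_on (polyfun ?I) J"
    unfolding ideal_on_def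
  proof (intro conjI ballI subsetI)
    show "f \<in> polyfun ?I" if "f \<in> J" for f
      using that Ff forms_polyfun[of N ?I d] unfolding J_def
      by (auto intro!: ring_on_sum[OF ring_on_polyfun] ring_onD(4)[OF ring_on_polyfun] simp del: sum_fun_apply)
    show "0 \<in> J" unfolding J_def
      by (rule CollectI, rule exI[of _ "\<lambda>_. 0"]) (use ring_onD(2)[OF ring_on_polyfun] in auto)
    fix f g assume "f \<in> J" "g \<in> J"
    then obtain H H' where H: "f = (\<Sum>j\<le>N. H j * heval N d (F j))" "\<forall>j. H j \<in> polyfun ?I"
      and H': "g = (\<Sum>j\<le>N. H' j * heval N d (F j))" "\<forall>j. H' j \<in> polyfun ?I" unfolding J_def by blast
    have "f + g = (\<Sum>j\<le>N. (H j + H' j) * heval N d (F j))"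
      unfolding H(1) H'(1) by (simp only: distrib_right sum.distrib)
    moreover have "\<forall>j. H j + H' j \<in> polyfun ?I" using H H' polyfun.add by blast
    ultimately show "f + g \<in> J" unfolding J_def by (intro CollectI exI[of _ "\<lambda>j. H j + H' j"] conjI)
  next
    fix s f :: "'k vecfun" assume s: "s \<in> polyfun ?I" and "f \<in> J"
    then obtain H where H: "f = (\<Sum>j\<le>N. H j * heval N d (F j))" "\<forall>j. H j \<in> polyfun ?I" unfolding J_def by blast
    have "s * f = (\<Sum>j\<le>N. (s * H j) * heval N d (F j))" unfolding H(1) by (simp only: sum_distrib_left mult.assoc)
    moreover have "\<forall>j. s * H j \<in> polyfun ?I" using H s polyfun.mult by blast
    ultimately show "s * f \<in> J" unfolding J_def by (intro CollectI exI[of _ "\<lambda>j. s * H j"] conjI)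
  qed
  have Jh: "hom_ideal N ?I J"
    unfolding hom_ideal_def
  proof (intro conjI ballI Jid)
    fix f assume "f \<in> J"
    then obtain H where H: "f = (\<Sum>j\<le>N. H j * heval N d (F j))" "\<forall>j. H j \<in> polyfun ?I" unfolding J_def by blast
    obtain q where q: "\<And>j e. coeff (q j) e \<in> forms N ?I e" "homog_parts N ?I (\<Sum>j\<le>N. q j * monom (heval N d (F j)) d) f"
      using parts[OF H(2)] unfolding H(1) by blast
    have "coeff (\<Sum>j\<le>N. q j * monom (heval N d (F j)) d) e \<in> J" for e
      unfolding cq J_def
      by (rule CollectI, rule exI[of _ "\<lambda>j. if d \<le> e then coeff (q j) (e - d) else 0"])
        (use q(1) forms_polyfun[of N ?I] ring_onD(2)[OF ring_on_polyfun, of ?I] in auto)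
    then show "\<exists>p. homog_parts N ?I p f \<and> (\<forall>e. coeff p e \<in> J)" using q(2) by blast
  qed
  have FJ: "heval N d (F j) \<in> J" if "j \<le> N" for j
  proof -
    have "heval N d (F j) = (\<Sum>l\<le>N. (if l = j then 1 else 0) * heval N d (F l))"
    proof -
      have "(\<Sum>l\<le>N. (if l = j then 1 else 0) * heval N d (F l)) = (\<Sum>l\<le>N. if l = j then heval N d (F j) else 0)"
        by (rule sum.cong) auto
      then show ?thesis using that by simp
    qed
    then show ?thesis unfolding J_def using ring_onD(1,2)[OF ring_on_polyfun, of ?I]
      by (intro CollectI exI[of _ "\<lambda>l. if l = j then 1 else 0"] conjI) auto
  qed
  have "\<exists>D. coord i ^ D \<in> J"
  proof (rule homogeneous_nullstellensatz[OF ac inf subset_refl Jh])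
    fix x :: "nat \<Rightarrow> 'k" assume "\<exists>i\<in>?I. x i \<noteq> 0"
    then obtain j where "j \<le> N" "heval N d (F j) x \<noteq> 0" using F unfolding no_common_zero_def by auto
    then show "\<exists>f\<in>J. f x \<noteq> 0" using FJ by blast
  qed (use i in simp)
  then obtain D where D: "coord i ^ D \<in> J" ..
  \<comment> \<open>The extra factor makes the exponent at least \<open>d\<close>, so that the
    truncated subtraction in \<open>D - d\<close> is a true difference.\<close>
  have "coord i ^ d * coord i ^ D \<in> J"
  proof -
    have "coord i ^ d \<in> polyfun ?I" using i by (intro ring_on_power[OF ring_on_polyfun] polyfun.coord) simp
    with Jid D show ?thesis unfolding ideal_on_def by blast
  qed
  then have "coord i ^ (d + D) \<in> J" by (simp only: power_add)
  then obtain H where H: "coord i ^ (d + D) = (\<Sum>j\<le>N. H j * heval N d (F j))" "\<forall>j. H j \<in> polyfun ?I" unfolding J_def by blast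
  obtain q where q: "\<And>j e. coeff (q j) e \<in> forms N ?I e"
    "homog_parts N ?I (\<Sum>j\<le>N. q j * monom (heval N d (F j)) d) (coord i ^ (d + D))"
    using parts[OF H(2)] unfolding H(1) by blast
  have "coord i ^ (d + D) \<in> forms N ?I (d + D)" using i by (intro forms_coord_power) auto
  from homog_parts_unique[OF inf homog_parts_form[OF this] q(2)]
  have "coord i ^ (d + D) = coeff (\<Sum>j\<le>N. q j * monom (heval N d (F j)) d) (d + D)" by (metis coeff_monom)
  also have "\<dots> = (\<Sum>j\<le>N. coeff (q j) D * heval N d (F j))" unfolding cq by simp
  finally show ?thesis using q(1) by (intro exI[of _ "d + D"] conjI exI[of _ "\<lambda>j. coeff (q j) D"]) auto
qed

subsection \<open>Macaulay matrices\<close>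

definition mon_enum :: "nat \<Rightarrow> nat \<Rightarrow> nat \<Rightarrow> (nat \<Rightarrow> nat)" where
  "mon_enum N D = (SOME e. bij_betw e {0..<card (mons_deg N D)} (mons_deg N D))"

lemma mon_enum_bij: "bij_betw (mon_enum N D) {0..<card (mons_deg N D)} (mons_deg N D)"
  unfolding mon_enum_def by (rule someI_ex[OF ex_bij_betw_nat_finite[OF finite_mons_deg]])

lemma mon_enum_mem: "a < card (mons_deg N D) \<Longrightarrow> mon_enum N D a \<in> mons_deg N D"
  using mon_enum_bij[of N D] by (auto simp: bij_betw_def)

lemma mon_enum_inj:
  "a < card (mons_deg N D) \<Longrightarrow> b < card (mons_deg N D) \<Longrightarrow> mon_enum N D a = mon_enum N D b \<longleftrightarrow> a = b"
  using mon_enum_bij[of N D] by (auto simp: bij_betw_def dest: inj_onD)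

text \<open>The coefficients of a form multiplied by the monomial with exponent
  \<open>\<beta>\<close>.\<close>

definition shift_coeff :: "(nat \<Rightarrow> nat) \<Rightarrow> ((nat \<Rightarrow> nat) \<Rightarrow> 'r::comm_ring_1) \<Rightarrow> (nat \<Rightarrow> nat) \<Rightarrow> 'r" where
  "shift_coeff \<beta> c \<gamma> = (if \<forall>i. \<beta> i \<le> \<gamma> i then c (\<lambda>i. \<gamma> i - \<beta> i) else 0)"

lemma heval_shift_coeff:
  assumes "\<beta> \<in> mons_deg N b"
  shows "heval N (b + d) (shift_coeff \<beta> c) x = (\<Prod>i\<le>N. x i ^ \<beta> i) * heval N d c x"
proof -
  let ?h = "\<lambda>\<alpha> i. \<alpha> i + \<beta> i"
  have inj: "inj_on ?h (mons_deg N d)" by (auto simp: inj_on_def fun_eq_iff)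
  have sub: "?h ` mons_deg N d \<subseteq> mons_deg N (b + d)" using assms by (auto simp: mons_deg_def sum.distrib)
  have zero: "shift_coeff \<beta> c \<gamma> = 0" if "\<gamma> \<in> mons_deg N (b + d) - ?h ` mons_deg N d" for \<gamma>
  proof (rule ccontr)
    assume "shift_coeff \<beta> c \<gamma> \<noteq> 0"
    then have le: "\<beta> i \<le> \<gamma> i" for i by (auto simp: shift_coeff_def split: if_splits)
    then have "\<gamma> = ?h (\<lambda>i. \<gamma> i - \<beta> i)" by auto
    moreover have "(\<lambda>i. \<gamma> i - \<beta> i) \<in> mons_deg N d"
      using that assms le by (auto simp: mons_deg_def sum_subtractf_nat)
    ultimately have "\<gamma> \<in> ?h ` mons_deg N d" by (rule image_eqI)
    then show False using that by simp
  qed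
  have "heval N (b + d) (shift_coeff \<beta> c) x = (\<Sum>\<gamma>\<in>?h ` mons_deg N d. shift_coeff \<beta> c \<gamma> * (\<Prod>i\<le>N. x i ^ \<gamma> i))"
    unfolding heval_def using sub zero by (intro sum.mono_neutral_right) auto
  also have "\<dots> = (\<Sum>\<alpha>\<in>mons_deg N d. shift_coeff \<beta> c (?h \<alpha>) * (\<Prod>i\<le>N. x i ^ ?h \<alpha> i))"
    by (simp add: sum.reindex[OF inj])
  also have "\<dots> = (\<Prod>i\<le>N. x i ^ \<beta> i) * heval N d c x"
    unfolding heval_def sum_distrib_left
    by (rule sum.cong) (auto simp: shift_coeff_def power_add prod.distrib mult_ac)
  finally show ?thesis .
qed

text \<open>Row \<open>a\<close> holds the coefficients, in degree \<open>D\<close>, of a monomial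
  multiple of one form; \<open>\<sigma> a\<close> names the form and the monomial. The selection is
  left free because the one with nonzero determinant depends on the system.\<close>

definition macmat :: "nat \<Rightarrow> nat \<Rightarrow> 'r::comm_ring_1 hmap \<Rightarrow> (nat \<Rightarrow> nat \<times> (nat \<Rightarrow> nat)) \<Rightarrow> 'r mat" where
  "macmat N D F \<sigma> = mat (card (mons_deg N D)) (card (mons_deg N D))
     (\<lambda>(a, b). shift_coeff (snd (\<sigma> a)) (F (fst (\<sigma> a))) (mon_enum N D b))"

definition mac_rows :: "nat \<Rightarrow> nat \<Rightarrow> nat \<Rightarrow> (nat \<Rightarrow> nat \<times> (nat \<Rightarrow> nat)) \<Rightarrow> bool" where
  "mac_rows N d D \<sigma> \<longleftrightarrow> d \<le> D \<and> (\<forall>a<card (mons_deg N D). \<sigma> a \<in> {..N} \<times> mons_deg N (D - d))"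

definition mac_minor :: "nat \<Rightarrow> nat \<Rightarrow> (nat \<Rightarrow> nat \<times> (nat \<Rightarrow> nat)) \<Rightarrow> zpoly" where
  "mac_minor N D \<sigma> = det (macmat N D (\<lambda>j \<alpha>. zvar (j, \<alpha>)) \<sigma>)"

lemma mac_minor_eval:
  "zpoly_eval (mac_minor N D \<sigma>) a = det (macmat N D (\<lambda>j \<alpha>. a (j, \<alpha>)) \<sigma>)"
proof -
  have "map_mat (\<lambda>f. zpoly_eval f a) (macmat N D (\<lambda>j \<alpha>. zvar (j, \<alpha>)) \<sigma>) = macmat N D (\<lambda>j \<alpha>. a (j, \<alpha>)) \<sigma>"
    by (rule eq_matI) (auto simp: macmat_def shift_coeff_def)
  then show ?thesis using zeval.hom_det[of a "macmat N D (\<lambda>j \<alpha>. zvar (j, \<alpha>)) \<sigma>"]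
    by (simp add: mac_minor_def)
qed

lemma ring_on_zring: "ring_on (zring W)"
  by (auto simp: ring_on_def zring_closed)

lemma mac_minor_zring:
  assumes "mac_rows N d D \<sigma>"
  shows "mac_minor N D \<sigma> \<in> zring ({..N} \<times> mons_deg N d)"
  unfolding mac_minor_def
proof (rule ring_on_det[OF ring_on_zring])
  let ?m = "card (mons_deg N D)"
  show "macmat N D (\<lambda>j \<alpha>. zvar (j, \<alpha>)) \<sigma> \<in> carrier_mat ?m ?m" by (simp add: macmat_def)
  fix a b assume ab: "a < ?m" "b < ?m"
  obtain j \<beta> where j: "\<sigma> a = (j, \<beta>)" by (cases "\<sigma> a")
  then have j': "j \<le> N" "\<beta> \<in> mons_deg N (D - d)" "d \<le> D" using assms ab by (auto simp: mac_rows_def)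
  have "(\<lambda>i. mon_enum N D b i - \<beta> i) \<in> mons_deg N d" if "\<And>i. \<beta> i \<le> mon_enum N D b i"
    using mon_enum_mem[OF ab(2)] j' that by (auto simp: mons_deg_def sum_subtractf_nat)
  then show "macmat N D (\<lambda>j \<alpha>. zvar (j, \<alpha>)) \<sigma> $$ (a, b) \<in> zring ({..N} \<times> mons_deg N d)"
    using ab j j' by (auto simp: macmat_def shift_coeff_def intro!: zring_closed)
qed

text \<open>The values of all monomials of degree \<open>D\<close> at \<open>z\<close> form a kernel
  vector, as every row represents a form vanishing at \<open>z\<close>. The entry of the pure power
  of the zeroth variable is 1, so the vector is nonzero.\<close>

lemma macmat_det_zero:
  fixes F :: "'k::field hmap"
  assumes \<sigma>: "mac_rows N d D \<sigma>" and z: "z 0 = 1" "\<And>j. j \<le> N \<Longrightarrow> heval N d (F j) z = 0"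
  shows "det (macmat N D F \<sigma>) = 0"
proof -
  let ?m = "card (mons_deg N D)" and ?e = "mon_enum N D"
  let ?v = "vec ?m (\<lambda>b. \<Prod>i\<le>N. z i ^ ?e b i)"
  have M: "macmat N D F \<sigma> \<in> carrier_mat ?m ?m" by (simp add: macmat_def)
  have "macmat N D F \<sigma> *\<^sub>v ?v = 0\<^sub>v ?m"
  proof (rule eq_vecI)
    fix a assume "a < dim_vec (0\<^sub>v ?m :: 'k vec)"
    then have a: "a < ?m" by simp
    obtain j \<beta> where j: "\<sigma> a = (j, \<beta>)" by (cases "\<sigma> a")
    then have j': "j \<le> N" "\<beta> \<in> mons_deg N (D - d)" "d \<le> D" using \<sigma> a by (auto simp: mac_rows_def)
    have "(macmat N D F \<sigma> *\<^sub>v ?v) $ a = (\<Sum>b\<in>{0..<?m}. shift_coeff \<beta> (F j) (?e b) * (\<Prod>i\<le>N. z i ^ ?e b i))"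
      using a j by (simp add: macmat_def scalar_prod_def)
    also have "\<dots> = heval N D (shift_coeff \<beta> (F j)) z"
      unfolding heval_def by (rule sum.reindex_bij_betw[OF mon_enum_bij])
    also have "\<dots> = 0" using heval_shift_coeff[OF j'(2), of d "F j" z] j' z(2) by simp
    finally show "(macmat N D F \<sigma> *\<^sub>v ?v) $ a = 0\<^sub>v ?m $ a" using a by simp
  qed (simp add: macmat_def)
  moreover have "?v \<noteq> 0\<^sub>v ?m"
  proof -
    let ?\<delta> = "\<lambda>i. if i = 0 then D else 0"
    have "?\<delta> \<in> ?e ` {0..<?m}"
      unfolding bij_betw_imp_surj_on[OF mon_enum_bij] by (rule delta_mons_deg) simp
    then obtain b where b: "b < ?m" "?\<delta> = ?e b" by auto
    have "?v $ b = z 0 ^ D" using b(1) prod_delta_power[of 0 N z D] by (simp flip: b(2))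
    then have "?v $ b \<noteq> 0\<^sub>v ?m $ b" using b z by simp
    then show ?thesis by metis
  qed
  moreover have "?v \<in> carrier_vec ?m" by simp
  ultimately show ?thesis unfolding det_0_iff_vec_prod_zero[OF M] by blast
qed

text \<open>An exchange argument: starting from the identity matrix, unit rows are replaced one at a
  time by rows \<open>r f\<close>, keeping the determinant nonzero. \<open>S\<close> expresses the
  unit vectors through the rows \<open>r f\<close>.\<close>

lemma exists_nonzero_minor:
  fixes r :: "'f \<Rightarrow> nat \<Rightarrow> 'k::field"
  assumes S: "\<And>a b. a < m \<Longrightarrow> b < m \<Longrightarrow> (\<Sum>f\<in>A. S a f * r f b) = (if a = b then 1 else 0)"
  shows "\<exists>\<sigma>. (\<forall>a<m. \<sigma> a \<in> A) \<and> det (mat m m (\<lambda>(a, b). r (\<sigma> a) b)) \<noteq> 0"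
proof -
  let ?M = "\<lambda>n \<sigma>. mat m m (\<lambda>(a, b). if a < n then r (\<sigma> a) b else if a = b then 1 else 0)"
  have "\<exists>\<sigma>. (\<forall>a<n. \<sigma> a \<in> A) \<and> det (?M n \<sigma>) \<noteq> 0" if "n \<le> m" for n
    using that
  proof (induction n)
    case 0
    have "?M 0 \<sigma> = 1\<^sub>m m" for \<sigma> by (rule eq_matI) auto
    then show ?case by simp
  next
    case (Suc n)
    then obtain \<sigma> where \<sigma>: "\<And>a. a < n \<Longrightarrow> \<sigma> a \<in> A" "det (?M n \<sigma>) \<noteq> 0" by auto
    have n: "n < m" using Suc by simp
    have car: "?M k \<tau> \<in> carrier_mat m m" for k \<tau> by simp
    let ?c = "\<lambda>b. cofactor (?M n \<sigma>) n b"
    \<comment> \<open>By linearity in row \<open>n\<close>, this nonzero determinant is a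
      combination of those with row \<open>n\<close> replaced by some \<open>r f\<close>, so at
      least one of them is nonzero.\<close>
    have "det (?M n \<sigma>) = (\<Sum>b<m. (\<Sum>f\<in>A. S n f * r f b) * ?c b)"
      unfolding laplace_expansion_row[OF car n] by (rule sum.cong) (use n S in auto)
    also have "\<dots> = (\<Sum>f\<in>A. S n f * (\<Sum>b<m. r f b * ?c b))"
      unfolding sum_distrib_right sum_distrib_left by (subst sum.swap) (simp add: mult.assoc)
    finally have "(\<Sum>f\<in>A. S n f * (\<Sum>b<m. r f b * ?c b)) \<noteq> 0" using \<sigma>(2) by simp
    then obtain f where "f \<in> A" "S n f * (\<Sum>b<m. r f b * ?c b) \<noteq> 0" by (rule sum.not_neutral_contains_not_neutral)
    then have f: "f \<in> A" "(\<Sum>b<m. r f b * ?c b) \<noteq> 0" by auto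
    let ?\<tau> = "\<sigma>(n := f)"
    have cof: "cofactor (?M (Suc n) ?\<tau>) n b = ?c b" if "b < m" for b
    proof -
      have "mat_delete (?M (Suc n) ?\<tau>) n b = mat_delete (?M n \<sigma>) n b"
        unfolding mat_delete_def by (rule cong_mat) auto
      then show ?thesis by (simp add: cofactor_def)
    qed
    have "det (?M (Suc n) ?\<tau>) = (\<Sum>b<m. r f b * ?c b)"
      unfolding laplace_expansion_row[OF car n] by (rule sum.cong) (use n cof in auto)
    then show ?case using f \<sigma>(1) by (intro exI[of _ ?\<tau>]) (auto simp: less_Suc_eq)
  qed
  from this[of m] obtain \<sigma> where \<sigma>: "\<forall>a<m. \<sigma> a \<in> A" "det (?M m \<sigma>) \<noteq> 0" by auto
  have "?M m \<sigma> = mat m m (\<lambda>(a, b). r (\<sigma> a) b)" by (rule eq_matI) auto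
  with \<sigma> show ?thesis by metis
qed

lemma heval_eq_imp_coeff_eq:
  fixes c c' :: "(nat \<Rightarrow> nat) \<Rightarrow> 'k::field"
  assumes inf: "infinite (UNIV :: 'k set)" and eq: "\<And>x. heval N D c x = heval N D c' x" and \<gamma>: "\<gamma> \<in> mons_deg N D"
  shows "c \<gamma> = c' \<gamma>"
proof (rule ccontr)
  assume "c \<gamma> \<noteq> c' \<gamma>"
  have "\<exists>(k :: nat \<Rightarrow> nat) p. p \<noteq> 0 \<and>
    (\<forall>t. (\<Sum>m\<in>mons_deg N D. (c m - c' m) * (\<Prod>v\<in>{..N}. (t ^ k v) ^ m v)) = poly p t)"
  proof (rule kronecker_poly[where m = \<gamma>])
    show "m = m'" if "m \<in> mons_deg N D" "m' \<in> mons_deg N D" "\<forall>v\<in>{..N}. m v = m' v" for m m'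
    proof
      fix i show "m i = m' i" using that by (cases "i \<le> N") (auto simp: mons_deg_def)
    qed
  qed (use \<gamma> \<open>c \<gamma> \<noteq> c' \<gamma>\<close> in auto)
  then obtain k :: "nat \<Rightarrow> nat" and p
    where p: "p \<noteq> 0" "\<And>t. (\<Sum>m\<in>mons_deg N D. (c m - c' m) * (\<Prod>v\<in>{..N}. (t ^ k v) ^ m v)) = poly p t" by blast
  have "poly p t = heval N D c (\<lambda>i. t ^ k i) - heval N D c' (\<lambda>i. t ^ k i)" for t
    unfolding p(2)[symmetric] heval_def sum_subtractf[symmetric] left_diff_distrib ..
  then have "{t. poly p t = 0} = UNIV" using eq by auto
  then show False using poly_roots_finite[OF p(1)] inf by simp
qed

text \<open>In a large enough degree \<open>D\<close> every monomial is a combination of monomial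
  multiples of the forms, so the full Macaulay matrix has maximal rank and
  \<open>exists_nonzero_minor\<close> applies.\<close>

lemma macmat_det_nonzero:
  fixes F :: "'k::field hmap"
  assumes ac: "alg_closed TYPE('k)" and F: "no_common_zero N d F"
  shows "\<exists>D \<sigma>. mac_rows N d D \<sigma> \<and> det (macmat N D F \<sigma>) \<noteq> 0"
proof -
  let ?I = "{..N}"
  have "\<forall>i. \<exists>D G. i \<le> N \<longrightarrow> d \<le> D \<and> (\<forall>j\<le>N. G j \<in> forms N ?I (D - d)) \<and> coord i ^ D = (\<Sum>j\<le>N. G j * heval N d (F j))"
    using coord_power_in_ideal[OF ac F] by blast
  from choice[OF this] obtain E where
    "\<forall>i. \<exists>G. i \<le> N \<longrightarrow> d \<le> E i \<and> (\<forall>j\<le>N. G j \<in> forms N ?I (E i - d)) \<and> coord i ^ E i = (\<Sum>j\<le>N. G j * heval N d (F j))" ..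
  from choice[OF this] obtain G where
    "\<forall>i. i \<le> N \<longrightarrow> d \<le> E i \<and> (\<forall>j\<le>N. G i j \<in> forms N ?I (E i - d)) \<and> coord i ^ E i = (\<Sum>j\<le>N. G i j * heval N d (F j))" ..
  then have E: "d \<le> E i" and G: "\<And>j. j \<le> N \<Longrightarrow> G i j \<in> forms N ?I (E i - d)"
    and EG: "coord i ^ E i = (\<Sum>j\<le>N. G i j * heval N d (F j))" if "i \<le> N" for i
    using that by blast+
  \<comment> \<open>By the pigeonhole principle, a monomial of this degree is divisible by the
    \<open>E i\<close>-th power of some variable \<open>i\<close>, and that power is already a
    combination of the forms.\<close>
  define D where "D = (\<Sum>i\<le>N. E i)"
  have dD: "d \<le> D" using E[of 0] member_le_sum[of 0 ?I E] by (auto simp: D_def)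
  let ?A = "?I \<times> mons_deg N (D - d)"
  have row: "\<exists>S. \<forall>\<gamma>'\<in>mons_deg N D. (\<Sum>f\<in>?A. S f * shift_coeff (snd f) (F (fst f)) \<gamma>') = (if \<gamma> = \<gamma>' then 1 else 0)"
    if \<gamma>: "\<gamma> \<in> mons_deg N D" for \<gamma>
  proof -
    have "\<exists>i\<le>N. E i \<le> \<gamma> i"
    proof (rule ccontr)
      assume "\<not> ?thesis"
      then have "\<gamma> i < E i" if "i \<le> N" for i using that not_le by blast
      then have "(\<Sum>i\<le>N. \<gamma> i) < (\<Sum>i\<le>N. E i)" by (intro sum_strict_mono) simp_all
      then show False using \<gamma> by (simp add: mons_deg_def D_def)
    qed
    then obtain i where i: "i \<le> N" "E i \<le> \<gamma> i" by blast
    have DE: "E i \<le> D" using i member_le_sum[of i ?I E] by (auto simp: D_def)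
    define \<beta> where "\<beta> = (\<lambda>k. \<gamma> k - (if k = i then E i else 0))"
    have split: "\<gamma> k = \<beta> k + (if k = i then E i else 0)" for k using i by (simp add: \<beta>_def)
    have "(\<Sum>k\<le>N. \<gamma> k) = (\<Sum>k\<le>N. \<beta> k) + E i" using i by (simp add: split sum.distrib)
    then have \<beta>: "\<beta> \<in> mons_deg N (D - E i)" using \<gamma> by (auto simp: mons_deg_def \<beta>_def)
    have "\<forall>j. \<exists>s. j \<le> N \<longrightarrow> (\<lambda>x. 1 * (\<Prod>k\<le>N. x k ^ \<beta> k)) * G i j = heval N (D - d) s"
    proof
      fix j
      show "\<exists>s. j \<le> N \<longrightarrow> (\<lambda>x. 1 * (\<Prod>k\<le>N. x k ^ \<beta> k)) * G i j = heval N (D - d) s"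
      proof (cases "j \<le> N")
        case True
        have "(\<lambda>x. 1 * (\<Prod>k\<le>N. x k ^ \<beta> k)) \<in> forms N ?I (D - E i)"
          using \<beta> by (intro forms_monomial) (auto simp: mons_deg_def)
        from forms_mult[OF this G[OF i(1) True]]
        have "(\<lambda>x. 1 * (\<Prod>k\<le>N. x k ^ \<beta> k)) * G i j \<in> forms N ?I (D - d)" using DE E[OF i(1)] by simp
        then show ?thesis unfolding forms_def by blast
      qed simp
    qed
    from choice[OF this] obtain s where s: "\<And>j. j \<le> N \<Longrightarrow> (\<lambda>x. 1 * (\<Prod>k\<le>N. x k ^ \<beta> k)) * G i j = heval N (D - d) (s j)" by blast
    define S where "S f = s (fst f) (snd f)" for f
    have "heval N D (\<lambda>\<gamma>'. if \<gamma>' = \<gamma> then 1 else 0) x = heval N D (\<lambda>\<gamma>'. \<Sum>f\<in>?A. S f * shift_coeff (snd f) (F (fst f)) \<gamma>') x" for x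
    proof -
      have "heval N D (\<lambda>\<gamma>'. if \<gamma>' = \<gamma> then 1 else 0) x = (\<Prod>k\<le>N. x k ^ \<gamma> k)" using heval_single[OF \<gamma>, of 1 x] by simp
      also have "\<dots> = (\<Prod>k\<le>N. x k ^ \<beta> k) * x i ^ E i"
        unfolding split power_add prod.distrib using prod_delta_power[OF i(1), of x "E i"] by simp
      also have "x i ^ E i = (coord i ^ E i) x" by (simp add: power_fun_apply coord_def)
      also have "(coord i ^ E i) x = (\<Sum>j\<le>N. G i j x * heval N d (F j) x)" unfolding EG[OF i(1)] sum_fun_apply times_fun_apply ..
      also have "(\<Prod>k\<le>N. x k ^ \<beta> k) * \<dots> = (\<Sum>j\<le>N. ((\<lambda>x. 1 * (\<Prod>k\<le>N. x k ^ \<beta> k)) * G i j) x * heval N d (F j) x)"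
        by (simp add: sum_distrib_left mult_ac)
      also have "\<dots> = (\<Sum>j\<le>N. heval N (D - d) (s j) x * heval N d (F j) x)" by (rule sum.cong) (simp_all only: s atMost_iff)
      also have "\<dots> = (\<Sum>j\<le>N. \<Sum>b\<in>mons_deg N (D - d). s j b * heval N (D - d + d) (shift_coeff b (F j)) x)"
      proof (rule sum.cong)
        fix j
        have "heval N (D - d) (s j) x * heval N d (F j) x = (\<Sum>b\<in>mons_deg N (D - d). s j b * ((\<Prod>i\<le>N. x i ^ b i) * heval N d (F j) x))"
          unfolding heval_def[of N "D - d"] sum_distrib_right mult.assoc ..
        also have "\<dots> = (\<Sum>b\<in>mons_deg N (D - d). s j b * heval N (D - d + d) (shift_coeff b (F j)) x)"
          by (rule sum.cong) (simp_all only: heval_shift_coeff)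
        finally show "heval N (D - d) (s j) x * heval N d (F j) x = \<dots>" .
      qed simp
      also have "\<dots> = (\<Sum>f\<in>?A. S f * heval N D (shift_coeff (snd f) (F (fst f))) x)"
        using dD by (simp add: sum.cartesian_product S_def case_prod_unfold)
      also have "\<dots> = heval N D (\<lambda>\<gamma>'. \<Sum>f\<in>?A. S f * shift_coeff (snd f) (F (fst f)) \<gamma>') x"
        unfolding heval_def sum_distrib_left sum_distrib_right by (subst sum.swap) (simp add: mult_ac)
      finally show ?thesis .
    qed
    from heval_eq_imp_coeff_eq[OF alg_closed_infinite[OF ac] this]
    have "(\<Sum>f\<in>?A. S f * shift_coeff (snd f) (F (fst f)) \<gamma>') = (if \<gamma> = \<gamma>' then 1 else 0)" if "\<gamma>' \<in> mons_deg N D" for \<gamma>'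
      using that by (auto simp: eq_commute)
    then show ?thesis by blast
  qed
  let ?m = "card (mons_deg N D)" and ?e = "mon_enum N D"
  have "\<forall>a. \<exists>S. a < ?m \<longrightarrow> (\<forall>\<gamma>'\<in>mons_deg N D. (\<Sum>f\<in>?A. S f * shift_coeff (snd f) (F (fst f)) \<gamma>') = (if ?e a = \<gamma>' then 1 else 0))"
    using row mon_enum_mem by blast
  from choice[OF this] obtain S where S: "\<And>a \<gamma>'. a < ?m \<Longrightarrow> \<gamma>' \<in> mons_deg N D \<Longrightarrow>
    (\<Sum>f\<in>?A. S a f * shift_coeff (snd f) (F (fst f)) \<gamma>') = (if ?e a = \<gamma>' then 1 else 0)" by blast
  have "\<exists>\<sigma>. (\<forall>a<?m. \<sigma> a \<in> ?A) \<and> det (mat ?m ?m (\<lambda>(a, b). shift_coeff (snd (\<sigma> a)) (F (fst (\<sigma> a))) (?e b))) \<noteq> 0"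
    by (rule exists_nonzero_minor[where S = S]) (simp add: S mon_enum_mem mon_enum_inj)
  then show ?thesis using dD unfolding mac_rows_def macmat_def by blast
qed

text \<open>In degree \<open>Suc N * d\<close> each monomial is divisible by the \<open>d\<close>-th
  power of some variable. Taking the quotient as row multiplier reproduces the monomial itself, so
  the matrix is the identity.\<close>

lemma macmat_det_power_forms:
  fixes F :: "int hmap"
  assumes "d > 0" and F: "\<And>j \<alpha>. F j \<alpha> = (if \<alpha> = (\<lambda>i. if i = j then d else 0) then 1 else 0)"
  shows "\<exists>D \<sigma>. mac_rows N d D \<sigma> \<and> det (macmat N D F \<sigma>) = 1"
proof -
  define D where "D = Suc N * d"
  let ?m = "card (mons_deg N D)" and ?e = "mon_enum N D"
  have "\<forall>a. \<exists>i. a < ?m \<longrightarrow> i \<le> N \<and> d \<le> ?e a i"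
  proof (intro allI, rule ccontr)
    fix a assume *: "\<nexists>i. a < ?m \<longrightarrow> i \<le> N \<and> d \<le> ?e a i"
    then have "?e a i < d" if "i \<le> N" for i using that not_le by blast
    then have "(\<Sum>i\<le>N. ?e a i) < (\<Sum>i\<le>N. d)" by (intro sum_strict_mono) simp_all
    then show False using * mon_enum_mem[of a N D] by (auto simp: mons_deg_def D_def)
  qed
  from choice[OF this] obtain i where i: "\<And>a. a < ?m \<Longrightarrow> i a \<le> N \<and> d \<le> ?e a (i a)" by blast
  let ?\<delta> = "\<lambda>a k. if k = i a then d else 0"
  define \<sigma> where "\<sigma> a = (i a, \<lambda>k. ?e a k - ?\<delta> a k)" for a
  have le: "?\<delta> a k \<le> ?e a k" if "a < ?m" for a k using i[OF that] by simp
  have "(\<lambda>k. ?e a k - ?\<delta> a k) \<in> mons_deg N (D - d)" if a: "a < ?m" for a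
  proof -
    have "(\<Sum>k\<le>N. ?e a k - ?\<delta> a k) = (\<Sum>k\<le>N. ?e a k) - (\<Sum>k\<le>N. ?\<delta> a k)" using le[OF a] by (intro sum_subtractf_nat) auto
    then show ?thesis using mon_enum_mem[OF a] i[OF a] by (auto simp: mons_deg_def)
  qed
  then have rows: "mac_rows N d D \<sigma>" using i by (auto simp: mac_rows_def \<sigma>_def D_def)
  have "macmat N D F \<sigma> = 1\<^sub>m ?m"
  proof (rule eq_matI)
    fix a b assume "a < dim_row (1\<^sub>m ?m :: int mat)" "b < dim_col (1\<^sub>m ?m :: int mat)"
    then have ab: "a < ?m" "b < ?m" by auto
    have iff: "(\<forall>k. ?e a k - ?\<delta> a k \<le> ?e b k) \<and> (\<lambda>k. ?e b k - (?e a k - ?\<delta> a k)) = ?\<delta> a \<longleftrightarrow> ?e a = ?e b" (is "?L \<longleftrightarrow> ?R")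
    proof
      assume L: ?L
      show ?R
      proof
        fix k
        have "?e b k - (?e a k - ?\<delta> a k) = ?\<delta> a k" using fun_cong[OF conjunct2[OF L], of k] .
        moreover have "?e a k - ?\<delta> a k \<le> ?e b k" using L by blast
        ultimately show "?e a k = ?e b k" using le[OF ab(1), of k] by linarith
      qed
    next
      assume R: ?R
      show ?L unfolding R[symmetric] using le[OF ab(1)] by auto
    qed
    have if_conj: "(if A then if B then 1 else 0 else 0) = (if A \<and> B then 1 else (0::int))" for A B by simp
    have "macmat N D F \<sigma> $$ (a, b)
        = (if \<forall>k. snd (\<sigma> a) k \<le> ?e b k then F (i a) (\<lambda>k. ?e b k - snd (\<sigma> a) k) else 0)"
      using ab by (simp add: macmat_def shift_coeff_def \<sigma>_def)
    then have "macmat N D F \<sigma> $$ (a, b) = (if ?e a = ?e b then 1 else 0)"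
      unfolding F \<sigma>_def snd_conv if_conj iff .
    then show "macmat N D F \<sigma> $$ (a, b) = 1\<^sub>m ?m $$ (a, b)"
      using ab mon_enum_inj[OF ab] by simp
  qed (auto simp: macmat_def)
  then show ?thesis using rows by (intro exI[of _ D] exI[of _ \<sigma>]) simp
qed

subsection \<open>The resultant\<close>

abbreviation coeff_vars :: "nat \<Rightarrow> nat \<Rightarrow> zv set" where
  "coeff_vars N d \<equiv> {..N} \<times> mons_deg N d"

definition mono0 :: "nat \<Rightarrow> nat \<Rightarrow> nat" where
  "mono0 d = (\<lambda>i. if i = 0 then d else 0)"

definition at_point :: "'r hmap \<Rightarrow> zv \<Rightarrow> 'r" where
  "at_point c = (\<lambda>(j, \<alpha>). c j \<alpha>)"

text \<open>The generic point of the variety of systems with a common zero whose zeroth coordinate is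
  \<open>1\<close>: the affine coordinates of the zero are the variables \<open>(N + 1 + i, 0)\<close>, and the coefficients of
  \<open>X_0 ^ d\<close> are solved for.\<close>
definition gen_zero :: "nat \<Rightarrow> nat \<Rightarrow> zpoly" where
  "gen_zero N i = (if i = 0 then 1 else zvar (N + 1 + i, \<lambda>_. 0))"

definition gen_coeff :: "nat \<Rightarrow> nat \<Rightarrow> zv \<Rightarrow> zpoly" where
  "gen_coeff N d v = (if snd v = mono0 d
     then - (\<Sum>\<alpha>\<in>mons_deg N d - {mono0 d}. zvar (fst v, \<alpha>) * (\<Prod>i\<le>N. gen_zero N i ^ \<alpha> i)) else zvar v)"

text \<open>As the kernel of a substitution into a domain the ideal is prime at once. As a single
  identity over the integers, membership specialises to every commutative ring.\<close>

definition inertia_ideal :: "nat \<Rightarrow> nat \<Rightarrow> zpoly set" where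
  "inertia_ideal N d = {f \<in> zring (coeff_vars N d). zpoly_eval f (gen_coeff N d) = 0}"

lemma mono0_mons_deg [simp]: "mono0 d \<in> mons_deg N d"
  unfolding mono0_def by (rule delta_mons_deg) simp

lemma heval_mono0:
  fixes z :: "nat \<Rightarrow> 'r::comm_ring_1"
  assumes "z 0 = 1"
  shows "heval N d c z = c (mono0 d) + (\<Sum>\<alpha>\<in>mons_deg N d - {mono0 d}. c \<alpha> * (\<Prod>i\<le>N. z i ^ \<alpha> i))"
proof -
  have "(\<Prod>i\<le>N. z i ^ mono0 d i) = 1"
    unfolding mono0_def using prod_delta_power[of 0 N z d] assms by simp
  then show ?thesis unfolding heval_def by (subst sum.remove[of _ "mono0 d"]) auto
qed

lemma inertia_vanish_affine:
  fixes c :: "'r::comm_ring_1 hmap"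
  assumes f: "f \<in> inertia_ideal N d" and z: "z 0 = 1" "\<And>j. j \<le> N \<Longrightarrow> heval N d (c j) z = 0"
  shows "zpoly_eval f (at_point c) = 0"
proof -
  \<comment> \<open>Specialises the generic point to the given system and zero; the offset undoes
    the index shift in \<open>gen_zero\<close>.\<close>
  let ?b = "\<lambda>v. if fst v \<le> N then c (fst v) (snd v) else z (fst v - N - 1)"
  have gz: "zpoly_eval (gen_zero N i) ?b = z i" for i using z by (simp add: gen_zero_def)
  have gc: "zpoly_eval (gen_coeff N d v) ?b = at_point c v" if v: "v \<in> coeff_vars N d" for v
  proof -
    obtain j \<alpha> where j: "v = (j, \<alpha>)" "j \<le> N" using v by auto
    show ?thesis
    proof (cases "\<alpha> = mono0 d")
      case True
      have "zpoly_eval (gen_coeff N d v) ?b = - (\<Sum>\<alpha>\<in>mons_deg N d - {mono0 d}. c j \<alpha> * (\<Prod>i\<le>N. z i ^ \<alpha> i))"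
        using j by (simp add: gen_coeff_def True zeval.hom_uminus zeval.hom_sum zeval.hom_mult zeval.hom_prod zeval.hom_power gz)
      also have "\<dots> = c j (mono0 d)"
        using z(2)[OF j(2)] unfolding heval_mono0[of z N d "c j", OF z(1)] by (metis eq_neg_iff_add_eq_0)
      finally show ?thesis by (simp add: j True at_point_def)
    qed (use j in \<open>simp add: gen_coeff_def at_point_def\<close>)
  qed
  have "zpoly_eval f (at_point c) = zpoly_eval f (\<lambda>v. zpoly_eval (gen_coeff N d v) ?b)"
    using f by (intro zpoly_eval_cong gc[symmetric]) (auto simp: inertia_ideal_def zring_def)
  also have "\<dots> = zpoly_eval (zpoly_eval f (gen_coeff N d)) ?b" by (rule zeval.hom_zpoly_eval[symmetric])
  also have "\<dots> = 0" using f by (simp add: inertia_ideal_def)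
  finally show ?thesis .
qed

text \<open>Complex systems suffice: the generic system evaluated at any complex point has the
  evaluated generic zero, and an integer polynomial vanishing at all complex points is zero.\<close>

lemma inertiaI:
  assumes f: "f \<in> zring (coeff_vars N d)"
    and v: "\<And>(c :: complex hmap) z. z 0 = 1 \<Longrightarrow> (\<And>j. j \<le> N \<Longrightarrow> heval N d (c j) z = 0) \<Longrightarrow> zpoly_eval f (at_point c) = 0"
  shows "f \<in> inertia_ideal N d"
proof -
  have "zpoly_eval (zpoly_eval f (gen_coeff N d)) b = 0" for b :: "zv \<Rightarrow> complex"
  proof -
    define z where "z i = zpoly_eval (gen_zero N i) b" for i
    define c where "c j \<alpha> = zpoly_eval (gen_coeff N d (j, \<alpha>)) b" for j \<alpha>
    have "z 0 = 1" by (simp add: z_def gen_zero_def)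
    moreover have "heval N d (c j) z = 0" for j
    proof -
      have "c j (mono0 d) = - (\<Sum>\<alpha>\<in>mons_deg N d - {mono0 d}. b (j, \<alpha>) * (\<Prod>i\<le>N. z i ^ \<alpha> i))"
        by (simp add: c_def z_def gen_coeff_def zeval.hom_uminus zeval.hom_sum zeval.hom_mult zeval.hom_prod zeval.hom_power)
      moreover have "(\<Sum>\<alpha>\<in>mons_deg N d - {mono0 d}. c j \<alpha> * (\<Prod>i\<le>N. z i ^ \<alpha> i)) = (\<Sum>\<alpha>\<in>mons_deg N d - {mono0 d}. b (j, \<alpha>) * (\<Prod>i\<le>N. z i ^ \<alpha> i))"
        by (rule sum.cong) (auto simp: c_def gen_coeff_def)
      ultimately show ?thesis by (simp add: heval_mono0[of z, OF \<open>z 0 = 1\<close>])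
    qed
    ultimately have "zpoly_eval f (at_point c) = 0" by (rule v)
    then show ?thesis by (simp add: zeval.hom_zpoly_eval at_point_def c_def case_prod_unfold)
  qed
  then have "zpoly_eval f (gen_coeff N d) = 0" by (intro zpoly_eqI) simp
  then show ?thesis using f by (simp add: inertia_ideal_def)
qed

lemma heval_hom:
  assumes "comm_ring_hom h"
  shows "h (heval N d c x) = heval N d (\<lambda>\<alpha>. h (c \<alpha>)) (\<lambda>i. h (x i))"
proof -
  interpret comm_ring_hom h by fact
  show ?thesis by (simp add: heval_def hom_sum hom_mult hom_prod hom_power)
qed

text \<open>Prescribes the value of a form at a point by changing one coefficient. It serves both to
  move zeros and to compare the resultant with the size of the values.\<close>

lemma heval_adjust:
  fixes z :: "nat \<Rightarrow> 'r::comm_ring_1"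
  assumes "i \<le> N" "z i = 1"
  shows "heval N d (\<lambda>\<alpha>. c \<alpha> - (if \<alpha> = (\<lambda>k. if k = i then d else 0) then t else 0)) z = heval N d c z - t"
proof -
  have "heval N d (\<lambda>\<alpha>. c \<alpha> - (if \<alpha> = (\<lambda>k. if k = i then d else 0) then t else 0)) z
      = heval N d c z - heval N d (\<lambda>\<alpha>. if \<alpha> = (\<lambda>k. if k = i then d else 0) then t else 0) z"
    by (simp add: heval_def left_diff_distrib sum_subtractf)
  also have "heval N d (\<lambda>\<alpha>. if \<alpha> = (\<lambda>k. if k = i then d else 0) then t else 0) z = t"
    using assms by (subst heval_single[OF delta_mons_deg]) (simp_all add: prod_delta_power)
  finally show ?thesis .
qed

text \<open>A zero on the hyperplane at infinity is moved off it along a line, adjusting one coefficient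
  of each form.\<close>
lemma inertia_vanish:
  fixes c :: "'k::field hmap"
  assumes inf: "infinite (UNIV :: 'k set)" and f: "f \<in> inertia_ideal N d"
    and z: "nonzero_vec N z" "\<And>j. j \<le> N \<Longrightarrow> heval N d (c j) z = 0"
  shows "zpoly_eval f (at_point c) = 0"
proof -
  have scaled: "zpoly_eval f (at_point c) = 0" if "z 0 \<noteq> 0" "\<And>j. j \<le> N \<Longrightarrow> heval N d (c j) z = 0"
    for c :: "'k hmap" and z :: "nat \<Rightarrow> 'k"
  proof -
    have "1 / z 0 * z 0 = 1" using that(1) by simp
    moreover have "heval N d (c j) (\<lambda>i. 1 / z 0 * z i) = 0" if "j \<le> N" for j
      unfolding heval_scale using \<open>\<And>j. j \<le> N \<Longrightarrow> heval N d (c j) z = 0\<close>[OF that] by simp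
    ultimately show ?thesis by (rule inertia_vanish_affine[OF f])
  qed
  obtain i where i: "i \<le> N" "z i \<noteq> 0" using z by (auto simp: nonzero_vec_def)
  show ?thesis
  proof (cases "z 0 = 0")
    case False
    then show ?thesis using scaled z by blast
  next
    case True
    define y where "y = (\<lambda>k. 1 / z i * z k)"
    have y: "y i = 1" "y 0 = 0" using i True by (auto simp: y_def)
    have yz: "heval N d (c j) y = 0" if "j \<le> N" for j unfolding y_def heval_scale using z that by simp
    \<comment> \<open>A line through \<open>y\<close> whose zeroth coordinate is the parameter.
      \<open>C\<close> subtracts the values along it from the coefficients of the
      \<open>d\<close>-th power of the \<open>i\<close>-th variable, so the point with parameter
      \<open>s\<close> is a zero of \<open>C\<close> at \<open>s\<close>.\<close>
    define w where "w = (\<lambda>k. if k = 0 then [:0, 1:] else [:y k:])"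
    define t where "t j = heval N d (\<lambda>\<alpha>. [:c j \<alpha>:]) w" for j
    define C where "C = (\<lambda>j \<alpha>. [:c j \<alpha>:] - (if \<alpha> = (\<lambda>k. if k = i then d else 0) then t j else 0))"
    define P where "P = zpoly_eval f (at_point C)"
    have h: "comm_ring_hom (\<lambda>p. poly p s)" for s :: 'k by unfold_locales simp_all
    have tj: "poly (t j) s = heval N d (c j) (y(0 := s))" for j s
    proof -
      have "(\<lambda>k. poly (w k) s) = y(0 := s)" by (auto simp: w_def)
      then show ?thesis unfolding t_def by (simp add: heval_hom[OF h])
    qed
    have PC: "poly P s = zpoly_eval f (at_point (\<lambda>j \<alpha>. poly (C j \<alpha>) s))" for s
      unfolding P_def by (simp add: comm_ring_hom.hom_zpoly_eval[OF h] at_point_def case_prod_unfold)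
    have Cs: "poly (C j \<alpha>) s = c j \<alpha> - (if \<alpha> = (\<lambda>k. if k = i then d else 0) then heval N d (c j) (y(0 := s)) else 0)" for j \<alpha> s
      by (simp add: C_def tj)
    have "i \<noteq> 0" using y by (metis zero_neq_one)
    have "poly P s = 0" if "s \<noteq> 0" for s
      unfolding PC
    proof (rule scaled[of "y(0 := s)"])
      show "(y(0 := s)) 0 \<noteq> 0" using that by simp
      fix j assume "j \<le> N"
      show "heval N d (\<lambda>\<alpha>. poly (C j \<alpha>) s) (y(0 := s)) = 0"
        unfolding Cs using i y \<open>i \<noteq> 0\<close> by (subst heval_adjust) auto
    qed
    \<comment> \<open>Away from the parameter 0 the zero has a nonzero zeroth coordinate. Infinitely
      many roots force \<open>P = 0\<close>, and at the parameter 0 the correction disappears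
      because \<open>y\<close> is already a zero.\<close>
    then have "UNIV - {0} \<subseteq> {s. poly P s = 0}" by auto
    moreover have "infinite (UNIV - {0 :: 'k})" using inf by simp
    ultimately have "P = 0" using poly_roots_finite[of P] finite_subset by blast
    then have "0 = poly P 0" by simp
    also have "\<dots> = zpoly_eval f (at_point c)"
      unfolding PC
    proof (rule zpoly_eval_cong)
      fix v assume "v \<in> zpoly_vars f"
      then have "fst v \<le> N" using f by (auto simp: inertia_ideal_def zring_def)
      moreover have "y(0 := 0) = y" using y by auto
      ultimately show "at_point (\<lambda>j \<alpha>. poly (C j \<alpha>) 0) v = at_point c v"
        by (simp add: at_point_def Cs case_prod_unfold yz)
    qed
    finally show ?thesis ..
  qed
qed

lemma inertia_prime:
  "ideal_on (zring (coeff_vars N d)) (inertia_ideal N d)" "1 \<notin> inertia_ideal N d"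
  "a \<in> zring (coeff_vars N d) \<Longrightarrow> b \<in> zring (coeff_vars N d) \<Longrightarrow> a * b \<in> inertia_ideal N d
    \<Longrightarrow> a \<in> inertia_ideal N d \<or> b \<in> inertia_ideal N d"
  unfolding ideal_on_def inertia_ideal_def
  by (auto simp: zring_closed zeval.hom_add zeval.hom_mult dest: zpoly_no_zero_divisors)

lemma mac_minor_inertia:
  assumes "mac_rows N d D \<sigma>"
  shows "mac_minor N D \<sigma> \<in> inertia_ideal N d"
  using assms
  by (intro inertiaI mac_minor_zring)
    (auto simp: mac_minor_eval at_point_def intro: macmat_det_zero)

section \<open>Dependence of inertia forms on the distinguished coefficient\<close>

lemma isCont_zpoly_eval:
  fixes \<beta> :: "'a::t2_space \<Rightarrow> zv \<Rightarrow> 'b::{real_normed_field}"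
  assumes "\<And>v. isCont (\<lambda>s. \<beta> s v) x"
  shows "isCont (\<lambda>s. zpoly_eval r (\<beta> s)) x"
  unfolding zpoly_eval_def by (intro continuous_intros assms)

text \<open>Scaling down all coefficients except those of \<open>X_0 ^ d\<close> and \<open>X_0 ^ (d - 1) * X_j\<close> in
  the \<open>j\<close>-th form degenerates the last \<open>N\<close> equations to linear ones, which are solvable for arbitrary
  values of these coefficients.\<close>
lemma inertia_elimination:
  assumes d: "d > 0" and f: "f \<in> inertia_ideal N d" "f \<in> zring (coeff_vars N d - {(0, mono0 d)})"
  shows "f = 0"
proof (rule ccontr)
  assume "f \<noteq> 0"
  \<comment> \<open>The exponent that is linear in the \<open>j\<close>-th affine coordinate once
    the zeroth coordinate is 1.\<close>
  define lin where "lin j = (\<lambda>i. if i = 0 then d - 1 else if i = j then 1 else 0)" for j :: nat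
  have lin_mons: "lin j \<in> mons_deg N d" if "1 \<le> j" "j \<le> N" for j
  proof -
    have "(\<Sum>i\<le>N. lin j i) = (\<Sum>i\<le>N. (if i = 0 then d - 1 else 0) + (if i = j then 1 else 0))"
      by (rule sum.cong) (use that in \<open>auto simp: lin_def\<close>)
    also have "\<dots> = d" using that d by (simp add: sum.distrib)
    finally show ?thesis using that by (auto simp: mons_deg_def lin_def)
  qed
  have lin_neq: "lin j \<noteq> mono0 d" if "1 \<le> j" for j
  proof
    assume "lin j = mono0 d"
    from fun_cong[OF this, of j] that show False by (simp add: lin_def mono0_def)
  qed
  define keep where "keep w \<longleftrightarrow> 1 \<le> fst w \<and> fst w \<le> N \<and> (snd w = mono0 d \<or> snd w = lin (fst w))" for w :: zv
  \<comment> \<open>The indeterminate is the scaling parameter: it multiplies every coefficient that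
    is not kept, and at the value 1 the original \<open>f\<close> returns.\<close>
  define a where "a w = (if keep w then [:zvar w:] else [:0, zvar w:])" for w
  define g where "g = zpoly_eval f a"
  have h1: "comm_ring_hom (\<lambda>p :: zpoly poly. poly p 1)" by unfold_locales simp_all
  have "poly g 1 = zpoly_eval f (\<lambda>w. poly (a w) 1)" unfolding g_def by (rule comm_ring_hom.hom_zpoly_eval[OF h1])
  also have "(\<lambda>w. poly (a w) 1) = zvar" by (auto simp: a_def)
  finally have "g \<noteq> 0" using \<open>f \<noteq> 0\<close> by auto
  then have ex: "\<exists>k. coeff g k \<noteq> 0" by (auto simp: poly_eq_iff)
  \<comment> \<open>The lowest order in the scaling parameter; its coefficient is what survives in
    the limit after division by the \<open>k\<close>-th power.\<close>
  define k where "k = (LEAST k. coeff g k \<noteq> 0)"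
  have k: "coeff g k \<noteq> 0" "\<And>l. l < k \<Longrightarrow> coeff g l = 0"
    unfolding k_def using LeastI_ex[OF ex] not_less_Least by auto
  have zv0: "zvar w \<noteq> 0" for w using zpoly_eval_zvar[of w "\<lambda>_. 1 :: int"] by force
  have pr: "(\<Prod>j\<in>A. zvar (j, lin j)) \<noteq> 0" for A :: "nat set"
    by (induction A rule: infinite_finite_induct) (use zpoly_no_zero_divisors zv0 in auto)
  \<comment> \<open>Multiplying by the linear coefficients yields one complex point \<open>b\<close>
    at which the leading term is nonzero and all limiting linear equations are solvable.\<close>
  have "coeff g k * (\<Prod>j\<in>{1..N}. zvar (j, lin j)) \<noteq> 0"
    using k(1) pr[of "{1..N}"] zpoly_no_zero_divisors by blast
  from zpoly_nonzero_eval[OF this] obtain b :: "zv \<Rightarrow> complex"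
    where b: "zpoly_eval (coeff g k) b * (\<Prod>j\<in>{1..N}. b (j, lin j)) \<noteq> 0"
    by (auto simp: zeval.hom_mult zeval.hom_prod)
  then have bl: "b (j, lin j) \<noteq> 0" if "1 \<le> j" "j \<le> N" for j using that by auto
  \<comment> \<open>The common zero of the limiting linear equations.\<close>
  define x where "x j = (if j = 0 then 1 else - b (j, mono0 d) / b (j, lin j))" for j
  have x0: "x 0 = 1" by (simp add: x_def)
  define h where "h j = (\<Sum>\<alpha>\<in>mons_deg N d - {mono0 d, lin j}. b (j, \<alpha>) * (\<Prod>i\<le>N. x i ^ \<alpha> i))" for j
  \<comment> \<open>Rather than moving the zero with \<open>s\<close>, the constant coefficients are
    corrected so that the fixed \<open>x\<close> stays an exact zero for every \<open>s\<close>. In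
    the zeroth form the distinguished coefficient is solved for, which \<open>f\<close> cannot
    notice.\<close>
  define \<beta> where "\<beta> s w = (if 1 \<le> fst w \<and> snd w = mono0 d then b w - s * h (fst w) else b w)" for s w
  define c where "c s j \<alpha> = (if j = 0 \<and> \<alpha> = mono0 d then - (\<Sum>\<alpha>\<in>mons_deg N d - {mono0 d}. s * b (0, \<alpha>) * (\<Prod>i\<le>N. x i ^ \<alpha> i))
    else if keep (j, \<alpha>) then \<beta> s (j, \<alpha>) else s * \<beta> s (j, \<alpha>))" for s j \<alpha>
  have zero: "heval N d (c s j) x = 0" if j: "j \<le> N" for s j
  proof (cases "j = 0")
    case True
    have "(\<Sum>\<alpha>\<in>mons_deg N d - {mono0 d}. c s j \<alpha> * (\<Prod>i\<le>N. x i ^ \<alpha> i)) = (\<Sum>\<alpha>\<in>mons_deg N d - {mono0 d}. s * b (0, \<alpha>) * (\<Prod>i\<le>N. x i ^ \<alpha> i))"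
      by (rule sum.cong) (auto simp: c_def True keep_def \<beta>_def)
    then show ?thesis unfolding heval_mono0[of x, OF x0] by (simp add: c_def True)
  next
    case False
    then have j1: "1 \<le> j" by simp
    have "(\<Prod>i\<le>N. x i ^ lin j i) = (\<Prod>i\<le>N. if i = j then x j else 1)"
      by (rule prod.cong) (use j1 in \<open>auto simp: lin_def x0\<close>)
    then have pl: "(\<Prod>i\<le>N. x i ^ lin j i) = x j" using j by simp
    have rest: "(\<Sum>\<alpha>\<in>mons_deg N d - {mono0 d} - {lin j}. c s j \<alpha> * (\<Prod>i\<le>N. x i ^ \<alpha> i)) = s * h j"
      unfolding h_def sum_distrib_left Diff_insert2[of _ "mono0 d" "{lin j}", symmetric]
      by (rule sum.cong) (use j1 in \<open>auto simp: c_def keep_def \<beta>_def\<close>)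
    have "(\<Sum>\<alpha>\<in>mons_deg N d - {mono0 d}. c s j \<alpha> * (\<Prod>i\<le>N. x i ^ \<alpha> i)) = c s j (lin j) * x j + s * h j"
      using lin_mons[OF j1 j] lin_neq[OF j1] by (subst sum.remove[of _ "lin j"]) (auto simp: pl rest)
    moreover have "c s j (lin j) = b (j, lin j)" using j1 j lin_neq[OF j1] by (simp add: c_def keep_def \<beta>_def)
    moreover have "c s j (mono0 d) = b (j, mono0 d) - s * h j" using j1 j by (simp add: c_def keep_def \<beta>_def)
    moreover have "b (j, lin j) * x j = - b (j, mono0 d)" using bl[OF j1 j] j1 by (simp add: x_def)
    ultimately show ?thesis unfolding heval_mono0[of x, OF x0] by simp
  qed
  \<comment> \<open>The evaluated \<open>g\<close> divided by the \<open>k\<close>-th power of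
    \<open>s\<close>. It vanishes for nonzero \<open>s\<close> because \<open>f\<close> vanishes on
    the systems \<open>c s\<close>, hence also at 0 by continuity, where it equals the leading term
    at \<open>b\<close>.\<close>
  define q where "q s = (\<Sum>i\<in>{k..degree g}. zpoly_eval (coeff g i) (\<beta> s) * s ^ (i - k))" for s
  have "q s = 0" if s: "s \<noteq> 0" for s
  proof -
    interpret ev: comm_ring_hom "\<lambda>r. zpoly_eval r (\<beta> s)" by (rule zpoly_eval_comm_ring_hom)
    interpret mp: map_poly_comm_ring_hom "\<lambda>r. zpoly_eval r (\<beta> s)" ..
    have hom: "comm_ring_hom (\<lambda>p. poly (map_poly (\<lambda>r. zpoly_eval r (\<beta> s)) p) s)"
      by unfold_locales (simp_all add: mp.hom_add mp.hom_mult)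
    have mp1: "map_poly (\<lambda>r. zpoly_eval r (\<beta> s)) [:r:] = [:zpoly_eval r (\<beta> s):]"
      and mp2: "map_poly (\<lambda>r. zpoly_eval r (\<beta> s)) [:0, r:] = [:0, zpoly_eval r (\<beta> s):]" for r
      by (rule poly_eqI, simp add: coeff_map_poly coeff_pCons split: nat.split)+
    have "0 = zpoly_eval f (at_point (c s))" using inertia_vanish_affine[OF f(1) x0 zero] ..
    also have "\<dots> = zpoly_eval f (\<lambda>w. poly (map_poly (\<lambda>r. zpoly_eval r (\<beta> s)) (a w)) s)"
    proof (rule zpoly_eval_cong)
      fix w assume "w \<in> zpoly_vars f"
      then have "w \<noteq> (0, mono0 d)" using f(2) by (auto simp: zring_def)
      then show "at_point (c s) w = poly (map_poly (\<lambda>r. zpoly_eval r (\<beta> s)) (a w)) s"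
        by (cases w) (auto simp: at_point_def c_def a_def mp1 mp2)
    qed
    also have "\<dots> = poly (map_poly (\<lambda>r. zpoly_eval r (\<beta> s)) g) s"
      unfolding g_def by (rule comm_ring_hom.hom_zpoly_eval[OF hom, symmetric])
    also have "\<dots> = (\<Sum>i<Suc (degree g). zpoly_eval (coeff g i) (\<beta> s) * s ^ i)"
      by (subst poly_truncate[of "Suc (degree g)"]) (auto simp: coeff_map_poly coeff_eq_0)
    also have "\<dots> = (\<Sum>i\<in>{k..degree g}. zpoly_eval (coeff g i) (\<beta> s) * s ^ i)"
      by (rule sum.mono_neutral_right) (use k(2) in \<open>auto simp: not_le\<close>)
    also have "\<dots> = s ^ k * q s"
      unfolding q_def sum_distrib_left
      by (rule sum.cong) (auto simp: mult.left_commute simp flip: power_add)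
    finally show ?thesis using s by simp
  qed
  moreover have "isCont q 0"
  proof -
    have "isCont (\<lambda>s. \<beta> s w) 0" for w
    proof (cases "1 \<le> fst w \<and> snd w = mono0 d")
      case True
      then have "(\<lambda>s. \<beta> s w) = (\<lambda>s. b w - s * h (fst w))" by (auto simp: \<beta>_def)
      then show ?thesis by (simp only:) (intro continuous_intros)
    next
      case False
      then have "(\<lambda>s. \<beta> s w) = (\<lambda>s. b w)" by (auto simp: \<beta>_def)
      then show ?thesis by simp
    qed
    then show ?thesis unfolding q_def by (intro continuous_intros isCont_zpoly_eval)
  qed
  ultimately have "q 0 = 0"
  proof -
    assume z: "\<And>s. s \<noteq> 0 \<Longrightarrow> q s = 0" and "isCont q 0"
    then have "(q \<longlongrightarrow> q 0) (at 0)" by (simp add: isCont_def)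
    moreover have "(q \<longlongrightarrow> 0) (at 0)"
      by (rule Lim_transform_eventually[OF tendsto_const]) (auto simp: eventually_at_filter z)
    ultimately show ?thesis by (intro tendsto_unique[of "at (0::complex)"]) auto
  qed
  moreover have "q 0 = zpoly_eval (coeff g k) b"
  proof -
    have "\<beta> 0 = b" by (auto simp: \<beta>_def)
    have "k \<le> degree g" using k(1) by (rule le_degree)
    have "q 0 = (\<Sum>i\<in>{k..degree g}. if i = k then zpoly_eval (coeff g k) b else 0)"
      unfolding q_def \<open>\<beta> 0 = b\<close> by (rule sum.cong) auto
    then show ?thesis using \<open>k \<le> degree g\<close> by simp
  qed
  ultimately show False using b by simp
qed

section \<open>The normalised generator and its identification with the Macaulay resultant\<close>

definition res_generator :: "nat \<Rightarrow> nat \<Rightarrow> zpoly \<Rightarrow> bool" where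
  "res_generator N d R \<longleftrightarrow> R \<in> inertia_ideal N d \<and> irreducible R \<and> (\<forall>g\<in>inertia_ideal N d. R dvd g) \<and>
     zpoly_eval R (\<lambda>(i, \<alpha>). if \<alpha> = (\<lambda>j. if j = i then d else 0) then 1 else 0) = (1::int)"

text \<open>The minor with value 1 at the power forms does double duty: it shows that the ideal is
  nonzero, and being a multiple of the generator it forces the generator's value there to be a unit
  of the integers.\<close>

lemma res_generator_exists:
  assumes d: "d > 0"
  shows "\<exists>R. res_generator N d R"
proof -
  let ?W = "coeff_vars N d" and ?v = "(0, mono0 d)"
  let ?pow = "(\<lambda>(i, \<alpha>). if \<alpha> = (\<lambda>j. if j = i then d else 0) then 1 else 0) :: zv \<Rightarrow> int"
  have W: "insert ?v (?W - {?v}) = ?W" by auto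
  obtain D \<sigma> where \<sigma>: "mac_rows N d D \<sigma>" "zpoly_eval (mac_minor N D \<sigma>) ?pow = 1"
    using macmat_det_power_forms[OF d, of "\<lambda>j \<alpha>. ?pow (j, \<alpha>)" N] by (auto simp: mac_minor_eval)
  have m: "mac_minor N D \<sigma> \<in> inertia_ideal N d" by (rule mac_minor_inertia[OF \<sigma>(1)])
  have "\<exists>R\<in>inertia_ideal N d. irreducible R \<and> (\<forall>g\<in>inertia_ideal N d. R dvd g)"
  proof (rule zring_prime_ideal_principal[where W = "?W - {?v}" and v = ?v, unfolded W])
    show "mac_minor N D \<sigma> \<in> inertia_ideal N d" by (rule m)
    show "mac_minor N D \<sigma> \<noteq> 0" using \<sigma>(2) by auto
    show "c = 0" if "c \<in> zring (?W - {?v})" "c \<in> inertia_ideal N d" for c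
      using inertia_elimination[OF d that(2,1)] .
  qed (use inertia_prime in auto)
  then obtain R where R: "R \<in> inertia_ideal N d" "irreducible R" "\<And>g. g \<in> inertia_ideal N d \<Longrightarrow> R dvd g" by blast
  obtain h where "mac_minor N D \<sigma> = R * h" using R(3)[OF m] by (auto simp: dvd_def)
  then have "zpoly_eval R ?pow * zpoly_eval h ?pow = 1" using \<sigma>(2) by (simp add: zeval.hom_mult)
  from dvdI[OF this[symmetric]] have "\<bar>zpoly_eval R ?pow\<bar> = 1" by (simp only: zdvd1_eq)
  then consider "zpoly_eval R ?pow = 1" | "zpoly_eval (- R) ?pow = 1"
    unfolding zeval.hom_uminus by linarith
  then show ?thesis
  proof cases
    case 1
    then show ?thesis using R by (auto simp: res_generator_def)
  next
    case 2
    have "- R \<in> inertia_ideal N d" using R(1) by (auto simp: inertia_ideal_def zeval.hom_uminus zring_closed)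
    moreover have "irreducible (- R)"
    proof (rule irreducibleI)
      show "- R \<noteq> 0" "\<not> - R dvd 1" using R(2) by (auto simp: irreducible_def)
      fix a b assume "- R = a * b"
      then have "R = (- a) * b" by (metis minus_minus minus_mult_left)
      then have "- a dvd 1 \<or> b dvd 1" using R(2) irreducibleD by blast
      then show "a dvd 1 \<or> b dvd 1" by simp
    qed
    ultimately show ?thesis using R 2 by (auto simp: res_generator_def)
  qed
qed

lemma res_generator_nonzero:
  fixes F :: "'k::field hmap"
  assumes "res_generator N d R" "alg_closed TYPE('k)" "no_common_zero N d F"
  shows "zpoly_eval R (at_point F) \<noteq> 0"
proof -
  obtain D \<sigma> where \<sigma>: "mac_rows N d D \<sigma>" "det (macmat N D F \<sigma>) \<noteq> 0" using macmat_det_nonzero[OF assms(2,3)] by blast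
  have "R dvd mac_minor N D \<sigma>" using assms(1) mac_minor_inertia[OF \<sigma>(1)] by (auto simp: res_generator_def)
  then obtain h where "mac_minor N D \<sigma> = R * h" by (auto simp: dvd_def)
  moreover have "zpoly_eval (mac_minor N D \<sigma>) (at_point F) \<noteq> 0" using \<sigma>(2) by (simp add: mac_minor_eval at_point_def)
  ultimately show ?thesis by (auto simp: zeval.hom_mult)
qed

lemma alg_closed_complex: "alg_closed TYPE(complex)"
  unfolding alg_closed_def using fundamental_theorem_of_algebra constant_degree by (metis less_numeral_extra(3))

lemma res_generator_complex_zeros:
  assumes "res_generator N d R"
  shows "zpoly_eval R (at_point c) = 0 \<longleftrightarrow> (\<exists>z :: nat \<Rightarrow> complex. nonzero_vec N z \<and> (\<forall>i\<le>N. heval N d (c i) z = 0))"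
proof
  assume "zpoly_eval R (at_point c) = 0"
  then have "\<not> no_common_zero N d c" using res_generator_nonzero[OF assms alg_closed_complex] by blast
  then show "\<exists>z. nonzero_vec N z \<and> (\<forall>i\<le>N. heval N d (c i) z = 0)" by (auto simp: no_common_zero_def nonzero_vec_def)
next
  assume "\<exists>z. nonzero_vec N z \<and> (\<forall>i\<le>N. heval N d (c i) z = 0)"
  then show "zpoly_eval R (at_point c) = 0"
    using inertia_vanish[OF alg_closed_infinite[OF alg_closed_complex]] assms by (auto simp: res_generator_def)
qed

text \<open>For uniqueness, a polynomial with the complex zero set required by
  \<open>is_macaulay_res\<close> lies in the ideal, so it is a multiple of the generator;
  irreducibility leaves an integer factor, and the normalisation makes it 1.\<close>

lemma res_generator_macaulay:
  assumes "d > 0"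
  shows "res_generator N d (macaulay_res N d)"
proof -
  obtain R where R: "res_generator N d R" using res_generator_exists[OF assms] by blast
  have "is_macaulay_res N d R"
    using R res_generator_complex_zeros[OF R]
    by (auto simp: is_macaulay_res_def res_generator_def inertia_ideal_def zring_def at_point_def)
  moreover have "R' = R" if R': "is_macaulay_res N d R'" for R'
  proof -
    have "R' \<in> inertia_ideal N d"
    proof (rule inertiaI)
      show "R' \<in> zring (coeff_vars N d)" using R' by (auto simp: is_macaulay_res_def zring_def)
      fix c :: "complex hmap" and z :: "nat \<Rightarrow> complex"
      assume "z 0 = 1" "\<And>j. j \<le> N \<Longrightarrow> heval N d (c j) z = 0"
      then have "\<exists>z. nonzero_vec N z \<and> (\<forall>i\<le>N. heval N d (c i) z = 0)" by (intro exI[of _ z]) (auto simp: nonzero_vec_def)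
      then show "zpoly_eval R' (at_point c) = 0" using R' by (simp add: is_macaulay_res_def at_point_def)
    qed
    then have "R dvd R'" using R by (auto simp: res_generator_def)
    then obtain k where k: "R' = R * k" by (auto simp: dvd_def)
    have "irreducible R'" "irreducible R" using R R' by (auto simp: is_macaulay_res_def res_generator_def)
    then have "k dvd 1" using k irreducibleD[of R' R k] by (auto simp: irreducible_def)
    then obtain e where e: "k = of_int e" using zpoly_unit by blast
    have "e = 1" using R R' by (simp add: k e is_macaulay_res_def res_generator_def zeval.hom_mult)
    then show ?thesis using k e by simp
  qed
  ultimately have "macaulay_res N d = R" unfolding macaulay_res_def by (rule the_equality)
  then show ?thesis using R by simp
qed

subsection \<open>Ratios of lifts\<close>

text \<open>On a line missing the origin the forms restrict to univariate polynomials without a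
  common root, so a combination of them is 1. The same combination of the other lift is then a
  polynomial quotient \<open>g\<close>. A root of \<open>g\<close> would be a common zero of the
  second lift, so \<open>g\<close> is constant.\<close>

lemma lift_ratio_line:
  fixes Phi Psi :: "'k::field hmap"
  assumes ac: "alg_closed TYPE('k)" and Phi: "no_common_zero N d Phi" and Psi: "no_common_zero N d Psi"
    and l: "\<And>x. nonzero_vec N x \<Longrightarrow> l x \<noteq> 0 \<and> (\<forall>i\<le>N. heval N d (Psi i) x = l x * heval N d (Phi i) x)"
    and nz: "\<And>t. nonzero_vec N (\<lambda>i. x i + t * y i)"
  shows "l (\<lambda>i. x i + t * y i) = l (\<lambda>i. x i + t' * y i)"
proof -
  let ?p = "\<lambda>t i. x i + t * y i"
  define F where "F i = heval N d (\<lambda>\<alpha>. [:Phi i \<alpha>:]) (\<lambda>k. [:x k, y k:])" for i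
  define G where "G i = heval N d (\<lambda>\<alpha>. [:Psi i \<alpha>:]) (\<lambda>k. [:x k, y k:])" for i
  have h: "comm_ring_hom (\<lambda>p. poly p s)" for s :: 'k by unfold_locales simp_all
  have F: "poly (F i) t = heval N d (Phi i) (?p t)" and G: "poly (G i) t = heval N d (Psi i) (?p t)" for i t
    by (simp_all add: F_def G_def heval_hom[OF h])
  have nzF: "\<exists>i\<le>N. poly (F i) t \<noteq> 0" and nzG: "\<exists>i\<le>N. poly (G i) t \<noteq> 0" for t
    using Phi Psi nz[of t] by (auto simp: F G no_common_zero_def nonzero_vec_def)
  have poly_eq: "p = q" if "\<And>t. poly p t = poly q t" for p q :: "'k poly"
  proof (rule ccontr)
    assume "p \<noteq> q"
    then have "finite {t. poly (p - q) t = 0}" by (intro poly_roots_finite) simp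
    moreover have "{t. poly (p - q) t = 0} = UNIV" using that by auto
    ultimately show False using alg_closed_infinite[OF ac] by simp
  qed
  have FG: "F j * G i = G j * F i" if "i \<le> N" "j \<le> N" for i j
    by (rule poly_eq) (use l[OF nz] that in \<open>simp add: F G\<close>)
  define A where "A = range (\<lambda>a. \<Sum>i\<le>N. a i * F i)"
  have FA: "F j \<in> A" if "j \<le> N" for j
  proof -
    have "(\<Sum>i\<le>N. (if i = j then 1 else 0) * F i) = (\<Sum>i\<le>N. if i = j then F j else 0)" by (rule sum.cong) auto
    then have "F j = (\<Sum>i\<le>N. (if i = j then 1 else 0) * F i)" using that by simp
    then show ?thesis unfolding A_def by (rule range_eqI[where x = "\<lambda>i. if i = j then 1 else 0"])
  qed
  have "1 \<in> A"
  proof (rule poly_ideal_contains_1[OF ac])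
    fix a b s assume "a \<in> A" "b \<in> A"
    then obtain u v where "a = (\<Sum>i\<le>N. u i * F i)" "b = (\<Sum>i\<le>N. v i * F i)" unfolding A_def by blast
    then have "a - s * b = (\<Sum>i\<le>N. (u i - s * v i) * F i)"
      by (simp add: left_diff_distrib sum_subtractf sum_distrib_left mult.assoc)
    then show "a - s * b \<in> A" unfolding A_def by (rule range_eqI[where x = "\<lambda>i. u i - s * v i"])
  next
    from nzF have "\<exists>j\<le>N. F j \<noteq> 0" by (metis poly_0)
    then have *: "(SOME j. j \<le> N \<and> F j \<noteq> 0) \<le> N \<and> F (SOME j. j \<le> N \<and> F j \<noteq> 0) \<noteq> 0" by (rule someI_ex)
    then show "F (SOME j. j \<le> N \<and> F j \<noteq> 0) \<in> A" "F (SOME j. j \<le> N \<and> F j \<noteq> 0) \<noteq> 0" using FA by auto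
    show "\<exists>a\<in>A. poly a t \<noteq> 0" for t using nzF[of t] FA by blast
  qed
  then obtain a where a: "1 = (\<Sum>i\<le>N. a i * F i)" unfolding A_def by blast
  define g where "g = (\<Sum>i\<le>N. a i * G i)"
  have gF: "G j = g * F j" if "j \<le> N" for j
  proof -
    have "G j = G j * (\<Sum>i\<le>N. a i * F i)" using a by simp
    also have "\<dots> = (\<Sum>i\<le>N. a i * (G j * F i))" by (simp add: sum_distrib_left mult_ac)
    also have "\<dots> = (\<Sum>i\<le>N. a i * (F j * G i))" by (rule sum.cong) (use FG that in auto)
    also have "\<dots> = g * F j" unfolding g_def sum_distrib_right by (rule sum.cong) (simp_all add: mult_ac)
    finally show ?thesis .
  qed
  have "degree g = 0"
  proof (rule ccontr)
    assume "degree g \<noteq> 0"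
    then obtain s where "poly g s = 0" using ac by (auto simp: alg_closed_def)
    then show False using nzG[of s] gF by auto
  qed
  then obtain c where c: "g = [:c:]" by (metis degree_0_id)
  have "l (?p t) = c" for t
  proof -
    obtain j where j: "j \<le> N" "poly (F j) t \<noteq> 0" using nzF by blast
    have "poly (G j) t = l (?p t) * poly (F j) t" using l[OF nz[of t]] j(1) by (simp add: F G)
    moreover have "poly (G j) t = c * poly (F j) t" using gF[OF j(1)] c by simp
    ultimately have "l (?p t) * poly (F j) t = c * poly (F j) t" by (rule trans[OF sym])
    then show ?thesis using j by simp
  qed
  then show ?thesis by simp
qed

text \<open>Proportional points are compared by homogeneity. Otherwise the lines through
  \<open>x\<close> in direction \<open>y\<close> and through \<open>y\<close> in direction
  \<open>x\<close> both miss the origin, and they meet in the sum of the two vectors.\<close>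

lemma lift_ratio_constant:
  fixes Phi Psi :: "'k::field hmap"
  assumes ac: "alg_closed TYPE('k)" and Phi: "no_common_zero N d Phi" and Psi: "no_common_zero N d Psi"
    and same: "same_proj_map N d Phi Psi"
  shows "\<exists>c. c \<noteq> 0 \<and> (\<forall>x. nonzero_vec N x \<longrightarrow> (\<forall>i\<le>N. heval N d (Psi i) x = c * heval N d (Phi i) x))"
proof -
  have "\<forall>x. \<exists>l. nonzero_vec N x \<longrightarrow> l \<noteq> 0 \<and> (\<forall>i\<le>N. heval N d (Psi i) x = l * heval N d (Phi i) x)"
    using same by (auto simp: same_proj_map_def)
  from choice[OF this] obtain l where
    l: "\<And>x. nonzero_vec N x \<Longrightarrow> l x \<noteq> 0 \<and> (\<forall>i\<le>N. heval N d (Psi i) x = l x * heval N d (Phi i) x)" by blast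
  have scaled: "l x = l y" if x: "nonzero_vec N x" and y: "nonzero_vec N y" and t: "\<And>i. i \<le> N \<Longrightarrow> x i + t * y i = 0" for x y t
  proof -
    obtain j where j: "j \<le> N" "heval N d (Phi j) x \<noteq> 0" using Phi x by (auto simp: no_common_zero_def nonzero_vec_def)
    have e: "heval N d c x = (- t) ^ d * heval N d c y" for c
    proof -
      have "heval N d c x = heval N d c (\<lambda>i. - t * y i)"
        by (rule heval_cong) (use t in \<open>simp add: eq_neg_iff_add_eq_0\<close>)
      then show ?thesis unfolding heval_scale .
    qed
    have "l x * heval N d (Phi j) x = heval N d (Psi j) x" using l[OF x] j by simp
    also have "\<dots> = l y * heval N d (Phi j) x" unfolding e using l[OF y] j by simp
    finally show ?thesis using j by simp
  qed
  have line: "l x = l (\<lambda>i. x i + 1 * y i)" if "\<And>t. nonzero_vec N (\<lambda>i. x i + t * y i)" for x y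
    using lift_ratio_line[OF ac Phi Psi l that, of 0 1] by simp
  have eq: "l x = l y" if x: "nonzero_vec N x" and y: "nonzero_vec N y" for x y
  proof -
    consider (a) t where "\<And>i. i \<le> N \<Longrightarrow> x i + t * y i = 0" | (b) t where "\<And>i. i \<le> N \<Longrightarrow> y i + t * x i = 0"
      | (c) "\<And>t. nonzero_vec N (\<lambda>i. x i + t * y i)" "\<And>t. nonzero_vec N (\<lambda>i. y i + t * x i)"
      unfolding nonzero_vec_def by blast
    then show ?thesis
    proof cases
      case a
      then show ?thesis using scaled[OF x y] by blast
    next
      case b
      then show ?thesis using scaled[OF y x] by metis
    next
      case c
      then show ?thesis using line[OF c(1)] line[OF c(2)] by (simp add: add.commute)
    qed
  qed
  have "nonzero_vec N (axis_vec 0 :: nat \<Rightarrow> 'k)" by (auto simp: nonzero_vec_def axis_vec_def)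
  then show ?thesis using l eq by (intro exI[of _ "l (axis_vec 0)"]) metis
qed

subsection \<open>Nonarchimedean estimates\<close>

locale nonarch =
  fixes absv :: "'k::field \<Rightarrow> real"
  assumes nonarch: "nonarch_abs absv"
begin

lemma abs_nonneg [simp]: "0 \<le> absv x"
  and abs_eq_0 [simp]: "absv x = 0 \<longleftrightarrow> x = 0"
  and abs_mult: "absv (x * y) = absv x * absv y"
  and abs_add: "absv (x + y) \<le> max (absv x) (absv y)"
  using nonarch by (auto simp: nonarch_abs_def)

lemma abs_0 [simp]: "absv 0 = 0"
  by (subst abs_eq_0) simp

lemma abs_pos [simp]: "0 < absv x \<longleftrightarrow> x \<noteq> 0"
  using abs_nonneg[of x] abs_eq_0[of x] by linarith

lemma abs_1 [simp]: "absv 1 = 1"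
  using abs_mult[of 1 1] abs_eq_0[of 1] by simp

lemma abs_minus [simp]: "absv (- x) = absv x"
proof -
  have "absv (- 1) * absv (- 1) = 1" using abs_mult[of "- 1" "- 1"] by simp
  then have "absv (- 1) = 1" using abs_nonneg[of "- 1"] by (metis abs_of_nonneg mult_1_right power2_eq_square real_sqrt_abs real_sqrt_one)
  then show ?thesis using abs_mult[of "- 1" x] by simp
qed

lemma abs_diff: "absv (x - y) \<le> max (absv x) (absv y)"
  using abs_add[of x "- y"] by simp

lemma abs_power: "absv (x ^ n) = absv x ^ n"
  by (induction n) (auto simp: abs_mult)

lemma abs_divide: "absv (x / y) = absv x / absv y"
proof (cases "y = 0")
  case False
  have "absv (x / y) * absv y = absv x" using False by (simp flip: abs_mult)
  then show ?thesis using False by (simp add: field_simps)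
qed simp

lemma abs_of_nat: "absv (of_nat n) \<le> 1"
proof (induction n)
  case (Suc n)
  then show ?case using abs_add[of 1 "of_nat n"] by simp
qed simp

lemma abs_of_int: "absv (of_int k) \<le> 1"
  by (cases k) (use abs_of_nat in \<open>simp_all flip: of_nat_Suc\<close>)

text \<open>Keeping both entries in the unit ball makes closeness stable under products as well as
  sums, with no loss in \<open>e\<close>.\<close>

definition near :: "real \<Rightarrow> 'k \<Rightarrow> 'k \<Rightarrow> bool" where
  "near e x y \<longleftrightarrow> absv x \<le> 1 \<and> absv y \<le> 1 \<and> absv (x - y) \<le> e"

lemma near_add: "near e x x' \<Longrightarrow> near e y y' \<Longrightarrow> near e (x + y) (x' + y')"
  using abs_add[of x y] abs_add[of x' y'] abs_add[of "x - x'" "y - y'"]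
  by (auto simp: near_def algebra_simps)

lemma near_mult:
  assumes "near e x x'" "near e y y'"
  shows "near e (x * y) (x' * y')"
proof -
  have "0 \<le> e" using assms(1) abs_nonneg[of "x - x'"] unfolding near_def by linarith
  then have "absv (x * (y - y')) \<le> e" "absv ((x - x') * y') \<le> e"
    using assms mult_mono[of "absv x" 1 "absv (y - y')" e] mult_mono[of "absv (x - x')" e "absv y'" 1]
    by (auto simp: near_def abs_mult)
  moreover have "x * y - x' * y' = x * (y - y') + (x - x') * y'" by (simp add: algebra_simps)
  ultimately have "absv (x * y - x' * y') \<le> e" using abs_add[of "x * (y - y')" "(x - x') * y'"] by simp
  then show ?thesis using assms by (auto simp: near_def abs_mult mult_le_one)
qed

lemma near_refl: "0 \<le> e \<Longrightarrow> absv x \<le> 1 \<Longrightarrow> near e x x"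
  by (simp add: near_def)

lemma near_heval:
  assumes e: "0 \<le> e" and c: "\<And>\<alpha>. \<alpha> \<in> mons_deg N d \<Longrightarrow> absv (c \<alpha>) \<le> 1" and x: "\<And>i. i \<le> N \<Longrightarrow> near e (x i) (y i)"
  shows "near e (heval N d c x) (heval N d c y)"
proof -
  have pow: "near e u v \<Longrightarrow> near e (u ^ n) (v ^ n)" for u v and n :: nat
    by (induction n) (auto simp: near_mult near_refl e)
  have pr: "(\<And>i. i \<in> A \<Longrightarrow> near e (f i) (g i)) \<Longrightarrow> near e (prod f A) (prod g A)" for A :: "nat set" and f g
    by (induction A rule: infinite_finite_induct) (auto simp: near_mult near_refl e)
  have su: "(\<And>i. i \<in> A \<Longrightarrow> near e (f i) (g i)) \<Longrightarrow> near e (sum f A) (sum g A)" for A :: "(nat \<Rightarrow> nat) set" and f g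
    by (induction A rule: infinite_finite_induct) (auto simp: near_add near_refl e)
  show ?thesis unfolding heval_def by (intro su near_mult near_refl e c pr pow x) auto
qed

section \<open>Maximum norm and chordal distance\<close>

abbreviation "vn \<equiv> vnorm absv"

lemma vnorm_ge: "i \<le> N \<Longrightarrow> absv (x i) \<le> vn N x"
  unfolding vnorm_def by (intro Max_ge) auto

lemma vnorm_le: "(\<And>i. i \<le> N \<Longrightarrow> absv (x i) \<le> B) \<Longrightarrow> vn N x \<le> B"
  unfolding vnorm_def by (subst Max_le_iff) auto

lemma vnorm_attained: "\<exists>i\<le>N. vn N x = absv (x i)"
proof -
  have "vn N x \<in> (\<lambda>i. absv (x i)) ` {..N}" unfolding vnorm_def by (intro Max_in) auto
  then show ?thesis by auto
qed

lemma vnorm_pos: "nonzero_vec N x \<Longrightarrow> 0 < vn N x"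
  unfolding nonzero_vec_def using vnorm_ge abs_pos by (metis order.strict_trans2)

lemma vnorm_scale: "vn N (\<lambda>i. a * x i) = absv a * vn N x"
proof (rule antisym)
  show "vn N (\<lambda>i. a * x i) \<le> absv a * vn N x"
    by (rule vnorm_le) (simp add: abs_mult mult_left_mono vnorm_ge)
  obtain i where "i \<le> N" "vn N x = absv (x i)" using vnorm_attained by blast
  then show "absv a * vn N x \<le> vn N (\<lambda>i. a * x i)" using vnorm_ge[of i N "\<lambda>i. a * x i"] by (simp add: abs_mult)
qed

lemma chordal_ge:
  "i \<le> N \<Longrightarrow> j \<le> N \<Longrightarrow> absv (x i * y j - x j * y i) / (vn N x * vn N y) \<le> chordal absv N x y"
  unfolding chordal_def
proof (rule divide_right_mono)
  show "i \<le> N \<Longrightarrow> j \<le> N \<Longrightarrow> absv (x i * y j - x j * y i) \<le> Max ((\<lambda>(i, j). absv (x i * y j - x j * y i)) ` ({..N} \<times> {..N}))"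
    by (intro Max_ge) auto
  obtain i j where "vn N x = absv (x i)" "vn N y = absv (y j)" using vnorm_attained by meson
  then show "0 \<le> vn N x * vn N y" by simp
qed

lemma chordal_attained:
  "\<exists>i\<le>N. \<exists>j\<le>N. chordal absv N x y = absv (x i * y j - x j * y i) / (vn N x * vn N y)"
proof -
  let ?f = "\<lambda>(i, j). absv (x i * y j - x j * y i)"
  have "Max (?f ` ({..N} \<times> {..N})) \<in> ?f ` ({..N} \<times> {..N})" by (intro Max_in) auto
  then obtain p where p: "Max (?f ` ({..N} \<times> {..N})) = ?f p" "p \<in> {..N} \<times> {..N}" by (rule imageE)
  then show ?thesis unfolding chordal_def p(1)
    by (intro exI[of _ "fst p"] exI[of _ "snd p"] conjI) (auto simp: case_prod_unfold)
qed

lemma chordal_scale: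
  assumes "a \<noteq> 0" "b \<noteq> 0"
  shows "chordal absv N (\<lambda>i. a * x i) (\<lambda>i. b * y i) = chordal absv N x y"
proof -
  have "absv (a * x i * (b * y j) - a * x j * (b * y i)) / (vn N (\<lambda>i. a * x i) * vn N (\<lambda>i. b * y i))
      = absv (x i * y j - x j * y i) / (vn N x * vn N y)" for i j
  proof -
    have "a * x i * (b * y j) - a * x j * (b * y i) = (a * b) * (x i * y j - x j * y i)" by (simp add: algebra_simps)
    then show ?thesis using assms by (simp add: abs_mult vnorm_scale)
  qed
  then show ?thesis
    using chordal_attained[of N "\<lambda>i. a * x i" "\<lambda>i. b * y i"] chordal_attained[of N x y]
      chordal_ge[of _ N _ "\<lambda>i. a * x i" "\<lambda>i. b * y i"] chordal_ge[of _ N _ x y]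
    by (metis antisym)
qed

lemma chordal_nonneg: "0 \<le> chordal absv N x y"
proof -
  obtain i j where "vn N x = absv (x i)" "vn N y = absv (y j)" using vnorm_attained by meson
  then show ?thesis using chordal_attained[of N x y] by (metis abs_nonneg divide_nonneg_nonneg mult_nonneg_nonneg)
qed

lemma chordal_le_1:
  assumes "nonzero_vec N x" "nonzero_vec N y"
  shows "chordal absv N x y \<le> 1"
proof -
  obtain i j where ij: "i \<le> N" "j \<le> N" "chordal absv N x y = absv (x i * y j - x j * y i) / (vn N x * vn N y)"
    using chordal_attained by blast
  have "absv (x k * y l) \<le> vn N x * vn N y" if "k \<le> N" "l \<le> N" for k l
    unfolding abs_mult using that vnorm_pos[OF assms(1)] by (intro mult_mono vnorm_ge) auto
  then have "absv (x i * y j - x j * y i) \<le> vn N x * vn N y"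
    using abs_diff[of "x i * y j" "x j * y i"] ij by (meson max.bounded_iff order_trans)
  then show ?thesis unfolding ij using vnorm_pos[OF assms(1)] vnorm_pos[OF assms(2)] by simp
qed

text \<open>At distance below 1 a coordinate of maximal size for \<open>x\<close> is also maximal
  for \<open>y\<close>; otherwise one of the two products in a minor would dominate and the distance
  would be at least 1. Dividing both vectors by that coordinate turns the differences of entries
  into normalised minors.\<close>

lemma chordal_representatives:
  assumes x: "nonzero_vec N x" and y: "nonzero_vec N y" and lt: "chordal absv N x y < 1"
  shows "\<exists>a b. a \<noteq> 0 \<and> b \<noteq> 0 \<and> vn N (\<lambda>i. a * x i) = 1 \<and> vn N (\<lambda>i. b * y i) = 1 \<and>
    (\<forall>i\<le>N. near (chordal absv N x y) (a * x i) (b * y i))"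
proof -
  have px: "vn N x > 0" and py: "vn N y > 0" using x y by (auto intro: vnorm_pos)
  obtain i where i: "i \<le> N" "vn N x = absv (x i)" using vnorm_attained by blast
  obtain j where j: "j \<le> N" "vn N y = absv (y j)" using vnorm_attained by blast
  have yi: "vn N y = absv (y i)"
  proof (rule ccontr)
    assume "vn N y \<noteq> absv (y i)"
    then have "absv (y i) < vn N y" using vnorm_ge[OF i(1), of y] by simp
    then have "absv (x j * y i) < vn N x * vn N y"
      unfolding abs_mult using px vnorm_ge[OF j(1), of x]
      by (intro le_less_trans[OF mult_right_mono mult_strict_left_mono]) auto
    moreover have "absv (x i * y j) \<le> max (absv (x i * y j - x j * y i)) (absv (x j * y i))"
      using abs_add[of "x i * y j - x j * y i" "x j * y i"] by simp
    moreover have "absv (x i * y j) = vn N x * vn N y" using i j by (simp add: abs_mult)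
    ultimately have "vn N x * vn N y \<le> absv (x i * y j - x j * y i)" by simp
    then have "1 \<le> absv (x i * y j - x j * y i) / (vn N x * vn N y)" using px py by simp
    then show False using chordal_ge[OF i(1) j(1), of x y] lt by simp
  qed
  have x0: "x i \<noteq> 0" "y i \<noteq> 0" using px py i yi by auto
  let ?a = "1 / x i" and ?b = "1 / y i"
  have n: "vn N (\<lambda>k. ?a * x k) = 1" "vn N (\<lambda>k. ?b * y k) = 1"
    unfolding vnorm_scale using x0 i yi by (simp_all add: abs_divide)
  have "near (chordal absv N x y) (?a * x k) (?b * y k)" if k: "k \<le> N" for k
  proof -
    have "?a * x k - ?b * y k = (x k * y i - x i * y k) / (x i * y i)" using x0 by (simp add: field_simps)
    then have "absv (?a * x k - ?b * y k) = absv (x k * y i - x i * y k) / (vn N x * vn N y)"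
      by (simp add: abs_divide abs_mult i(2) yi)
    also have "\<dots> \<le> chordal absv N x y" by (rule chordal_ge[OF k i(1)])
    finally show ?thesis using vnorm_ge[OF k, of "\<lambda>k. ?a * x k"] vnorm_ge[OF k, of "\<lambda>k. ?b * y k"] n by (simp add: near_def)
  qed
  then show ?thesis using n x0 by (intro exI[of _ ?a] exI[of _ ?b]) auto
qed

lemma vnorm_normalise:
  assumes "nonzero_vec N x"
  shows "\<exists>a. a \<noteq> 0 \<and> vn N (\<lambda>i. a * x i) = 1"
proof -
  obtain i where i: "i \<le> N" "vn N x = absv (x i)" using vnorm_attained by blast
  then have "x i \<noteq> 0" using vnorm_pos[OF assms] by auto
  moreover from this have "vn N (\<lambda>k. 1 / x i * x k) = 1" unfolding vnorm_scale using i by (simp add: abs_divide)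
  ultimately show ?thesis by (intro exI[of _ "1 / x i"]) auto
qed

end

section \<open>Lifts with coefficients in the unit ball\<close>

locale integral_lift = nonarch absv for absv :: "'k::field \<Rightarrow> real" +
  fixes N d :: nat and Psi :: "'k hmap"
  assumes d_pos: "d > 0" and ac: "alg_closed TYPE('k)" and ncz: "no_common_zero N d Psi"
    and coeff_le: "\<And>j \<alpha>. j \<le> N \<Longrightarrow> \<alpha> \<in> mons_deg N d \<Longrightarrow> absv (Psi j \<alpha>) \<le> 1"
begin

abbreviation "H \<equiv> hmap_apply N d Psi"

definition "\<rho> = absv (Res_of_lift N d Psi)"

lemma Res_eq: "Res_of_lift N d Psi = zpoly_eval (macaulay_res N d) (at_point Psi)"
  by (simp add: Res_of_lift_def at_point_def)

lemma generator: "res_generator N d (macaulay_res N d)"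
  by (rule res_generator_macaulay[OF d_pos])

lemma inertia: "macaulay_res N d \<in> inertia_ideal N d"
  using generator by (simp add: res_generator_def)

lemma res_vars: "v \<in> zpoly_vars (macaulay_res N d) \<Longrightarrow> v \<in> coeff_vars N d"
  using inertia by (auto simp: inertia_ideal_def zring_def)

lemma rho_pos: "0 < \<rho>"
  using res_generator_nonzero[OF generator ac ncz] by (simp add: \<rho>_def Res_eq)

text \<open>The resultant vanishes after perturbing one coefficient of each form by at most the size of
  its value, and integer polynomials are 1-Lipschitz on the unit polydisc.\<close>
lemma rho_le_perturbed:
  assumes e: "0 \<le> e" and i: "i \<le> N" "y i = 1" and y: "\<And>k. k \<le> N \<Longrightarrow> absv (y k) \<le> 1"
    and small: "\<And>j. j \<le> N \<Longrightarrow> absv (heval N d (Psi j) y) \<le> e"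
  shows "\<rho> \<le> e"
proof -
  let ?b = "\<lambda>j \<alpha>. Psi j \<alpha> - (if \<alpha> = (\<lambda>k. if k = i then d else 0) then heval N d (Psi j) y else 0)"
  have "zpoly_eval (macaulay_res N d) (at_point ?b) = 0"
  proof (rule inertia_vanish[OF alg_closed_infinite[OF ac] inertia])
    show "nonzero_vec N y" using i by (auto simp: nonzero_vec_def)
    show "heval N d (?b j) y = 0" for j by (simp add: heval_adjust i)
  qed
  moreover have "near e (zpoly_eval (macaulay_res N d) (at_point Psi)) (zpoly_eval (macaulay_res N d) (at_point ?b))"
  proof (rule zpoly_eval_rel)
    show "near e (of_int k) (of_int k)" for k by (intro near_refl e abs_of_int)
    fix v assume "v \<in> zpoly_vars (macaulay_res N d)"
    then obtain j \<alpha> where v: "v = (j, \<alpha>)" "j \<le> N" "\<alpha> \<in> mons_deg N d" using res_vars by blast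
    \<comment> \<open>Closeness of \<open>y\<close> to itself with radius 0 just says that its
      entries lie in the unit ball, and \<open>near_heval\<close> passes this on to the
      value.\<close>
    have le: "absv (heval N d (Psi j) y) \<le> 1"
      using near_heval[of 0 N d "Psi j" y y] coeff_le v y by (simp add: near_def)
    then have "absv (Psi j \<alpha> - heval N d (Psi j) y) \<le> 1"
      using abs_diff[of "Psi j \<alpha>" "heval N d (Psi j) y"] coeff_le[OF v(2,3)] by simp
    then show "near e (at_point Psi v) (at_point ?b v)"
      using v coeff_le small e by (auto simp: at_point_def near_def)
  qed (auto simp: near_add near_mult)
  ultimately show ?thesis by (simp add: near_def \<rho>_def Res_eq)
qed

lemma H_scale: "H (\<lambda>i. a * x i) = (\<lambda>i. a ^ d * H x i)"
  by (auto simp: hmap_apply_def heval_scale)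

lemma H_nonzero: "nonzero_vec N x \<Longrightarrow> nonzero_vec N (H x)"
  using ncz by (auto simp: nonzero_vec_def no_common_zero_def hmap_apply_def)

text \<open>For the lower bound, \<open>x\<close> is divided by a coordinate of absolute value 1,
  which changes no sizes and creates the entry exactly 1 that \<open>rho_le_perturbed\<close>
  requires.\<close>

lemma unit_bounds:
  assumes "vn N x = 1"
  shows "\<rho> \<le> vn N (H x)" "vn N (H x) \<le> 1"
proof -
  have x: "absv (x k) \<le> 1" if "k \<le> N" for k using vnorm_ge[OF that, of x] assms by simp
  have le: "absv (heval N d (Psi j) x) \<le> 1" if "j \<le> N" for j
    using near_heval[of 0 N d "Psi j" x x] coeff_le that x by (simp add: near_def)
  show "vn N (H x) \<le> 1" by (rule vnorm_le) (simp add: hmap_apply_def le)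
  obtain i where i: "i \<le> N" "absv (x i) = 1" using vnorm_attained[of N x] assms by auto
  then have xi: "x i \<noteq> 0" by auto
  let ?y = "\<lambda>k. 1 / x i * x k"
  show "\<rho> \<le> vn N (H x)"
  proof (rule rho_le_perturbed[where i = i and y = ?y])
    obtain k where "vn N (H x) = absv (H x k)" using vnorm_attained by blast
    then show "0 \<le> vn N (H x)" by simp
    show "i \<le> N" "?y i = 1" using i xi by simp_all
    show "absv (?y k) \<le> 1" if "k \<le> N" for k using x[OF that] i by (simp add: abs_divide)
    show "absv (heval N d (Psi j) ?y) \<le> vn N (H x)" if "j \<le> N" for j
      using vnorm_ge[OF that, of "H x"] that i
      unfolding heval_scale by (simp add: abs_mult abs_power abs_divide hmap_apply_def)
  qed
qed

lemma rho_le_1: "\<rho> \<le> 1"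
proof -
  have "vn N (axis_vec 0) = 1"
  proof (rule antisym)
    show "vn N (axis_vec 0) \<le> 1" by (rule vnorm_le) (simp add: axis_vec_def)
    show "1 \<le> vn N (axis_vec 0)" using vnorm_ge[of 0 N "axis_vec 0"] by (simp add: axis_vec_def)
  qed
  from unit_bounds[OF this] show ?thesis by linarith
qed

definition "h x = ln (vn N (H x)) - real d * ln (vn N x)"

lemma h_scale:
  assumes "a \<noteq> 0" "nonzero_vec N x"
  shows "h (\<lambda>i. a * x i) = h x"
proof -
  have "vn N x > 0" "vn N (H x) > 0" using assms H_nonzero by (auto intro: vnorm_pos)
  then show ?thesis using assms(1)
    by (simp add: h_def H_scale vnorm_scale abs_power ln_mult ln_realpow algebra_simps)
qed

lemma h_bounds:
  assumes "nonzero_vec N x"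
  shows "ln \<rho> \<le> h x" "h x \<le> 0"
proof -
  obtain a where a: "a \<noteq> 0" "vn N (\<lambda>i. a * x i) = 1" using vnorm_normalise[OF assms] by blast
  have "ln \<rho> \<le> ln (vn N (H (\<lambda>i. a * x i)))" "ln (vn N (H (\<lambda>i. a * x i))) \<le> 0"
    using unit_bounds[OF a(2)] rho_pos by auto
  then show "ln \<rho> \<le> h x" "h x \<le> 0" using h_scale[OF a(1) assms] a(2) by (auto simp: h_def)
qed

lemma near_H:
  assumes "0 \<le> e" "\<And>i. i \<le> N \<Longrightarrow> near e (x i) (y i)" "i \<le> N"
  shows "near e (H x i) (H y i)"
  using assms coeff_le by (auto simp: hmap_apply_def intro!: near_heval)

text \<open>For close representatives the images differ by less than \<open>\<rho>\<close>, which is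
  at most the norm of either image; by the ultrametric inequality such a change cannot alter the
  norm.\<close>

lemma h_locally_constant:
  assumes x: "nonzero_vec N x" and y: "nonzero_vec N y" and lt: "chordal absv N x y < \<rho>"
  shows "h x = h y"
proof -
  let ?e = "chordal absv N x y"
  have "?e < 1" using lt rho_le_1 by simp
  from chordal_representatives[OF x y this] obtain a b where ab: "a \<noteq> 0" "b \<noteq> 0"
    "vn N (\<lambda>i. a * x i) = 1" "vn N (\<lambda>i. b * y i) = 1" "\<And>i. i \<le> N \<Longrightarrow> near ?e (a * x i) (b * y i)" by blast
  let ?x = "\<lambda>i. a * x i" and ?y = "\<lambda>i. b * y i"
  have n: "near ?e (H ?x i) (H ?y i)" if "i \<le> N" for i by (rule near_H[OF chordal_nonneg ab(5) that])
  have le: "vn N u \<le> vn N w" if "\<And>i. i \<le> N \<Longrightarrow> absv (u i - w i) \<le> ?e" "\<rho> \<le> vn N w" for u w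
  proof (rule vnorm_le)
    fix i assume i: "i \<le> N"
    have "absv (u i) \<le> max (absv (u i - w i)) (absv (w i))" using abs_add[of "u i - w i" "w i"] by simp
    then show "absv (u i) \<le> vn N w" using that(1)[OF i] that(2) vnorm_ge[OF i, of w] lt by linarith
  qed
  have "vn N (H ?x) = vn N (H ?y)"
  proof (rule antisym)
    show "vn N (H ?x) \<le> vn N (H ?y)" using n unit_bounds[OF ab(4)] by (intro le) (auto simp: near_def)
    have "absv (H ?y i - H ?x i) \<le> ?e" if "i \<le> N" for i
      using n[OF that] abs_minus[of "H ?x i - H ?y i"] by (simp add: near_def)
    then show "vn N (H ?y) \<le> vn N (H ?x)" using unit_bounds[OF ab(3)] by (intro le) auto
  qed
  then have "h ?x = h ?y" using ab by (simp add: h_def)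
  then show ?thesis using h_scale[OF ab(1) x] h_scale[OF ab(2) y] by simp
qed

text \<open>For close representatives the minors of the images are at most the distance, while each
  image norm in the denominator is at least \<open>\<rho>\<close>; this is the source of the
  exponent 2. If the distance is not below 1, the bound is trivial.\<close>

lemma chordal_H:
  assumes x: "nonzero_vec N x" and y: "nonzero_vec N y"
  shows "chordal absv N (H x) (H y) \<le> chordal absv N x y / \<rho>\<^sup>2"
proof (cases "chordal absv N x y < 1")
  case False
  have "\<rho>\<^sup>2 \<le> 1" using rho_le_1 rho_pos by (simp add: power_le_one)
  then have "1 \<le> chordal absv N x y / \<rho>\<^sup>2" using False rho_pos by (simp add: field_simps)
  then show ?thesis using chordal_le_1[OF H_nonzero[OF x] H_nonzero[OF y]] by linarith
next
  case True
  let ?e = "chordal absv N x y"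
  from chordal_representatives[OF x y True] obtain a b where ab: "a \<noteq> 0" "b \<noteq> 0"
    "vn N (\<lambda>i. a * x i) = 1" "vn N (\<lambda>i. b * y i) = 1" "\<And>i. i \<le> N \<Longrightarrow> near ?e (a * x i) (b * y i)" by blast
  let ?x = "\<lambda>i. a * x i" and ?y = "\<lambda>i. b * y i"
  have n: "near ?e (H ?x i) (H ?y i)" if "i \<le> N" for i by (rule near_H[OF chordal_nonneg ab(5) that])
  obtain i j where ij: "i \<le> N" "j \<le> N"
    "chordal absv N (H ?x) (H ?y) = absv (H ?x i * H ?y j - H ?x j * H ?y i) / (vn N (H ?x) * vn N (H ?y))"
    using chordal_attained by blast
  \<comment> \<open>Both products in the minor are compared with the same intermediate product, so
    their difference is bounded without any factor.\<close>
  have "near ?e (H ?x i * H ?x j) (H ?x i * H ?y j)" "near ?e (H ?x i * H ?x j) (H ?y i * H ?x j)"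
  proof -
    have "absv (H ?x i) \<le> 1" "absv (H ?x j) \<le> 1" using n[OF ij(1)] n[OF ij(2)] by (simp_all add: near_def)
    then show "near ?e (H ?x i * H ?x j) (H ?x i * H ?y j)" "near ?e (H ?x i * H ?x j) (H ?y i * H ?x j)"
      using n[OF ij(1)] n[OF ij(2)] by (blast intro: near_mult near_refl chordal_nonneg)+
  qed
  then have "absv (H ?x i * H ?x j - H ?x i * H ?y j) \<le> ?e" "absv (H ?x i * H ?x j - H ?y i * H ?x j) \<le> ?e"
    by (simp_all add: near_def)
  then have "absv ((H ?x i * H ?x j - H ?y i * H ?x j) - (H ?x i * H ?x j - H ?x i * H ?y j)) \<le> ?e"
    using abs_diff[of "H ?x i * H ?x j - H ?y i * H ?x j" "H ?x i * H ?x j - H ?x i * H ?y j"] by linarith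
  moreover have "H ?x i * H ?y j - H ?x j * H ?y i = (H ?x i * H ?x j - H ?y i * H ?x j) - (H ?x i * H ?x j - H ?x i * H ?y j)"
    by (simp add: algebra_simps)
  ultimately have num: "absv (H ?x i * H ?y j - H ?x j * H ?y i) \<le> ?e"
    by metis
  have "\<rho>\<^sup>2 \<le> vn N (H ?x) * vn N (H ?y)"
    unfolding power2_eq_square using unit_bounds[OF ab(3)] unit_bounds[OF ab(4)] rho_pos by (intro mult_mono) auto
  then have "chordal absv N (H ?x) (H ?y) \<le> ?e / \<rho>\<^sup>2"
    unfolding ij(3) using num rho_pos chordal_nonneg by (intro frac_le) auto
  moreover have "chordal absv N (H ?x) (H ?y) = chordal absv N (H x) (H y)"
    unfolding H_scale using ab by (intro chordal_scale) auto
  ultimately show ?thesis by simp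
qed

end

subsection \<open>Green functions\<close>

text \<open>Division by \<open>d ^ Suc n\<close> turns the recursion into a telescoping sum. It is
  applied with \<open>A n\<close> the logarithmic size of the \<open>n\<close>-th iterate.\<close>

lemma telescoping_limit:
  fixes A B :: "nat \<Rightarrow> real" and d :: real
  assumes d: "d \<ge> 2" and A: "\<And>n. A (Suc n) = d * A n + B n" and B: "\<And>n. \<bar>B n\<bar> \<le> M"
  shows "summable (\<lambda>n. B n / d ^ Suc n)" "lim (\<lambda>n. A n / d ^ n) = A 0 + suminf (\<lambda>n. B n / d ^ Suc n)"
proof -
  have M: "0 \<le> M" using B[of 0] by linarith
  have "summable (\<lambda>n. M * (1 / d) ^ n)" using d by (intro summable_mult summable_geometric) auto
  moreover have "norm (B n / d ^ Suc n) \<le> M * (1 / d) ^ n" for n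
  proof -
    have "norm (B n / d ^ Suc n) \<le> M / d ^ Suc n" using B[of n] d by (simp add: abs_mult divide_right_mono)
    also have "\<dots> \<le> M / d ^ n" using d M by (intro divide_left_mono) auto
    finally show ?thesis by (simp add: power_divide)
  qed
  ultimately show s: "summable (\<lambda>n. B n / d ^ Suc n)" by (rule summable_comparison_test')
  have "A n / d ^ n = A 0 + (\<Sum>k<n. B k / d ^ Suc k)" for n
  proof (induction n)
    case (Suc n)
    have "A (Suc n) / d ^ Suc n = A n / d ^ n + B n / d ^ Suc n" using d by (simp add: A add_divide_distrib)
    then show ?case using Suc by simp
  qed simp
  moreover have "(\<lambda>n. A 0 + (\<Sum>k<n. B k / d ^ Suc k)) \<longlonglongrightarrow> A 0 + suminf (\<lambda>n. B n / d ^ Suc n)"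
    by (intro tendsto_add tendsto_const summable_LIMSEQ s)
  ultimately show "lim (\<lambda>n. A n / d ^ n) = A 0 + suminf (\<lambda>n. B n / d ^ Suc n)" by (simp add: limI)
qed

text \<open>Only the terms with \<open>u ^ k * \<Delta> \<ge> \<rho>\<close> contribute, and the first such index \<open>k\<close> satisfies
  \<open>1 / d ^ k \<le> (\<Delta> / \<rho>) powr \<kappa>\<close> for \<open>\<kappa> = ln d / ln u\<close>.\<close>
lemma holder_series_bound:
  fixes t :: "nat \<Rightarrow> real" and d u \<rho> \<Delta> :: real
  assumes d: "d \<ge> 2" and u: "u \<ge> 2 * d" "u \<ge> 1 / \<rho>\<^sup>2" and \<rho>: "0 < \<rho>" "\<rho> \<le> 1" and \<Delta>: "0 \<le> \<Delta>"
    and t: "\<And>k. \<bar>t k\<bar> \<le> - ln \<rho>" "\<And>k. u ^ k * \<Delta> < \<rho> \<Longrightarrow> t k = 0"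
  shows "\<bar>suminf (\<lambda>k. t k / d ^ Suc k)\<bar> \<le> 2 * u * ln u / d * \<Delta> powr (ln d / ln u)"
proof (cases "\<Delta> = 0")
  case True
  then have "t k = 0" for k using t(2)[of k] \<rho> by simp
  then show ?thesis using True by simp
next
  case False
  then have \<Delta>': "\<Delta> > 0" using \<Delta> by simp
  define \<kappa> where "\<kappa> = ln d / ln u"
  have u1: "u > 1" "ln u > 0" "ln d > 0" using d u by auto
  have \<kappa>: "\<kappa> > 0" using u1 by (simp add: \<kappa>_def)
  \<comment> \<open>This identity dictates the Hoelder exponent: it converts the growth rate
    \<open>u\<close> of distances into the decay rate \<open>d\<close> of the series.\<close>
  have uk: "u powr \<kappa> = d" using u1 d by (simp add: \<kappa>_def powr_def)
  have "\<exists>n. \<rho> / \<Delta> < u ^ n" using u1 by (intro real_arch_pow) auto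
  then have ex: "\<exists>n. \<rho> \<le> u ^ n * \<Delta>" using \<Delta>' by (auto simp: pos_divide_less_eq intro: less_imp_le)
  define n where "n = (LEAST n. \<rho> \<le> u ^ n * \<Delta>)"
  have n: "\<rho> \<le> u ^ n * \<Delta>" unfolding n_def by (rule LeastI_ex[OF ex])
  have tz: "t k = 0" if "k < n" for k
    using not_less_Least[of k "\<lambda>n. \<rho> \<le> u ^ n * \<Delta>"] that t(2)[of k] by (simp add: n_def not_le)
  define m where "m = - ln \<rho>"
  have m: "0 \<le> m" using \<rho> by (simp add: m_def)
  have geo: "(\<lambda>k. m / d ^ Suc n * (1 / d) ^ k) sums (m / d ^ Suc n * (1 / (1 - 1 / d)))"
    using d by (intro sums_mult geometric_sums) auto
  have bound: "norm (t (k + n) / d ^ Suc (k + n)) \<le> m / d ^ Suc n * (1 / d) ^ k" for k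
  proof -
    have "norm (t (k + n) / d ^ Suc (k + n)) = \<bar>t (k + n)\<bar> / d ^ Suc (k + n)" using d by (simp add: abs_mult)
    also have "\<dots> \<le> m / d ^ Suc (k + n)" using t(1)[of "k + n"] d unfolding m_def by (intro divide_right_mono) auto
    also have "\<dots> = m / d ^ Suc n * (1 / d) ^ k" by (simp add: power_add power_divide mult_ac)
    finally show ?thesis .
  qed
  have sn: "summable (\<lambda>k. t (k + n) / d ^ Suc (k + n))"
    by (rule summable_comparison_test'[OF sums_summable[OF geo]]) (use bound in auto)
  then have s: "summable (\<lambda>k. t k / d ^ Suc k)" by (subst (asm) summable_iff_shift[of "\<lambda>k. t k / d ^ Suc k"])
  have "suminf (\<lambda>k. t k / d ^ Suc k) = suminf (\<lambda>k. t (k + n) / d ^ Suc (k + n))"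
    using suminf_minus_initial_segment[OF s, of n] tz by simp
  also have "\<bar>\<dots>\<bar> \<le> m / d ^ Suc n * (1 / (1 - 1 / d))"
  proof -
    have "norm (suminf (\<lambda>k. t (k + n) / d ^ Suc (k + n))) \<le> suminf (\<lambda>k. m / d ^ Suc n * (1 / d) ^ k)"
      by (rule norm_suminf_le[OF bound sums_summable[OF geo]])
    then show ?thesis using sums_unique[OF geo] by simp
  qed
  also have "\<dots> = m / (d ^ n * (d - 1))" using d by (simp add: field_simps)
  also have "\<dots> \<le> 2 * m / d * (1 / d ^ n)"
  proof -
    \<comment> \<open>Equivalent to \<open>d \<ge> 2\<close>; this is the origin of the factor 2 in
      the estimate of the tail.\<close>
    have "1 / (d - 1) \<le> 2 / d" using d by (simp add: field_simps)
    then have "m / d ^ n * (1 / (d - 1)) \<le> m / d ^ n * (2 / d)" using m d by (intro mult_left_mono) auto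
    then show ?thesis by (simp add: mult_ac)
  qed
  also have "\<dots> \<le> 2 * m / d * (d * \<Delta> powr \<kappa>)"
  proof -
    have "(\<rho> / \<Delta>) powr \<kappa> \<le> (u ^ n) powr \<kappa>"
      using n \<rho> \<Delta>' \<kappa> by (intro powr_mono2) (auto simp: pos_divide_le_eq)
    also have "(u ^ n) powr \<kappa> = d ^ n"
    proof -
      have "(u ^ n) powr \<kappa> = (u powr real n) powr \<kappa>" using u1 by (simp add: powr_realpow)
      also have "\<dots> = (u powr \<kappa>) powr real n" by (simp add: powr_powr mult.commute)
      also have "\<dots> = d ^ n" using d by (simp add: uk powr_realpow)
      finally show ?thesis .
    qed
    finally have "\<rho> powr \<kappa> / \<Delta> powr \<kappa> \<le> d ^ n" using \<rho> \<Delta>' by (simp add: powr_divide)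
    moreover have "1 \<le> d * \<rho> powr \<kappa>"
    proof -
      \<comment> \<open>The bound \<open>\<rho> \<ge> 1 / u\<close> gives
        \<open>\<rho> powr \<kappa> \<ge> 1 / d\<close>, so removing \<open>\<rho>\<close> from the
        estimate costs one factor \<open>d\<close>.\<close>
      have "1 / \<rho> \<le> 1 / \<rho>\<^sup>2" using \<rho> by (simp add: field_simps power2_eq_square)
      then have "1 / \<rho> \<le> u" using u(2) by linarith
      then have "1 \<le> u * \<rho>" using \<rho> by (simp add: field_simps)
      then have "1 powr \<kappa> \<le> (u * \<rho>) powr \<kappa>" using \<kappa> by (intro powr_mono2) auto
      then show ?thesis using u1 \<rho> by (simp add: powr_mult uk)
    qed
    ultimately have "1 / d ^ n \<le> d * \<Delta> powr \<kappa>"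
    proof -
      assume a: "\<rho> powr \<kappa> / \<Delta> powr \<kappa> \<le> d ^ n" and b: "1 \<le> d * \<rho> powr \<kappa>"
      have p: "\<Delta> powr \<kappa> > 0" "d ^ n > 0" using \<Delta>' d by auto
      have "1 \<le> d * \<rho> powr \<kappa>" by (rule b)
      also have "\<dots> \<le> d * (d ^ n * \<Delta> powr \<kappa>)" using a p d by (intro mult_left_mono) (auto simp: pos_divide_le_eq)
      finally show ?thesis using p by (simp add: field_simps)
    qed
    then show ?thesis using m d by (intro mult_left_mono) auto
  qed
  also have "\<dots> = 2 * m * \<Delta> powr \<kappa>" using d by simp
  also have "\<dots> \<le> 2 * u * ln u / d * \<Delta> powr \<kappa>"
  proof -
    \<comment> \<open>The square absorbs the factor 2 in front of \<open>m\<close>; what is left is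
      \<open>ln u\<close>, and \<open>2 * u / d\<close> is at least 1.\<close>
    have "ln (1 / \<rho>\<^sup>2) \<le> ln u" using u \<rho> u1 by (subst ln_le_cancel_iff) auto
    then have "2 * m \<le> ln u" using \<rho> by (simp add: m_def ln_div ln_realpow)
    moreover have "1 * ln u \<le> (2 * u / d) * ln u" using u d u1 by (intro mult_right_mono) (auto simp: field_simps)
    ultimately have "2 * m \<le> 2 * u * ln u / d" by simp
    then show ?thesis by (intro mult_right_mono) auto
  qed
  finally show ?thesis by (simp add: \<kappa>_def)
qed

section \<open>Minimal lifts and the Hoelder bound\<close>

lemma (in nonarch) minimal_lift_exists:
  assumes ncz: "no_common_zero N d Phi"
  shows "\<exists>Psi. minimal_lift_of absv N d Phi Psi"
proof -
  let ?f = "\<lambda>(i, \<alpha>). absv (Phi i \<alpha>)" and ?S = "{..N} \<times> mons_deg N d"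
  have S: "finite ?S" "?S \<noteq> {}" using delta_mons_deg[of 0 N d] by auto
  then have "hmap_norm absv N d Phi \<in> ?f ` ?S" unfolding hmap_norm_def by (intro Max_in) auto
  then obtain i0 \<alpha>0 where a0: "hmap_norm absv N d Phi = absv (Phi i0 \<alpha>0)" "(i0, \<alpha>0) \<in> ?S" by auto
  define a where "a = Phi i0 \<alpha>0"
  have le: "absv (Phi i \<alpha>) \<le> absv a" if "(i, \<alpha>) \<in> ?S" for i \<alpha>
  proof -
    have "?f (i, \<alpha>) \<le> hmap_norm absv N d Phi" unfolding hmap_norm_def using S that by (intro Max_ge) blast+
    then show ?thesis using a0 by (simp add: a_def)
  qed
  have a: "a \<noteq> 0"
  proof
    assume "a = 0"
    then have "Phi i \<alpha> = 0" if "i \<le> N" "\<alpha> \<in> mons_deg N d" for i \<alpha>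
      using le[of i \<alpha>] that abs_nonneg[of "Phi i \<alpha>"] abs_eq_0[of "Phi i \<alpha>"] by auto
    then have "\<forall>i\<le>N. heval N d (Phi i) (axis_vec 0) = 0" by (auto simp: heval_def)
    then have "axis_vec 0 0 = (0 :: 'k)" using ncz unfolding no_common_zero_def by blast
    then show False by (simp add: axis_vec_def)
  qed
  define Psi where "Psi = (\<lambda>i \<alpha>. 1 / a * Phi i \<alpha>)"
  have ev: "heval N d (Psi i) x = 1 / a * heval N d (Phi i) x" for i x
    by (simp only: heval_def Psi_def sum_distrib_left mult.assoc)
  have "no_common_zero N d Psi" using ncz a by (simp add: no_common_zero_def ev)
  moreover have "same_proj_map N d Phi Psi" unfolding same_proj_map_def ev using a by (intro allI impI exI[of _ "1 / a"]) simp
  moreover have "hmap_norm absv N d Psi = 1"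
    unfolding hmap_norm_def
  proof (rule Max_eqI)
    show "finite ((\<lambda>(i, \<alpha>). absv (Psi i \<alpha>)) ` ?S)" using S by blast
    show "y \<le> 1" if "y \<in> (\<lambda>(i, \<alpha>). absv (Psi i \<alpha>)) ` ?S" for y
      using that le a by (auto simp: Psi_def abs_mult abs_divide)
    have "absv (Psi i0 \<alpha>0) = 1" using a by (simp add: Psi_def flip: a_def)
    then show "1 \<in> (\<lambda>(i, \<alpha>). absv (Psi i \<alpha>)) ` ?S" using a0(2) by (auto intro!: rev_image_eqI[of "(i0, \<alpha>0)"])
  qed
  ultimately show ?thesis by (auto simp: minimal_lift_of_def)
qed

theorem theorem17:
  fixes absv :: "'k::field \<Rightarrow> real" and N d :: nat and Phi :: "'k hmap"
    and x y :: "nat \<Rightarrow> 'k"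
  assumes "nonarch_abs absv" and "nontrivial_abs absv" and "complete_abs absv"
    and "alg_closed TYPE('k)"
    and "d \<ge> 2"
    and "no_common_zero N d Phi"
    and "nonzero_vec N x" and "nonzero_vec N y"
  shows "let u = max (2 * real d) (abs_Res absv N d Phi powr (-2)) in
    \<bar>green_hat absv N d Phi x - green_hat absv N d Phi y\<bar>
      \<le> 2 * u * ln u / real d * chordal absv N x y powr (ln (real d) / ln u)"
proof -
  interpret nonarch absv by unfold_locales (rule assms(1))
  define Psi where "Psi = (SOME Psi. minimal_lift_of absv N d Phi Psi)"
  have Psi: "minimal_lift_of absv N d Phi Psi"
    unfolding Psi_def by (rule someI_ex[OF minimal_lift_exists[OF assms(6)]])
  interpret integral_lift absv N d Psi
  proof
    show "d > 0" "alg_closed TYPE('k)" "no_common_zero N d Psi" using assms Psi by (auto simp: minimal_lift_of_def)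
    fix j \<alpha> assume "j \<le> N" "\<alpha> \<in> mons_deg N d"
    then have "(\<lambda>(i, \<alpha>). absv (Psi i \<alpha>)) (j, \<alpha>) \<le> hmap_norm absv N d Psi"
      unfolding hmap_norm_def by (intro Max_ge finite_imageI finite_cartesian_product) auto
    then show "absv (Psi j \<alpha>) \<le> 1" using Psi by (simp add: minimal_lift_of_def)
  qed
  obtain c where c: "c \<noteq> 0" "\<And>x i. nonzero_vec N x \<Longrightarrow> i \<le> N \<Longrightarrow> heval N d (Psi i) x = c * heval N d (Phi i) x"
    using lift_ratio_constant[OF assms(4,6) ncz] Psi by (auto simp: minimal_lift_of_def)
  let ?P = "hmap_apply N d Phi"
  \<comment> \<open>The constant ratio lets the orbit of the given lift be followed with the
    estimates for the minimal one.\<close>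
  have P: "?P v = (\<lambda>i. 1 / c * H v i)" if "nonzero_vec N v" for v
    using c(1) c(2)[OF that] by (auto simp: hmap_apply_def)
  define X where "X v n = (?P ^^ n) v" for v n
  have X_Suc: "X v (Suc n) = ?P (X v n)" and X_0: "X v 0 = v" for v n by (simp_all add: X_def)
  have nz: "nonzero_vec N (X v n)" if "nonzero_vec N v" for v n
  proof (induction n)
    case (Suc n)
    then show ?case unfolding X_Suc P[OF Suc] using H_nonzero[OF Suc] c(1) by (simp add: nonzero_vec_def)
  qed (simp add: X_0 that)
  \<comment> \<open>Passing to the minimal lift adds the same constant to every term for every
    starting vector, so it cancels in the difference of the two series.\<close>
  define B where "B v n = h (X v n) - ln (absv c)" for v n
  have step: "ln (vn N (X v (Suc n))) = real d * ln (vn N (X v n)) + B v n" if "nonzero_vec N v" for v n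
  proof -
    have "vn N (H (X v n)) > 0" using vnorm_pos[OF H_nonzero[OF nz[OF that]]] .
    then have "ln (vn N (X v (Suc n))) = ln (vn N (H (X v n))) - ln (absv c)"
      unfolding X_Suc P[OF nz[OF that]] vnorm_scale using c(1) by (simp add: abs_divide ln_div)
    then show ?thesis by (simp add: B_def h_def)
  qed
  have Bb: "\<bar>B v n\<bar> \<le> - ln \<rho> + \<bar>ln (absv c)\<bar>" if "nonzero_vec N v" for v n
    using h_bounds[OF nz[OF that, of n]] by (auto simp: B_def abs_if)
  have d2: "real d \<ge> 2" using assms(5) by simp
  have series: "summable (\<lambda>n. B v n / real d ^ Suc n)"
    "green_hat absv N d Phi v = suminf (\<lambda>n. B v n / real d ^ Suc n)" if v: "nonzero_vec N v" for v
  proof -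
    note tl = telescoping_limit[OF d2, of "\<lambda>n. ln (vn N (X v n))" "B v", OF step[OF v] Bb[OF v]]
    show "summable (\<lambda>n. B v n / real d ^ Suc n)" by (rule tl(1))
    show "green_hat absv N d Phi v = suminf (\<lambda>n. B v n / real d ^ Suc n)"
      using tl(2) by (simp add: green_hat_def green_def X_def)
  qed
  define t where "t k = h (X x k) - h (X y k)" for k
  have "green_hat absv N d Phi x - green_hat absv N d Phi y = suminf (\<lambda>n. B x n / real d ^ Suc n - B y n / real d ^ Suc n)"
    unfolding series(2)[OF assms(7)] series(2)[OF assms(8)] by (rule suminf_diff[OF series(1)[OF assms(7)] series(1)[OF assms(8)]])
  also have "(\<lambda>n. B x n / real d ^ Suc n - B y n / real d ^ Suc n) = (\<lambda>n. t n / real d ^ Suc n)"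
    by (simp add: B_def t_def diff_divide_distrib)
  finally have diff: "green_hat absv N d Phi x - green_hat absv N d Phi y = suminf (\<lambda>n. t n / real d ^ Suc n)" .
  define u where "u = max (2 * real d) (abs_Res absv N d Phi powr (-2))"
  \<comment> \<open>\<open>Psi\<close> was chosen by the same \<open>SOME\<close> as in
    \<open>abs_Res\<close>, so no independence of the minimal lift has to be shown.\<close>
  have "abs_Res absv N d Phi = \<rho>" by (simp only: abs_Res_def \<rho>_def flip: Psi_def)
  then have u: "u \<ge> 2 * real d" "u \<ge> 1 / \<rho>\<^sup>2"
    using rho_pos by (auto simp: u_def powr_minus powr_numeral divide_inverse)
  have "\<bar>suminf (\<lambda>n. t n / real d ^ Suc n)\<bar> \<le> 2 * u * ln u / real d * chordal absv N x y powr (ln (real d) / ln u)"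
  proof (rule holder_series_bound[OF d2 u rho_pos rho_le_1 chordal_nonneg])
    show "\<bar>t k\<bar> \<le> - ln \<rho>" for k
      using h_bounds[OF nz[OF assms(7), of k]] h_bounds[OF nz[OF assms(8), of k]] by (auto simp: t_def abs_if)
    have "chordal absv N (X x k) (X y k) \<le> u ^ k * chordal absv N x y" for k
    proof (induction k)
      case (Suc k)
      have "chordal absv N (X x (Suc k)) (X y (Suc k)) = chordal absv N (H (X x k)) (H (X y k))"
        unfolding X_Suc P[OF nz[OF assms(7)]] P[OF nz[OF assms(8)]] using c(1) by (intro chordal_scale) auto
      also have "\<dots> \<le> chordal absv N (X x k) (X y k) / \<rho>\<^sup>2" by (rule chordal_H[OF nz[OF assms(7)] nz[OF assms(8)]])
      also have "\<dots> \<le> u * chordal absv N (X x k) (X y k)"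
        using mult_right_mono[OF u(2) chordal_nonneg[of N "X x k" "X y k"]] by simp
      also have "\<dots> \<le> u * (u ^ k * chordal absv N x y)" using Suc u(1) by (intro mult_left_mono) auto
      finally show ?case by (simp add: mult.assoc)
    qed (simp add: X_0)
    then show "t k = 0" if "u ^ k * chordal absv N x y < \<rho>" for k
      using h_locally_constant[OF nz[OF assms(7), of k] nz[OF assms(8), of k]] that by (auto simp: t_def intro: order.strict_trans1)
  qed
  then show ?thesis unfolding Let_def diff u_def .
qed

end
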